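(* Let $\Lambda=[\lambda_{\min},\lambda_{\max}]$ with $0<\lambda_{\min}<\lambda_{\max}<\infty$ and $\Delta_\Lambda=\lambda_{\max}-\lambda_{\min}$. For every constant $K_\Lambda>0$ depending only on $\Lambda$ there is a constant $A_\Lambda>0$ depending only on $\Lambda$ and $K_\Lambda$ such that the following holds for all integers $d\ge 1$ and all reals $k,R$ with $1\le k\le K_\Lambda d$, $R>0$ and $R^2\ge A_\Lambda k$ (that is, $1\le k\lesssim_\Lambda d$ and $R^2\gtrsim_\Lambda k$). (i) (Lower bound.) $$\mathcal R^\star_{\mathrm{LD}}(d,k,R;\Lambda)\ \ge\ c\,\min\left\{\Delta_\Lambda^2,\ \lambda_{\min}^2\left(\frac1d+\frac{k^2}{d^2}\right)\right\},$$ where $c>0$ is an absolute constant. (ii) (MLE upper bound.) For every fixed $P\in\mathcal P_{\mathrm{LD}}(k,R)$, the constrained maximum-likelihood estimator $\widehat\lambda_{\mathrm{MLE},P}$ satisfies $$\sup_{\lambda^\star\in\Lambda}\mathbb E_{\lambda^\star,P}\bigl[(\widehat\lambda_{\mathrm{MLE},P}-\lambda^\star)^2\bigr]\ \le\ C\,\min\left\{\Delta_\Lambda^2,\ \frac{\lambda_{\max}^4}{\lambda_{\min}^2}\left[\frac{\log(2d)}{d}+\frac{(k+\log(2d))^2}{d^2}\right]\right\},$$ where $C>0$ is an absolute constant. (iii) (Rate.) Hence, for a fixed compact precision interval $\Lambda$, $$\mathcal R^\star_{\mathrm{LD}}(d,k,R;\Lambda)=\widetilde\Theta_\Lambda\left(\min\left\{\Delta_\Lambda^2,\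 \frac1d+\frac{k^2}{d^2}\right\}\right),$$ i.e. there are constants $c_\Lambda,C_\Lambda>0$ depending only on $\Lambda$ and an absolute constant $q\ge 0$ such that, with $m:=\min\{\Delta_\Lambda^2,\,d^{-1}+k^2d^{-2}\}$, $$c_\Lambda\, m\ \le\ \mathcal R^\star_{\mathrm{LD}}(d,k,R;\Lambda)\ \le\ C_\Lambda\,(\log(2d))^{q}\, m .$$
   Context: Observation model. Let $P$ be a probability measure on $\mathbb R^d$ (the known signal law). For a precision $\lambda>0$ one observes a single vector $Y=X+\lambda^{-1/2}Z$, where $X\sim P$ and $Z\sim\mathcal N(0,I_d)$ are independent. The law of $Y$ is $P_\lambda=P*\mathcal N(0,\lambda^{-1}I_d)$, with density $$p_\lambda(y)=\left(\frac{\lambda}{2\pi}\right)^{d/2}\int e^{-\frac{\lambda}{2}\|x-y\|^2}\,P(dx).$$ $\mathbb E_{\lambda,P}$ denotes expectation under this model. Risk. $\mathcal R(P;\Lambda)=\inf_{\widehat\lambda_P}\sup_{\lambda\in\Lambda}\mathbb E_{\lambda,P}[(\widehat\lambda_P(Y)-\lambda)^2]$, where the infimum is over all (measurable) estimators $\widehat\lambda_P:\mathbb R^d\to\Lambda$; the estimator may depend arbitrarily on $P$. MLE. With $\ell(\lambda\mid y)=-\log p_\lambda(y)$, the constrained MLE is any (measurable) choice $\widehat\lambda_{\mathrm{MLE},P}\in\arg\min_{\lambda\in\Lambda}\ell(\lambda\mid Y)$. Signal class. Put $r_0=\frac{\sqrt{\lambda_{\min}}}{\lambda_{\max}\sqrt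 d}$. For real $k\ge1$ and $R>0$, $\mathcal P_{\mathrm{LD}}(k,R)$ is the class of probability measures $P$ on $\mathbb R^d$ with $\operatorname{supp}(P)\subseteq B(0,R)$ and $1+\log N(\operatorname{supp}(P),r_0)\le k$, where $B(0,R)$ is the Euclidean ball of radius $R$ centered at $0$ and $N(S,r_0)$ is the Euclidean covering number of $S$ at scale $r_0$ (the least number of Euclidean balls of radius $r_0$ needed to cover $S$). Finally, $$\mathcal R^\star_{\mathrm{LD}}(d,k,R;\Lambda)=\sup_{P\in\mathcal P_{\mathrm{LD}}(k,R)}\mathcal R(P;\Lambda).$$ Absolute constants do not depend on $d,k,R,P,\Lambda$. *)

theory Defs
  imports "HOL-Probability.Probability"
begin

text \<open>
  The constants in the theorem are uniform in the dimension d, so d is a term variable and not a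
  type: a point of R^d is a function on the index set {..<d} (undefined outside), and R^d
  carries the product Borel sigma-algebra, which for a finite product is the Borel sigma-algebra.
\<close>

definition Rd :: "nat \<Rightarrow> (nat \<Rightarrow> real) measure" where
  "Rd d = PiM {..<d} (\<lambda>_. borel)"

definition edist :: "nat \<Rightarrow> (nat \<Rightarrow> real) \<Rightarrow> (nat \<Rightarrow> real) \<Rightarrow> real" where
  "edist d x y = L2_set (\<lambda>i. x i - y i) {..<d}"

definition eball :: "nat \<Rightarrow> (nat \<Rightarrow> real) \<Rightarrow> real \<Rightarrow> (nat \<Rightarrow> real) set" where
  "eball d x r = {y \<in> space (Rd d). edist d x y \<le> r}"

definition origin :: "nat \<Rightarrow> nat \<Rightarrow> real" where
  "origin d = (\<lambda>i\<in>{..<d}. 0)"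

definition prob_measures :: "nat \<Rightarrow> (nat \<Rightarrow> real) measure set" where
  "prob_measures d = {P. prob_space P \<and> sets P = sets (Rd d)}"

definition supp :: "nat \<Rightarrow> (nat \<Rightarrow> real) measure \<Rightarrow> (nat \<Rightarrow> real) set" where
  "supp d P = {x \<in> space (Rd d). \<forall>r>0. emeasure P (eball d x r) > 0}"

text \<open>Centers range over all of R^d.  The number is only meaningful for sets that have a finite
  cover, in particular for bounded sets and r > 0.\<close>

definition covering_number :: "nat \<Rightarrow> (nat \<Rightarrow> real) set \<Rightarrow> real \<Rightarrow> nat" where
  "covering_number d S r =
     (LEAST n. \<exists>T \<subseteq> space (Rd d). finite T \<and> card T = n \<and> S \<subseteq> (\<Union>x\<in>T. eball d x r))"

definition std_gaussian :: "nat \<Rightarrow> (nat \<Rightarrow> real) measure" where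
  "std_gaussian d = PiM {..<d} (\<lambda>_. density lborel std_normal_density)"

text \<open>In the definitions below the precision is called l.  The law of Y = X + Z / sqrt l, with
  (X, Z) distributed according to the product of P and the standard Gaussian:\<close>

definition obs_law :: "nat \<Rightarrow> (nat \<Rightarrow> real) measure \<Rightarrow> real \<Rightarrow> (nat \<Rightarrow> real) measure" where
  "obs_law d P l =
     distr (P \<Otimes>\<^sub>M std_gaussian d) (Rd d) (\<lambda>(x, z). \<lambda>i\<in>{..<d}. x i + z i / sqrt l)"

definition obs_density :: "nat \<Rightarrow> (nat \<Rightarrow> real) measure \<Rightarrow> real \<Rightarrow> (nat \<Rightarrow> real) \<Rightarrow> real" where
  "obs_density d P l y =
     (l / (2 * pi)) powr (real d / 2) * (\<integral>x. exp (- (l / 2) * (edist d x y)\<^sup>2) \<partial>P)"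

definition neg_log_lik :: "nat \<Rightarrow> (nat \<Rightarrow> real) measure \<Rightarrow> real \<Rightarrow> (nat \<Rightarrow> real) \<Rightarrow> real" where
  "neg_log_lik d P l y = - ln (obs_density d P l y)"

definition estimators :: "nat \<Rightarrow> real set \<Rightarrow> ((nat \<Rightarrow> real) \<Rightarrow> real) set" where
  "estimators d \<Lambda> = Rd d \<rightarrow>\<^sub>M restrict_space borel \<Lambda>"

definition max_risk ::
  "nat \<Rightarrow> (nat \<Rightarrow> real) measure \<Rightarrow> real set \<Rightarrow> ((nat \<Rightarrow> real) \<Rightarrow> real) \<Rightarrow> ennreal" where
  "max_risk d P \<Lambda> f = (SUP l\<in>\<Lambda>. \<integral>\<^sup>+y. ennreal ((f y - l)\<^sup>2) \<partial>(obs_law d P l))"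

definition minimax_risk :: "nat \<Rightarrow> (nat \<Rightarrow> real) measure \<Rightarrow> real set \<Rightarrow> ennreal" where
  "minimax_risk d P \<Lambda> = (INF f\<in>estimators d \<Lambda>. max_risk d P \<Lambda> f)"

definition constrained_MLE ::
  "nat \<Rightarrow> (nat \<Rightarrow> real) measure \<Rightarrow> real set \<Rightarrow> ((nat \<Rightarrow> real) \<Rightarrow> real) \<Rightarrow> bool" where
  "constrained_MLE d P \<Lambda> f \<longleftrightarrow>
     f \<in> estimators d \<Lambda> \<and>
     (\<forall>y\<in>space (Rd d). is_arg_min (\<lambda>l. neg_log_lik d P l y) (\<lambda>l. l \<in> \<Lambda>) (f y))"

definition r0 :: "nat \<Rightarrow> real \<Rightarrow> real \<Rightarrow> real" where
  "r0 d lmin lmax = sqrt lmin / (lmax * sqrt (real d))"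

definition LD_class ::
  "nat \<Rightarrow> real \<Rightarrow> real \<Rightarrow> real \<Rightarrow> real \<Rightarrow> (nat \<Rightarrow> real) measure set" where
  "LD_class d k R lmin lmax =
     {P \<in> prob_measures d.
        supp d P \<subseteq> eball d (origin d) R \<and>
        1 + ln (real (covering_number d (supp d P) (r0 d lmin lmax))) \<le> k}"

definition LD_risk :: "nat \<Rightarrow> real \<Rightarrow> real \<Rightarrow> real \<Rightarrow> real \<Rightarrow> ennreal" where
  "LD_risk d k R lmin lmax =
     (SUP P\<in>LD_class d k R lmin lmax. minimax_risk d P {lmin..lmax})"

end

theory Submission
  imports Defs
begin

text \<open>
  For the lower bound, two precisions \<open>l1 < l2\<close> are hard to separate when the signal itself can imitate the
  missing noise.  If \<open>1 / l1 = v + 1 / l2\<close>, a Gaussian signal of variance \<open>v\<close> per coordinate observed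
  at precision \<open>l2\<close> has exactly the law of the zero signal observed at precision \<open>l1\<close>.  Take the signal
  law that is with probability one half the point mass at the origin and otherwise uniform on a finite
  codebook which imitates that Gaussian.  Then half of the observation law at \<open>l1\<close> nearly coincides
  with half of the one at \<open>l2\<close>, and by the two-point method no estimator has squared error much below
  \<open>(l2 - l1)\<^sup>2\<close> at both.  A random codebook of \<open>M\<close> points has mean squared error at most
  \<open>(l2 / l1) ^ d / M\<close> relative to the target Gaussian, because the likelihood ratio of the two laws has
  second moment \<open>(l2 / l1) ^ d\<close>.  With \<open>M\<close> of order \<open>exp k\<close> and \<open>l2 / l1 = 1 + k / (2 d)\<close> this is at
  most of order \<open>exp (- k / 2)\<close>, which yields the term \<open>k\<^sup>2 / d\<^sup>2\<close> (\<open>LD_risk_ge_codebook\<close>, resting on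
  \<open>gaussian_codebook\<close>).  Codewords drawn from the Gaussian conditioned on the ball of radius \<open>R\<close> do
  almost as well, since \<open>d v\<close> is of order \<open>k / lmin\<close> and hence small against \<open>R\<^sup>2\<close>.  The term \<open>1 / d\<close> is the
  classical one, for the point mass at the origin (\<open>LD_risk_ge_parametric\<close>).

  For the upper bound, put \<open>G q = - ln (\<integral>x. exp (- q / 2 * (edist d x y)\<^sup>2) \<partial>P)\<close>, so that the negative log
  likelihood is \<open>G q - d / 2 * ln q\<close> up to a constant.  \<open>G\<close> is concave with \<open>G 0 = 0\<close>.  Write
  \<open>y = x + z / sqrt l\<close> and \<open>W = |z|\<^sup>2 / l\<close>.  Outside an event of probability \<open>1 / d\<close>,
  \<open>G q = q / 2 * W\<close> up to an error of order \<open>k + ln d\<close>, for all \<open>q\<close> comparable to the precisions in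
  question: from above because the cell of the cover that contains \<open>x\<close> is not too light, from below
  because by a union bound over the cover no other cell is much closer to \<open>y\<close> than \<open>x\<close> is.  The radius
  of the cells is chosen to make the discretisation error of order one.  A comparison of values
  alone would give the error \<open>sqrt (k / d)\<close>.  Concavity turns it into a comparison of slopes over
  intervals as long as \<open>q\<close> itself, and so into the error \<open>k / d\<close>: a minimiser \<open>p\<close> below the upper end
  has \<open>d / 2 \<le> G p\<close>, one above the lower end has \<open>G (2 p) - G p \<le> d / 2\<close>
  (\<open>constrained_minimiser_stationary\<close>, \<open>minimiser_error_bound\<close>).  The fluctuation of \<open>|z|\<^sup>2\<close> around \<open>d\<close>
  adds \<open>1 / d\<close> to the risk (\<open>MLE_risk_bound\<close>).

  The two-sided rate combines both bounds, as a measurable constrained MLE exists for every signal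
  law (\<open>constrained_MLE_exists\<close>).
\<close>

section \<open>Supports and covers in Euclidean space\<close>

lemma edist_sq: "(edist d x y)\<^sup>2 = (\<Sum>i<d. (x i - y i)\<^sup>2)"
  by (simp add: edist_def L2_set_def sum_nonneg)

lemma edist_nonneg [simp]: "0 \<le> edist d x y"
  by (simp add: edist_def)

lemma edist_self [simp]: "edist d x x = 0"
  by (simp add: edist_def L2_set_def)

lemma edist_commute: "edist d x y = edist d y x"
  by (simp add: edist_def L2_set_def power2_commute)

lemma edist_triangle: "edist d x z \<le> edist d x y + edist d y z"
  using L2_set_triangle_ineq[of "\<lambda>i. x i - y i" "\<lambda>i. y i - z i" "{..<d}"]
  by (simp add: edist_def)

lemma edist_le_of_coordinates:
  fixes d :: nat
  assumes "\<And>i. i < d \<Longrightarrow> \<bar>x i - y i\<bar> \<le> \<epsilon>"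
  shows "edist d x y \<le> real d * \<epsilon>"
proof -
  have "edist d x y \<le> (\<Sum>i<d. \<bar>x i - y i\<bar>)"
    unfolding edist_def by (rule L2_set_le_sum_abs)
  also have "\<dots> \<le> real d * \<epsilon>"
    using sum_mono[of "{..<d}" "\<lambda>i. \<bar>x i - y i\<bar>" "\<lambda>_. \<epsilon>"] assms by simp
  finally show ?thesis .
qed

lemma abs_coordinate_le_edist: "i < d \<Longrightarrow> \<bar>x i - y i\<bar> \<le> edist d x y"
  using member_le_L2_set[of "{..<d}" i "\<lambda>i. \<bar>x i - y i\<bar>"]
  by (simp add: edist_def L2_set_def)

lemma space_Rd: "space (Rd d) = {..<d} \<rightarrow>\<^sub>E UNIV"
  by (simp add: Rd_def space_PiM)

lemma measurable_coordinate [measurable]: "i < d \<Longrightarrow> (\<lambda>x. x i) \<in> borel_measurable (Rd d)"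
  unfolding Rd_def by measurable

lemma measurable_edist [measurable (raw)]:
  assumes f [measurable]: "f \<in> M \<rightarrow>\<^sub>M Rd d" and g [measurable]: "g \<in> M \<rightarrow>\<^sub>M Rd d"
  shows "(\<lambda>w. edist d (f w) (g w)) \<in> borel_measurable M"
proof -
  have "(\<lambda>w. f w i) \<in> borel_measurable M" "(\<lambda>w. g w i) \<in> borel_measurable M" if "i < d" for i
    using measurable_compose[OF f measurable_coordinate[OF that]]
      measurable_compose[OF g measurable_coordinate[OF that]] by auto
  then show ?thesis
    unfolding edist_def L2_set_def
    by (intro measurable_compose[OF _ borel_measurable_sqrt] borel_measurable_sum
        borel_measurable_power borel_measurable_diff) auto
qed

lemma sets_eball [measurable]: "x \<in> space (Rd d) \<Longrightarrow> eball d x r \<in> sets (Rd d)"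
  unfolding eball_def by measurable

lemma origin_in_space [simp]: "origin d \<in> space (Rd d)"
  by (auto simp: origin_def space_Rd)

lemma edist_eq_0_iff:
  assumes "x \<in> space (Rd d)" "y \<in> space (Rd d)"
  shows "edist d x y = 0 \<longleftrightarrow> x = y"
proof
  assume "edist d x y = 0"
  then have "x i = y i" if "i < d" for i
    using abs_coordinate_le_edist[OF that, of x y] by auto
  then show "x = y"
    using assms by (auto simp: space_Rd intro!: PiE_ext[of x "{..<d}" "\<lambda>_. UNIV" y])
qed auto

text \<open>The complement of the support is a union of null balls, and countably many of them, with rational
  radii and rational centres, already exhaust it.\<close>

lemma AE_in_supp:
  assumes P: "P \<in> prob_measures d"
  shows "AE x in P. x \<in> supp d P"
proof -
  have sP: "sets P = sets (Rd d)" and spP: "space P = space (Rd d)"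
    using P sets_eq_imp_space_eq by (auto simp: prob_measures_def)
  define Q where "Q = {..<d} \<rightarrow>\<^sub>E (\<rat> :: real set)"
  have QR: "Q \<subseteq> space (Rd d)" by (auto simp: Q_def space_Rd)
  have cQ: "countable Q" unfolding Q_def by (intro countable_PiE) (auto simp: countable_rat)
  define F where "F = {(q, r). q \<in> Q \<and> r \<in> (\<rat> :: real set) \<and> emeasure P (eball d q r) = 0}"
  have cF: "countable F"
    by (rule countable_subset[of _ "Q \<times> \<rat>"]) (auto simp: F_def cQ countable_rat)
  have "AE x in P. \<forall>p\<in>F. x \<notin> eball d (fst p) (snd p)"
  proof (subst AE_ball_countable[OF cF], intro ballI)
    fix p assume p: "p \<in> F"
    then have "eball d (fst p) (snd p) \<in> null_sets P"
      using QR by (auto simp: F_def null_sets_def sP intro!: sets_eball)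
    then show "AE x in P. x \<notin> eball d (fst p) (snd p)" by (rule AE_not_in)
  qed
  then show ?thesis
  proof (rule AE_mp, intro AE_I2 impI)
    fix x assume x: "x \<in> space P" and n: "\<forall>p\<in>F. x \<notin> eball d (fst p) (snd p)"
    show "x \<in> supp d P"
    proof (rule ccontr)
      assume "x \<notin> supp d P"
      then obtain r where r: "r > 0" "emeasure P (eball d x r) = 0"
        using x spP by (auto simp: supp_def)
      \<comment> \<open>A rational ball around a rational point, caught between x and the null ball.\<close>
      obtain r' where r': "r' \<in> \<rat>" "r / 4 < r'" "r' < r / 2"
        using Rats_dense_in_real[of "r / 4" "r / 2"] r by auto
      define e where "e = r / (4 * (real d + 1))"
      have e: "e > 0" using r by (simp add: e_def)
      have "\<exists>q\<in>\<rat>. \<bar>x i - q\<bar> \<le> e" for i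
      proof -
        obtain q where "q \<in> \<rat>" "x i - e < q" "q < x i + e"
          using Rats_dense_in_real[of "x i - e" "x i + e"] e by auto
        then show ?thesis by (intro bexI[of _ q]) auto
      qed
      then obtain q0 where q0: "\<And>i. q0 i \<in> \<rat>" "\<And>i. \<bar>x i - q0 i\<bar> \<le> e" by metis
      define q where "q = restrict q0 {..<d}"
      have qQ: "q \<in> Q" using q0 by (auto simp: q_def Q_def)
      have "edist d x q \<le> real d * e"
        by (rule edist_le_of_coordinates) (use q0 in \<open>auto simp: q_def\<close>)
      also have "\<dots> \<le> r / 4" using r by (simp add: e_def field_simps)
      finally have xq: "edist d x q \<le> r / 4" .
      have "eball d q r' \<subseteq> eball d x r"
      proof
        fix z assume z: "z \<in> eball d q r'"
        then have "edist d x z \<le> edist d x q + edist d q z" by (intro edist_triangle)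
        then show "z \<in> eball d x r" using z xq r' r by (auto simp: eball_def)
      qed
      then have "emeasure P (eball d q r') \<le> 0"
        using emeasure_mono[of "eball d q r'" "eball d x r" P] x spP r sP by (auto intro: sets_eball)
      then have "(q, r') \<in> F" using qQ r' by (auto simp: F_def)
      moreover have "x \<in> eball d q r'"
        using x spP xq r' by (auto simp: eball_def edist_commute)
      ultimately show False using n by force
    qed
  qed
qed

text \<open>A fine enough grid is a cover.  This makes the least number in the covering number of a bounded set
  an attained one.\<close>

lemma bounded_set_finite_cover:
  assumes S: "S \<subseteq> eball d (origin d) R" and r: "r > 0"
  shows "\<exists>T\<subseteq>space (Rd d). finite T \<and> S \<subseteq> (\<Union>x\<in>T. eball d x r)"
proof -
  define e where "e = r / (real d + 1)"
  have e: "e > 0" using r by (simp add: e_def)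
  define J where "J = \<lceil>R / e\<rceil> + 1"
  define T where "T = {..<d} \<rightarrow>\<^sub>E (\<lambda>j::int. real_of_int j * e) ` {- J..J}"
  have "finite T" unfolding T_def by (intro finite_PiE) auto
  moreover have "T \<subseteq> space (Rd d)" by (auto simp: T_def space_Rd)
  moreover have "S \<subseteq> (\<Union>x\<in>T. eball d x r)"
  proof
    fix x assume "x \<in> S"
    then have x: "x \<in> space (Rd d)" "edist d (origin d) x \<le> R" using S by (auto simp: eball_def)
    define c where "c = (\<lambda>i\<in>{..<d}. real_of_int \<lfloor>x i / e\<rfloor> * e)"
    have "\<lfloor>x i / e\<rfloor> \<in> {- J..J}" if "i < d" for i
    proof -
      have "\<bar>x i\<bar> \<le> R"
        using abs_coordinate_le_edist[OF that, of "origin d" x] x that by (simp add: origin_def)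
      then have "x i / e \<le> R / e" "- (R / e) \<le> x i / e"
        using e by (auto simp: field_simps abs_le_iff)
      then show ?thesis unfolding J_def by (simp; linarith)
    qed
    then have "c \<in> T" by (auto simp: c_def T_def)
    moreover have "edist d c x \<le> real d * e"
    proof (rule edist_le_of_coordinates)
      fix i assume "i < d"
      have "real_of_int \<lfloor>x i / e\<rfloor> \<le> x i / e" "x i / e \<le> real_of_int \<lfloor>x i / e\<rfloor> + 1"
        by linarith+
      then have "real_of_int \<lfloor>x i / e\<rfloor> * e \<le> x i" "x i \<le> (real_of_int \<lfloor>x i / e\<rfloor> + 1) * e"
        using pos_le_divide_eq[OF e] pos_divide_le_eq[OF e] by blast+
      then show "\<bar>c i - x i\<bar> \<le> e" using \<open>i < d\<close> by (auto simp: c_def algebra_simps)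
    qed
    moreover have "real d * e \<le> r" using r by (simp add: e_def field_simps)
    ultimately show "x \<in> (\<Union>x\<in>T. eball d x r)" using x by (auto simp: eball_def intro!: bexI[of _ c])
  qed
  ultimately show ?thesis by blast
qed

lemma covering_number_attained:
  assumes "S \<subseteq> eball d (origin d) R" "r > 0"
  obtains T where "T \<subseteq> space (Rd d)" "finite T" "card T = covering_number d S r"
    "S \<subseteq> (\<Union>x\<in>T. eball d x r)"
proof -
  have "\<exists>n. \<exists>T\<subseteq>space (Rd d). finite T \<and> card T = n \<and> S \<subseteq> (\<Union>x\<in>T. eball d x r)"
    using bounded_set_finite_cover[OF assms] by blast
  then have "\<exists>T\<subseteq>space (Rd d). finite T \<and> card T = covering_number d S r \<and> S \<subseteq> (\<Union>x\<in>T. eball d x r)"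
    unfolding covering_number_def by (rule LeastI_ex)
  then show ?thesis using that by blast
qed

lemma covering_number_le:
  assumes "T \<subseteq> space (Rd d)" "finite T" "S \<subseteq> (\<Union>x\<in>T. eball d x r)"
  shows "covering_number d S r \<le> card T"
  unfolding covering_number_def by (rule Least_le) (use assms in blast)

section \<open>Gaussian integrals\<close>

abbreviation gauss :: "real \<Rightarrow> real \<Rightarrow> real measure" where
  "gauss m s \<equiv> density lborel (\<lambda>x. ennreal (normal_density m s x))"

lemma product_prob_gauss:
  assumes "\<And>i. i \<in> I \<Longrightarrow> 0 < s i" 
  shows "prob_space (PiM I (\<lambda>i. gauss (m i) (s i)))"
  by (intro prob_space_PiM prob_space_normal_density assms)

lemma sets_PiM_gauss: "sets (PiM {..<d} (\<lambda>i. gauss (m i) (s i))) = sets (Rd d)"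
  unfolding Rd_def by (intro sets_PiM_cong) auto

lemma std_gaussian_eq: "std_gaussian d = PiM {..<d} (\<lambda>_. gauss 0 1)"
  by (simp add: std_gaussian_def)

lemma prob_space_std_gaussian: "prob_space (std_gaussian d)"
  unfolding std_gaussian_eq by (rule product_prob_gauss) simp

lemma sets_std_gaussian [simp, measurable_cong]: "sets (std_gaussian d) = sets (Rd d)"
  unfolding std_gaussian_eq by (rule sets_PiM_gauss)

lemma space_std_gaussian: "space (std_gaussian d) = space (Rd d)"
  using sets_eq_imp_space_eq[OF sets_std_gaussian] .

lemma nn_integral_prod_gauss:
  fixes d :: nat
  assumes s: "s > 0" and f: "\<And>i. i < d \<Longrightarrow> f i \<in> borel_measurable borel"
  shows "(\<integral>\<^sup>+z. (\<Prod>i<d. f i (z i)) \<partial>PiM {..<d} (\<lambda>_. gauss 0 s))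
    = (\<Prod>i<d. \<integral>\<^sup>+t. f i t \<partial>gauss 0 s)"
proof -
  interpret product_sigma_finite "\<lambda>i::nat. gauss 0 s"
    using prob_space_normal_density[OF s, of 0]
    by (auto simp: product_sigma_finite_def prob_space_imp_sigma_finite)
  show ?thesis using product_nn_integral_prod[of "{..<d}" f] f by simp
qed

lemma nn_integral_exp_square:
  assumes a: "a > 0"
  shows "(\<integral>\<^sup>+x. ennreal (exp (- (a * (x - c)\<^sup>2) / 2)) \<partial>lborel) = ennreal (sqrt (2 * pi / a))"
proof -
  define s where "s = 1 / sqrt a"
  have s: "s > 0" "s\<^sup>2 = 1 / a" using a by (auto simp: s_def power_divide)
  have "exp (- (a * (x - c)\<^sup>2) / 2) = sqrt (2 * pi / a) * normal_density c s x" for x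
    using a s by (simp add: normal_density_def)
  then have "(\<integral>\<^sup>+x. ennreal (exp (- (a * (x - c)\<^sup>2) / 2)) \<partial>lborel)
     = ennreal (sqrt (2 * pi / a)) * (\<integral>\<^sup>+x. ennreal (normal_density c s x) \<partial>lborel)"
    using a by (subst nn_integral_cmult[symmetric]) (auto simp: ennreal_mult)
  also have "(\<integral>\<^sup>+x. ennreal (normal_density c s x) \<partial>lborel) = 1"
    using s by (subst nn_integral_eq_integral) auto
  finally show ?thesis by simp
qed

text \<open>Completing the square.  Most of the Gaussian expectations below factor over the coordinates and
  reduce to this one.\<close>

lemma gauss_exp_quadratic:
  assumes s: "s > 0" and b: "2 * b * s\<^sup>2 < 1"
  shows "(\<integral>\<^sup>+x. ennreal (exp (b * x\<^sup>2 + h * x)) \<partial>gauss 0 s)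
    = ennreal (exp (h\<^sup>2 * s\<^sup>2 / (2 * (1 - 2 * b * s\<^sup>2))) / sqrt (1 - 2 * b * s\<^sup>2))"
proof -
  define a where "a = (1 - 2 * b * s\<^sup>2) / s\<^sup>2"
  have a: "a > 0" using s b by (simp add: a_def)
  have as: "a * s\<^sup>2 = 1 - 2 * b * s\<^sup>2" using s by (simp add: a_def)
  have b_eq: "b = (1 / s\<^sup>2 - a) / 2" using s by (simp add: a_def field_simps)
  have e: "normal_density 0 s x * exp (b * x\<^sup>2 + h * x)
      = exp (h\<^sup>2 / (2 * a)) / sqrt (2 * pi * s\<^sup>2) * exp (- (a * (x - h / a)\<^sup>2) / 2)" for x
  proof -
    have "- (x\<^sup>2 / (2 * s\<^sup>2)) + (b * x\<^sup>2 + h * x) = h\<^sup>2 / (2 * a) + (- (a * (x - h / a)\<^sup>2) / 2)"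
      unfolding b_eq using a s by (simp add: field_simps power2_eq_square)
    then have "exp (- (x\<^sup>2 / (2 * s\<^sup>2))) * exp (b * x\<^sup>2 + h * x)
        = exp (h\<^sup>2 / (2 * a)) * exp (- (a * (x - h / a)\<^sup>2) / 2)"
      by (simp only: exp_add[symmetric])
    then show ?thesis by (simp add: normal_density_def)
  qed
  have "(\<integral>\<^sup>+x. ennreal (exp (b * x\<^sup>2 + h * x)) \<partial>gauss 0 s)
      = (\<integral>\<^sup>+x. ennreal (normal_density 0 s x * exp (b * x\<^sup>2 + h * x)) \<partial>lborel)"
    by (subst nn_integral_density) (auto simp: ennreal_mult)
  also have "\<dots> = ennreal (exp (h\<^sup>2 / (2 * a)) / sqrt (2 * pi * s\<^sup>2)) * ennreal (sqrt (2 * pi / a))"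
    unfolding e nn_integral_exp_square[OF a, of "h / a", symmetric]
    by (subst nn_integral_cmult[symmetric]) (auto simp: ennreal_mult'[symmetric])
  also have "\<dots> = ennreal (exp (h\<^sup>2 / (2 * a)) / sqrt (2 * pi * s\<^sup>2) * sqrt (2 * pi / a))"
    using a by (subst ennreal_mult') (auto simp: mult.commute)
  also have "exp (h\<^sup>2 / (2 * a)) / sqrt (2 * pi * s\<^sup>2) * sqrt (2 * pi / a)
      = exp (h\<^sup>2 / (2 * a)) / sqrt (a * s\<^sup>2)"
    using a s by (simp add: real_sqrt_mult real_sqrt_divide field_simps)
  also have "h\<^sup>2 / (2 * a) = h\<^sup>2 * s\<^sup>2 / (2 * (1 - 2 * b * s\<^sup>2))"
    using s a by (simp add: as[symmetric])
  finally show ?thesis by (simp add: as)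
qed

abbreviation noisy :: "nat \<Rightarrow> real \<Rightarrow> (nat \<Rightarrow> real) \<Rightarrow> (nat \<Rightarrow> real) \<Rightarrow> nat \<Rightarrow> real" where
  "noisy d l x z \<equiv> (\<lambda>i\<in>{..<d}. x i + z i / sqrt l)"

lemma measurable_noisy: "(\<lambda>z. noisy d l x z) \<in> Rd d \<rightarrow>\<^sub>M Rd d"
  unfolding Rd_def by (rule measurable_restrict) (auto simp: Rd_def[symmetric])

lemma nn_integral_obs_law:
  assumes P: "P \<in> prob_measures d" and g [measurable]: "g \<in> borel_measurable (Rd d)"
  shows "(\<integral>\<^sup>+y. g y \<partial>obs_law d P l)
    = (\<integral>\<^sup>+x. \<integral>\<^sup>+z. g (noisy d l x z) \<partial>std_gaussian d \<partial>P)"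
proof -
  have sP [measurable_cong]: "sets P = sets (Rd d)" using P by (auto simp: prob_measures_def)
  interpret S: prob_space "std_gaussian d" by (rule prob_space_std_gaussian)
  have m: "(\<lambda>(x, z). \<lambda>i\<in>{..<d}. x i + z i / sqrt l) \<in> P \<Otimes>\<^sub>M std_gaussian d \<rightarrow>\<^sub>M Rd d"
    unfolding Rd_def case_prod_beta
  proof (rule measurable_restrict)
    fix i assume i: "i \<in> {..<d}"
    have "(\<lambda>w. fst w i) \<in> borel_measurable (P \<Otimes>\<^sub>M std_gaussian d)"
      "(\<lambda>w. snd w i) \<in> borel_measurable (P \<Otimes>\<^sub>M std_gaussian d)"
      using i by (auto intro!: measurable_compose[OF _ measurable_coordinate[of i d]])
    then show "(\<lambda>w. fst w i + snd w i / sqrt l) \<in> borel_measurable (P \<Otimes>\<^sub>M std_gaussian d)"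
      by measurable
  qed
  have "(\<integral>\<^sup>+y. g y \<partial>obs_law d P l)
     = (\<integral>\<^sup>+w. g ((\<lambda>(x, z). \<lambda>i\<in>{..<d}. x i + z i / sqrt l) w) \<partial>(P \<Otimes>\<^sub>M std_gaussian d))"
    unfolding obs_law_def by (rule nn_integral_distr[OF m]) simp
  also have "\<dots> = (\<integral>\<^sup>+x. \<integral>\<^sup>+z. g (noisy d l x z) \<partial>std_gaussian d \<partial>P)"
    by (subst S.nn_integral_fst[symmetric]) (use measurable_compose[OF m g] in \<open>auto simp: case_prod_beta\<close>)
  finally show ?thesis .
qed

section \<open>Likelihood ratios of Gaussian laws\<close>

text \<open>The density of the normal law with mean \<open>a\<close> and precision \<open>l2\<close> relative to the centred one with
  precision \<open>l1\<close>, at the point \<open>b\<close>.\<close>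

definition coord_ratio :: "real \<Rightarrow> real \<Rightarrow> real \<Rightarrow> real \<Rightarrow> real" where
  "coord_ratio l1 l2 a b = sqrt (l2 / l1) * exp (l1 / 2 * b\<^sup>2 - l2 / 2 * (b - a)\<^sup>2)"

definition lik_ratio :: "nat \<Rightarrow> real \<Rightarrow> real \<Rightarrow> (nat \<Rightarrow> real) \<Rightarrow> (nat \<Rightarrow> real) \<Rightarrow> real" where
  "lik_ratio d l1 l2 x y = (\<Prod>i<d. coord_ratio l1 l2 (x i) (y i))"

definition centred_gaussian :: "nat \<Rightarrow> real \<Rightarrow> (nat \<Rightarrow> real) measure" where
  "centred_gaussian d v = PiM {..<d} (\<lambda>_. gauss 0 (sqrt v))"

lemma coord_ratio_pos: "0 < l1 \<Longrightarrow> 0 < l2 \<Longrightarrow> 0 < coord_ratio l1 l2 a b"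
  by (simp add: coord_ratio_def)

lemma coord_ratio_nonneg [simp]: "0 < l1 \<Longrightarrow> 0 < l2 \<Longrightarrow> 0 \<le> coord_ratio l1 l2 a b"
  by (rule less_imp_le[OF coord_ratio_pos])

lemma lik_ratio_nonneg [simp]: "0 < l1 \<Longrightarrow> 0 < l2 \<Longrightarrow> 0 \<le> lik_ratio d l1 l2 x y"
  by (simp add: lik_ratio_def prod_nonneg)

lemma normal_density_coord_ratio:
  assumes "0 < l1" "0 < l2"
  shows "normal_density 0 (sqrt (1 / l1)) b * coord_ratio l1 l2 a b = normal_density a (sqrt (1 / l2)) b"
proof -
  have 1: "exp (- (l1 / 2 * b\<^sup>2)) * exp (l1 / 2 * b\<^sup>2 - l2 / 2 * (b - a)\<^sup>2) = exp (- (l2 / 2 * (b - a)\<^sup>2))"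
    by (simp add: exp_add[symmetric])
  have 2: "1 / sqrt (2 * pi * (1 / l1)) * sqrt (l2 / l1) = 1 / sqrt (2 * pi * (1 / l2))"
    using assms by (simp add: real_sqrt_divide real_sqrt_mult)
  have d: "normal_density m (sqrt (1 / l)) b = 1 / sqrt (2 * pi * (1 / l)) * exp (- (l / 2 * (b - m)\<^sup>2))"
    if "0 < l" for l m using that by (simp add: normal_density_def)
  have "normal_density 0 (sqrt (1 / l1)) b * coord_ratio l1 l2 a b
      = (1 / sqrt (2 * pi * (1 / l1)) * sqrt (l2 / l1))
        * (exp (- (l1 / 2 * b\<^sup>2)) * exp (l1 / 2 * b\<^sup>2 - l2 / 2 * (b - a)\<^sup>2))"
  proof -
    have "A * e * (B * e') = A * B * (e * e')" for A B e e' :: real by simp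
    then show ?thesis unfolding d[OF assms(1)] coord_ratio_def diff_0_right .
  qed
  then show ?thesis unfolding 1 2 d[OF assms(2)] .
qed

lemma measurable_coord_ratio [measurable]: "(\<lambda>b. coord_ratio l1 l2 a b) \<in> borel_measurable borel"
  "(\<lambda>a. coord_ratio l1 l2 a b) \<in> borel_measurable borel"
  unfolding coord_ratio_def by measurable

lemma measurable_ratio [measurable (raw)]:
  assumes f: "f \<in> M \<rightarrow>\<^sub>M Rd d" and g: "g \<in> M \<rightarrow>\<^sub>M Rd d"
  shows "(\<lambda>w. lik_ratio d l1 l2 (f w) (g w)) \<in> borel_measurable M"
proof -
  have "(\<lambda>w. coord_ratio l1 l2 (f w i) (g w i)) \<in> borel_measurable M" if "i < d" for i
  proof -
    have [measurable]: "(\<lambda>w. f w i) \<in> borel_measurable M" "(\<lambda>w. g w i) \<in> borel_measurable M"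
      using measurable_compose[OF f measurable_coordinate[OF that]]
        measurable_compose[OF g measurable_coordinate[OF that]] by auto
    show ?thesis unfolding coord_ratio_def by measurable
  qed
  then show ?thesis unfolding lik_ratio_def by (intro borel_measurable_prod) auto
qed

lemma sets_centred [simp, measurable_cong]: "sets (centred_gaussian d v) = sets (Rd d)"
  unfolding centred_gaussian_def by (rule sets_PiM_gauss)

lemma space_centred: "space (centred_gaussian d v) = space (Rd d)"
  using sets_eq_imp_space_eq[OF sets_centred] .

lemma prob_space_centred: "0 < v \<Longrightarrow> prob_space (centred_gaussian d v)"
  unfolding centred_gaussian_def by (rule product_prob_gauss) simp

lemma nn_integral_prod_centred:
  fixes d :: nat
  assumes "0 < v" "\<And>i. i < d \<Longrightarrow> f i \<in> borel_measurable borel"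
  shows "(\<integral>\<^sup>+z. (\<Prod>i<d. f i (z i)) \<partial>centred_gaussian d v) = (\<Prod>i<d. \<integral>\<^sup>+t. f i t \<partial>gauss 0 (sqrt v))"
  unfolding centred_gaussian_def using assms by (intro nn_integral_prod_gauss) auto

lemma distr_gauss_affine:
  assumes l: "0 < l"
  shows "distr (gauss 0 1) borel (\<lambda>t. a + t / sqrt l) = gauss a (sqrt (1 / l))"
proof -
  interpret prob_space "gauss 0 1" by (rule prob_space_normal_density) simp
  have "distributed (gauss 0 1) lborel (\<lambda>x. x) (normal_density 0 1)"
    unfolding distributed_def by (auto simp: distr_id2 intro!: measure_eqI)
  from normal_density_affine[OF this, of "1 / sqrt l" a] l
  have "distributed (gauss 0 1) lborel (\<lambda>x. a + 1 / sqrt l * x) (normal_density a (1 / sqrt l))" by simp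
  then have "distr (gauss 0 1) lborel (\<lambda>x. a + 1 / sqrt l * x) = gauss a (1 / sqrt l)"
    by (rule distributed_distr_eq_density)
  moreover have "distr (gauss 0 1) lborel (\<lambda>x. a + 1 / sqrt l * x) = distr (gauss 0 1) borel (\<lambda>t. a + t / sqrt l)"
    by (rule distr_cong) auto
  ultimately show ?thesis by (simp add: real_sqrt_divide)
qed

lemma prod_sigma_finite_gauss:
  assumes "0 < s"
  shows "product_sigma_finite (\<lambda>i::nat. gauss (m i) s)"
  using prob_space_normal_density[OF assms]
  by (auto simp: product_sigma_finite_def prob_space_imp_sigma_finite)

lemma distr_noise_map:
  assumes l: "0 < l"
  shows "distr (std_gaussian d) (Rd d) (noisy d l x) = PiM {..<d} (\<lambda>i. gauss (x i) (sqrt (1 / l)))"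
proof -
  interpret A: product_sigma_finite "\<lambda>i::nat. gauss (x i) (sqrt (1 / l))"
    by (rule prod_sigma_finite_gauss) (use l in simp)
  interpret B: product_sigma_finite "\<lambda>i::nat. gauss 0 1"
    by (rule prod_sigma_finite_gauss) simp
  have m: "noisy d l x \<in> std_gaussian d \<rightarrow>\<^sub>M Rd d"
    unfolding measurable_cong_sets[OF sets_std_gaussian refl] by (rule measurable_noisy)
  show ?thesis
  proof (rule A.PiM_eqI)
    show "sets (distr (std_gaussian d) (Rd d) (noisy d l x)) = sets (PiM {..<d} (\<lambda>i. gauss (x i) (sqrt (1 / l))))"
      by (simp add: sets_PiM_gauss)
    fix A assume A: "\<And>i. i \<in> {..<d} \<Longrightarrow> A i \<in> sets (gauss (x i) (sqrt (1 / l)))"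
    then have Ab: "\<And>i. i < d \<Longrightarrow> A i \<in> sets borel" by auto
    have PA: "Pi\<^sub>E {..<d} A \<in> sets (Rd d)"
      unfolding Rd_def using Ab by (intro sets_PiM_I_finite) auto
    let ?B = "\<lambda>i. (\<lambda>t. x i + t / sqrt l) -` A i"
    have Bm: "?B i \<in> sets borel" if "i < d" for i
      using measurable_sets[of "\<lambda>t. x i + t / sqrt l" borel borel "A i"] Ab[OF that] by auto
    have "emeasure (distr (std_gaussian d) (Rd d) (noisy d l x)) (Pi\<^sub>E {..<d} A)
       = emeasure (std_gaussian d) (noisy d l x -` Pi\<^sub>E {..<d} A \<inter> space (std_gaussian d))"
      by (rule emeasure_distr[OF m PA])
    also have "noisy d l x -` Pi\<^sub>E {..<d} A \<inter> space (std_gaussian d) = Pi\<^sub>E {..<d} ?B"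
      unfolding space_std_gaussian space_Rd by (auto simp: PiE_iff)
    also have "emeasure (std_gaussian d) (Pi\<^sub>E {..<d} ?B) = (\<Prod>i<d. emeasure (gauss 0 1) (?B i))"
      unfolding std_gaussian_eq using Bm by (subst B.emeasure_PiM) auto
    also have "\<dots> = (\<Prod>i<d. emeasure (gauss (x i) (sqrt (1 / l))) (A i))"
    proof (rule prod.cong[OF refl])
      fix i assume "i \<in> {..<d}"
      then show "emeasure (gauss 0 1) (?B i) = emeasure (gauss (x i) (sqrt (1 / l))) (A i)"
        unfolding distr_gauss_affine[OF l, symmetric] using Ab by (subst emeasure_distr) auto
    qed
    finally show "emeasure (distr (std_gaussian d) (Rd d) (noisy d l x)) (Pi\<^sub>E {..<d} A)
      = (\<Prod>i<d. emeasure (gauss (x i) (sqrt (1 / l))) (A i))" .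
  qed simp
qed

lemma density_centred_ratio:
  assumes l: "0 < l1" "0 < l2" and x: "x \<in> space (Rd d)"
  shows "density (centred_gaussian d (1 / l1)) (\<lambda>y. ennreal (lik_ratio d l1 l2 x y)) = PiM {..<d} (\<lambda>i. gauss (x i) (sqrt (1 / l2)))"
proof -
  interpret A: product_sigma_finite "\<lambda>i::nat. gauss (x i) (sqrt (1 / l2))"
    by (rule prod_sigma_finite_gauss) (use l in simp)
  have mr: "(\<lambda>y. lik_ratio d l1 l2 x y) \<in> borel_measurable (Rd d)"
    by (rule measurable_ratio[where f = "\<lambda>_. x" and g = "\<lambda>y. y"]) (use x in auto)
  show ?thesis
  proof (rule A.PiM_eqI)
    show "sets (density (centred_gaussian d (1 / l1)) (\<lambda>y. ennreal (lik_ratio d l1 l2 x y))) = sets (PiM {..<d} (\<lambda>i. gauss (x i) (sqrt (1 / l2))))"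
      by (simp add: sets_PiM_gauss)
    fix A assume A: "\<And>i. i \<in> {..<d} \<Longrightarrow> A i \<in> sets (gauss (x i) (sqrt (1 / l2)))"
    then have Ab: "\<And>i. i < d \<Longrightarrow> A i \<in> sets borel" by auto
    have PA: "Pi\<^sub>E {..<d} A \<in> sets (Rd d)"
      unfolding Rd_def using Ab by (intro sets_PiM_I_finite) auto
    have "emeasure (density (centred_gaussian d (1 / l1)) (\<lambda>y. ennreal (lik_ratio d l1 l2 x y))) (Pi\<^sub>E {..<d} A)
      = (\<integral>\<^sup>+y. ennreal (lik_ratio d l1 l2 x y) * indicator (Pi\<^sub>E {..<d} A) y \<partial>centred_gaussian d (1 / l1))"
      using mr PA by (subst emeasure_density) (auto cong: measurable_cong_sets)
    also have "\<dots> = (\<integral>\<^sup>+y. (\<Prod>i<d. ennreal (coord_ratio l1 l2 (x i) (y i)) * indicator (A i) (y i)) \<partial>centred_gaussian d (1 / l1))"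
    proof (rule nn_integral_cong)
      fix y assume "y \<in> space (centred_gaussian d (1 / l1))"
      then have "y \<in> extensional {..<d}" by (auto simp: space_centred space_Rd PiE_iff)
      then have "indicator (Pi\<^sub>E {..<d} A) y = (\<Prod>i<d. indicator (A i) (y i) :: ennreal)"
        by (auto simp: indicator_def PiE_iff prod_zero_iff)
      then show "ennreal (lik_ratio d l1 l2 x y) * indicator (Pi\<^sub>E {..<d} A) y
        = (\<Prod>i<d. ennreal (coord_ratio l1 l2 (x i) (y i)) * indicator (A i) (y i))"
        using l by (simp add: lik_ratio_def prod_ennreal prod.distrib)
    qed
    also have "\<dots> = (\<Prod>i<d. \<integral>\<^sup>+b. ennreal (coord_ratio l1 l2 (x i) b) * indicator (A i) b \<partial>gauss 0 (sqrt (1 / l1)))"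
      using l Ab by (intro nn_integral_prod_centred) auto
    also have "\<dots> = (\<Prod>i<d. emeasure (gauss (x i) (sqrt (1 / l2))) (A i))"
    proof (rule prod.cong[OF refl])
      fix i assume i: "i \<in> {..<d}"
      have "(\<integral>\<^sup>+b. ennreal (coord_ratio l1 l2 (x i) b) * indicator (A i) b \<partial>gauss 0 (sqrt (1 / l1)))
        = (\<integral>\<^sup>+b. ennreal (normal_density 0 (sqrt (1 / l1)) b * coord_ratio l1 l2 (x i) b) * indicator (A i) b \<partial>lborel)"
        using Ab[of i] i l by (subst nn_integral_density) (auto simp: ennreal_mult mult.assoc)
      also have "\<dots> = emeasure (gauss (x i) (sqrt (1 / l2))) (A i)"
        unfolding normal_density_coord_ratio[OF l] using Ab[of i] i by (subst emeasure_density) auto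
      finally show "(\<integral>\<^sup>+b. ennreal (coord_ratio l1 l2 (x i) b) * indicator (A i) b \<partial>gauss 0 (sqrt (1 / l1)))
        = emeasure (gauss (x i) (sqrt (1 / l2))) (A i)" .
    qed
    finally show "emeasure (density (centred_gaussian d (1 / l1)) (\<lambda>y. ennreal (lik_ratio d l1 l2 x y))) (Pi\<^sub>E {..<d} A)
      = (\<Prod>i<d. emeasure (gauss (x i) (sqrt (1 / l2))) (A i))" .
  qed simp
qed

lemma nn_integral_noise_eq:
  assumes l: "0 < l1" "0 < l2" and x: "x \<in> space (Rd d)" and g: "g \<in> borel_measurable (Rd d)"
  shows "(\<integral>\<^sup>+z. g (noisy d l2 x z) \<partial>std_gaussian d)
    = (\<integral>\<^sup>+y. ennreal (lik_ratio d l1 l2 x y) * g y \<partial>centred_gaussian d (1 / l1))"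
proof -
  have m: "noisy d l2 x \<in> std_gaussian d \<rightarrow>\<^sub>M Rd d"
    unfolding measurable_cong_sets[OF sets_std_gaussian refl] by (rule measurable_noisy)
  have mr: "(\<lambda>y. lik_ratio d l1 l2 x y) \<in> borel_measurable (Rd d)"
    by (rule measurable_ratio[where f = "\<lambda>_. x" and g = "\<lambda>y. y"]) (use x in auto)
  have "(\<integral>\<^sup>+z. g (noisy d l2 x z) \<partial>std_gaussian d) = (\<integral>\<^sup>+y. g y \<partial>distr (std_gaussian d) (Rd d) (noisy d l2 x))"
    using nn_integral_distr[OF m, of g] g by simp
  also have "\<dots> = (\<integral>\<^sup>+y. g y \<partial>density (centred_gaussian d (1 / l1)) (\<lambda>y. ennreal (lik_ratio d l1 l2 x y)))"
    by (simp only: distr_noise_map[OF l(2)] density_centred_ratio[OF l x])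
  also have "\<dots> = (\<integral>\<^sup>+y. ennreal (lik_ratio d l1 l2 x y) * g y \<partial>centred_gaussian d (1 / l1))"
    using g mr by (intro nn_integral_density) (auto cong: measurable_cong_sets)
  finally show ?thesis .
qed

lemma coord_ratio_expand:
  "coord_ratio l1 l2 a b = sqrt (l2 / l1) * exp (- (l2 / 2 * a\<^sup>2)) * exp ((l1 - l2) / 2 * b\<^sup>2 + l2 * a * b)"
  unfolding coord_ratio_def mult.assoc exp_add[symmetric] by (simp add: power2_eq_square field_simps)

lemma coord_ratio_swap_expand:
  "coord_ratio l1 l2 a b = sqrt (l2 / l1) * exp ((l1 - l2) / 2 * b\<^sup>2) * exp (- (l2 / 2) * a\<^sup>2 + l2 * b * a)"
  unfolding coord_ratio_def mult.assoc exp_add[symmetric] by (simp add: power2_eq_square field_simps)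

lemma coord_ratio_second_moment:
  assumes l: "0 < l1" "l1 \<le> l2"
  shows "(\<integral>\<^sup>+b. ennreal ((coord_ratio l1 l2 a b)\<^sup>2) \<partial>gauss 0 (sqrt (1 / l1)))
    = ennreal (l2 / sqrt (l1 * (2 * l2 - l1)) * exp (l1 * l2 / (2 * l2 - l1) * a\<^sup>2))"
proof -
  define \<alpha> where "\<alpha> = 2 * l2 - l1"
  have \<alpha>: "0 < \<alpha>" and l2: "0 < l2" using l by (auto simp: \<alpha>_def)
  have s: "1 - 2 * (l1 - l2) * (sqrt (1 / l1))\<^sup>2 = \<alpha> / l1"
    using l by (simp add: \<alpha>_def field_simps)
  have "0 < \<alpha> / l1" using \<alpha> l by simp
  with s have lt: "2 * (l1 - l2) * (sqrt (1 / l1))\<^sup>2 < 1" by linarith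
  let ?C = "l2 / l1 * exp (- (l2 * a\<^sup>2))"
  have "(coord_ratio l1 l2 a b)\<^sup>2 = ?C * exp ((l1 - l2) * b\<^sup>2 + 2 * l2 * a * b)" for b
    unfolding coord_ratio_expand power_mult_distrib using l
    by (simp add: power2_eq_square exp_add[symmetric] algebra_simps)
  then have "ennreal ((coord_ratio l1 l2 a b)\<^sup>2) = ennreal ?C * ennreal (exp ((l1 - l2) * b\<^sup>2 + 2 * l2 * a * b))" for b
    using l by (simp only: ennreal_mult[OF mult_nonneg_nonneg[OF divide_nonneg_nonneg exp_ge_zero] exp_ge_zero])
  then have "(\<integral>\<^sup>+b. ennreal ((coord_ratio l1 l2 a b)\<^sup>2) \<partial>gauss 0 (sqrt (1 / l1)))
     = (\<integral>\<^sup>+b. ennreal ?C * ennreal (exp ((l1 - l2) * b\<^sup>2 + 2 * l2 * a * b)) \<partial>gauss 0 (sqrt (1 / l1)))"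
    by (simp only:)
  also have "\<dots> = ennreal ?C * (\<integral>\<^sup>+b. ennreal (exp ((l1 - l2) * b\<^sup>2 + 2 * l2 * a * b)) \<partial>gauss 0 (sqrt (1 / l1)))"
    by (rule nn_integral_cmult) auto
  also have "(\<integral>\<^sup>+b. ennreal (exp ((l1 - l2) * b\<^sup>2 + 2 * l2 * a * b)) \<partial>gauss 0 (sqrt (1 / l1)))
      = ennreal (exp ((2 * l2 * a)\<^sup>2 * (sqrt (1 / l1))\<^sup>2 / (2 * (\<alpha> / l1))) / sqrt (\<alpha> / l1))"
    using gauss_exp_quadratic[of "sqrt (1 / l1)" "l1 - l2" "2 * l2 * a"] l lt unfolding s by simp
  also have "ennreal ?C * \<dots> = ennreal (?C * (exp ((2 * l2 * a)\<^sup>2 * (sqrt (1 / l1))\<^sup>2 / (2 * (\<alpha> / l1))) / sqrt (\<alpha> / l1)))"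
    using l \<alpha> by (intro ennreal_mult[symmetric]) auto
  also have "?C * (exp ((2 * l2 * a)\<^sup>2 * (sqrt (1 / l1))\<^sup>2 / (2 * (\<alpha> / l1))) / sqrt (\<alpha> / l1))
     = (l2 / l1 / sqrt (\<alpha> / l1)) * exp (- (l2 * a\<^sup>2) + (2 * l2 * a)\<^sup>2 * (sqrt (1 / l1))\<^sup>2 / (2 * (\<alpha> / l1)))"
    by (subst exp_add) simp
  also have "- (l2 * a\<^sup>2) + (2 * l2 * a)\<^sup>2 * (sqrt (1 / l1))\<^sup>2 / (2 * (\<alpha> / l1)) = l1 * l2 / \<alpha> * a\<^sup>2"
  proof -
    have "(2 * l2 * a)\<^sup>2 * (sqrt (1 / l1))\<^sup>2 / (2 * (\<alpha> / l1)) = 2 * l2\<^sup>2 * a\<^sup>2 / \<alpha>"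
      using l \<alpha> by (simp add: power_mult_distrib)
    moreover have "- (l2 * a\<^sup>2) + 2 * l2\<^sup>2 * a\<^sup>2 / \<alpha> = (2 * l2\<^sup>2 * a\<^sup>2 - l2 * a\<^sup>2 * \<alpha>) / \<alpha>"
      using \<alpha> by (simp add: diff_divide_distrib)
    moreover have "2 * l2\<^sup>2 * a\<^sup>2 - l2 * a\<^sup>2 * \<alpha> = l1 * l2 * a\<^sup>2"
      by (simp add: \<alpha>_def power2_eq_square algebra_simps)
    ultimately show ?thesis by simp
  qed
  also have "l2 / l1 / sqrt (\<alpha> / l1) = l2 / sqrt (l1 * \<alpha>)"
    using l \<alpha> by (simp add: real_sqrt_divide real_sqrt_mult field_simps)
  finally show ?thesis unfolding \<alpha>_def .
qed

text \<open>The convolution of the normal laws of variances \<open>1 / l1 - 1 / l2\<close> and \<open>1 / l2\<close> is the one of variance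
  \<open>1 / l1\<close>, relative to which its density is 1.\<close>

lemma coord_ratio_mixture:
  assumes l: "0 < l1" "l1 < l2"
  shows "(\<integral>\<^sup>+a. ennreal (coord_ratio l1 l2 a b) \<partial>gauss 0 (sqrt (1 / l1 - 1 / l2))) = 1"
proof -
  define v where "v = 1 / l1 - 1 / l2"
  have v: "0 < v" using l by (simp add: v_def frac_less2)
  have s: "1 - 2 * (- (l2 / 2)) * (sqrt v)\<^sup>2 = l2 / l1"
    using l v by (simp add: v_def field_simps)
  let ?C = "sqrt (l2 / l1) * exp ((l1 - l2) / 2 * b\<^sup>2)"
  have "(\<integral>\<^sup>+a. ennreal (coord_ratio l1 l2 a b) \<partial>gauss 0 (sqrt v))
     = (\<integral>\<^sup>+a. ennreal ?C * ennreal (exp (- (l2 / 2) * a\<^sup>2 + l2 * b * a)) \<partial>gauss 0 (sqrt v))"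
    unfolding coord_ratio_swap_expand using l by (simp add: ennreal_mult)
  also have "\<dots> = ennreal ?C * (\<integral>\<^sup>+a. ennreal (exp (- (l2 / 2) * a\<^sup>2 + l2 * b * a)) \<partial>gauss 0 (sqrt v))"
    by (rule nn_integral_cmult) auto
  also have "(\<integral>\<^sup>+a. ennreal (exp (- (l2 / 2) * a\<^sup>2 + l2 * b * a)) \<partial>gauss 0 (sqrt v))
     = ennreal (exp ((l2 * b)\<^sup>2 * (sqrt v)\<^sup>2 / (2 * (l2 / l1))) / sqrt (l2 / l1))"
  proof -
    have "2 * (- (l2 / 2)) * (sqrt v)\<^sup>2 \<le> 0" using l v by simp
    then show ?thesis
      using gauss_exp_quadratic[of "sqrt v" "- (l2 / 2)" "l2 * b"] v unfolding s by simp
  qed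
  also have "ennreal ?C * \<dots> = ennreal (?C * (exp ((l2 * b)\<^sup>2 * (sqrt v)\<^sup>2 / (2 * (l2 / l1))) / sqrt (l2 / l1)))"
    using l by (intro ennreal_mult[symmetric]) auto
  also have "?C * (exp ((l2 * b)\<^sup>2 * (sqrt v)\<^sup>2 / (2 * (l2 / l1))) / sqrt (l2 / l1))
     = exp ((l1 - l2) / 2 * b\<^sup>2 + (l2 * b)\<^sup>2 * (sqrt v)\<^sup>2 / (2 * (l2 / l1)))"
    using l by (simp add: exp_add)
  also have "(l1 - l2) / 2 * b\<^sup>2 + (l2 * b)\<^sup>2 * (sqrt v)\<^sup>2 / (2 * (l2 / l1)) = 0"
    using l v by (simp add: v_def power_mult_distrib power2_eq_square field_simps)
  finally show ?thesis by (simp add: v_def)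
qed

lemma coord_ratio_mean_second_moment:
  assumes l: "0 < l1" "l1 < l2"
  shows "(\<integral>\<^sup>+a. ennreal (l2 / sqrt (l1 * (2 * l2 - l1)) * exp (l1 * l2 / (2 * l2 - l1) * a\<^sup>2)) \<partial>gauss 0 (sqrt (1 / l1 - 1 / l2)))
    = ennreal (l2 / l1)"
proof -
  define \<alpha> where "\<alpha> = 2 * l2 - l1"
  define v where "v = 1 / l1 - 1 / l2"
  have \<alpha>: "0 < \<alpha>" and l2: "0 < l2" using l by (auto simp: \<alpha>_def)
  have v: "0 < v" using l by (simp add: v_def frac_less2)
  have s: "1 - 2 * (l1 * l2 / \<alpha>) * (sqrt v)\<^sup>2 = l1 / \<alpha>"
  proof -
    have "l1 * l2 * v = l2 - l1" using l by (simp add: v_def field_simps)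
    then have "2 * (l1 * l2 / \<alpha>) * (sqrt v)\<^sup>2 = 2 * (l2 - l1) / \<alpha>" using v by simp
    moreover have "1 - 2 * (l2 - l1) / \<alpha> = (\<alpha> - 2 * (l2 - l1)) / \<alpha>"
      using \<alpha> by (simp add: diff_divide_distrib)
    moreover have "\<alpha> - 2 * (l2 - l1) = l1" by (simp add: \<alpha>_def)
    ultimately show ?thesis by (simp only:)
  qed
  have "0 < l1 / \<alpha>" using l \<alpha> by simp
  then have lt: "2 * (l1 * l2 / \<alpha>) * (sqrt v)\<^sup>2 < 1" using s by simp
  have "(\<integral>\<^sup>+a. ennreal (l2 / sqrt (l1 * \<alpha>) * exp (l1 * l2 / \<alpha> * a\<^sup>2)) \<partial>gauss 0 (sqrt v))
     = (\<integral>\<^sup>+a. ennreal (l2 / sqrt (l1 * \<alpha>)) * ennreal (exp (l1 * l2 / \<alpha> * a\<^sup>2 + 0 * a)) \<partial>gauss 0 (sqrt v))"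
    using l \<alpha> by (simp add: ennreal_mult[symmetric])
  also have "\<dots> = ennreal (l2 / sqrt (l1 * \<alpha>)) * (\<integral>\<^sup>+a. ennreal (exp (l1 * l2 / \<alpha> * a\<^sup>2 + 0 * a)) \<partial>gauss 0 (sqrt v))"
    by (rule nn_integral_cmult) auto
  also have "(\<integral>\<^sup>+a. ennreal (exp (l1 * l2 / \<alpha> * a\<^sup>2 + 0 * a)) \<partial>gauss 0 (sqrt v)) = ennreal (1 / sqrt (l1 / \<alpha>))"
    using gauss_exp_quadratic[of "sqrt v" "l1 * l2 / \<alpha>" 0] v lt unfolding s by simp
  also have "ennreal (l2 / sqrt (l1 * \<alpha>)) * \<dots> = ennreal (l2 / sqrt (l1 * \<alpha>) * (1 / sqrt (l1 / \<alpha>)))"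
    using l \<alpha> by (intro ennreal_mult[symmetric]) auto
  also have "l2 / sqrt (l1 * \<alpha>) * (1 / sqrt (l1 / \<alpha>)) = l2 / l1"
    using l \<alpha> by (simp add: real_sqrt_divide real_sqrt_mult)
  finally show ?thesis by (simp add: \<alpha>_def v_def)
qed

lemma lik_ratio_second_moment:
  assumes l: "0 < l1" "l1 \<le> l2"
  shows "(\<integral>\<^sup>+y. ennreal ((lik_ratio d l1 l2 x y)\<^sup>2) \<partial>centred_gaussian d (1 / l1))
    = (\<Prod>i<d. ennreal (l2 / sqrt (l1 * (2 * l2 - l1)) * exp (l1 * l2 / (2 * l2 - l1) * (x i)\<^sup>2)))"
proof -
  have "(\<integral>\<^sup>+y. ennreal ((lik_ratio d l1 l2 x y)\<^sup>2) \<partial>centred_gaussian d (1 / l1))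
     = (\<integral>\<^sup>+y. (\<Prod>i<d. ennreal ((coord_ratio l1 l2 (x i) (y i))\<^sup>2)) \<partial>centred_gaussian d (1 / l1))"
    by (simp add: lik_ratio_def prod_power_distrib prod_ennreal)
  also have "\<dots> = (\<Prod>i<d. \<integral>\<^sup>+b. ennreal ((coord_ratio l1 l2 (x i) b)\<^sup>2) \<partial>gauss 0 (sqrt (1 / l1)))"
    using l by (intro nn_integral_prod_centred) auto
  finally show ?thesis by (simp only: coord_ratio_second_moment[OF l])
qed

text \<open>A Gaussian signal of variance \<open>1 / l1 - 1 / l2\<close> seen at precision \<open>l2\<close> cannot be told from no signal
  at precision \<open>l1\<close>.\<close>

lemma lik_ratio_mixture:
  assumes l: "0 < l1" "l1 < l2"
  shows "(\<integral>\<^sup>+x. ennreal (lik_ratio d l1 l2 x y) \<partial>centred_gaussian d (1 / l1 - 1 / l2)) = 1"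
proof -
  have v: "0 < 1 / l1 - 1 / l2" using l by (simp add: frac_less2)
  have "(\<integral>\<^sup>+x. ennreal (lik_ratio d l1 l2 x y) \<partial>centred_gaussian d (1 / l1 - 1 / l2))
     = (\<integral>\<^sup>+x. (\<Prod>i<d. ennreal (coord_ratio l1 l2 (x i) (y i))) \<partial>centred_gaussian d (1 / l1 - 1 / l2))"
    using l by (simp add: lik_ratio_def prod_ennreal)
  also have "\<dots> = (\<Prod>i<d. \<integral>\<^sup>+a. ennreal (coord_ratio l1 l2 a (y i)) \<partial>gauss 0 (sqrt (1 / l1 - 1 / l2)))"
    using v by (intro nn_integral_prod_centred) auto
  finally show ?thesis by (simp add: coord_ratio_mixture[OF l])
qed

text \<open>The mean squared error of a random codebook is at most this quantity divided by the number of
  codewords.\<close>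

lemma lik_ratio_mean_second_moment:
  assumes l: "0 < l1" "l1 < l2"
  shows "(\<integral>\<^sup>+x. \<integral>\<^sup>+y. ennreal ((lik_ratio d l1 l2 x y)\<^sup>2) \<partial>centred_gaussian d (1 / l1) \<partial>centred_gaussian d (1 / l1 - 1 / l2))
    = ennreal ((l2 / l1) ^ d)"
proof -
  have v: "0 < 1 / l1 - 1 / l2" using l by (simp add: frac_less2)
  have "(\<integral>\<^sup>+x. \<integral>\<^sup>+y. ennreal ((lik_ratio d l1 l2 x y)\<^sup>2) \<partial>centred_gaussian d (1 / l1) \<partial>centred_gaussian d (1 / l1 - 1 / l2))
    = (\<Prod>i<d. \<integral>\<^sup>+a. ennreal (l2 / sqrt (l1 * (2 * l2 - l1)) * exp (l1 * l2 / (2 * l2 - l1) * a\<^sup>2))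
        \<partial>gauss 0 (sqrt (1 / l1 - 1 / l2)))"
    unfolding lik_ratio_second_moment[OF l(1) less_imp_le[OF l(2)]]
    by (rule nn_integral_prod_centred[OF v]) auto
  then show ?thesis
    using l by (simp only: coord_ratio_mean_second_moment[OF l]) (simp add: ennreal_power)
qed

text \<open>Markov's inequality for the squared norm.\<close>

lemma centred_ball_mass:
  assumes v: "0 < v" and R: "0 < R"
  shows "1 - real d * v / R\<^sup>2 \<le> measure (centred_gaussian d v) (eball d (origin d) R)"
proof -
  interpret prob_space "centred_gaussian d v" by (rule prob_space_centred[OF v])
  let ?B = "eball d (origin d) R"
  have B: "?B \<in> sets (centred_gaussian d v)" by (simp add: sets_eball)
  have sq: "(edist d (origin d) x)\<^sup>2 = (\<Sum>i<d. (x i)\<^sup>2)" for x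
    by (simp add: edist_sq origin_def)
  have "emeasure (centred_gaussian d v) (space (centred_gaussian d v) - ?B) = (\<integral>\<^sup>+x. indicator (space (centred_gaussian d v) - ?B) x \<partial>centred_gaussian d v)"
    by (rule nn_integral_indicator[symmetric, OF sets.compl_sets[OF B]])
  also have "\<dots> \<le> (\<integral>\<^sup>+x. (\<Sum>i<d. ennreal ((x i)\<^sup>2 / R\<^sup>2)) \<partial>centred_gaussian d v)"
  proof (rule nn_integral_mono)
    fix x assume x: "x \<in> space (centred_gaussian d v)"
    show "indicator (space (centred_gaussian d v) - ?B) x \<le> (\<Sum>i<d. ennreal ((x i)\<^sup>2 / R\<^sup>2))"
    proof (cases "x \<in> ?B")
      case False
      then have "R \<le> edist d (origin d) x" using x by (auto simp: eball_def space_centred)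
      then have "R\<^sup>2 \<le> (edist d (origin d) x)\<^sup>2" using R by (intro power_mono) auto
      then have "1 \<le> (\<Sum>i<d. (x i)\<^sup>2 / R\<^sup>2)" using R by (simp add: sq sum_divide_distrib[symmetric])
      then have "ennreal 1 \<le> ennreal (\<Sum>i<d. (x i)\<^sup>2 / R\<^sup>2)" by (rule ennreal_leI)
      then show ?thesis by (simp add: sum_ennreal indicator_def)
    qed simp
  qed
  also have "\<dots> = (\<Sum>i<d. \<integral>\<^sup>+x. ennreal ((x i)\<^sup>2 / R\<^sup>2) \<partial>centred_gaussian d v)"
    by (rule nn_integral_sum) measurable
  also have "\<dots> = (\<Sum>i<d. ennreal (v / R\<^sup>2))"
  proof (rule sum.cong[OF refl])
    fix i assume i: "i \<in> {..<d}"
    have mi: "(\<lambda>x. x i) \<in> centred_gaussian d v \<rightarrow>\<^sub>M gauss 0 (sqrt v)"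
      using measurable_coordinate[of i d] i by (simp cong: measurable_cong_sets)
    have "(\<integral>\<^sup>+x. ennreal ((x i)\<^sup>2 / R\<^sup>2) \<partial>centred_gaussian d v) = (\<integral>\<^sup>+t. ennreal (t\<^sup>2 / R\<^sup>2) \<partial>distr (centred_gaussian d v) (gauss 0 (sqrt v)) (\<lambda>x. x i))"
      by (rule nn_integral_distr[symmetric, OF mi]) auto
    also have "distr (centred_gaussian d v) (gauss 0 (sqrt v)) (\<lambda>x. x i) = gauss 0 (sqrt v)"
      unfolding centred_gaussian_def
      using distr_PiM_component[of "{..<d}" "\<lambda>_. gauss 0 (sqrt v)" i] i v prob_space_normal_density by simp
    also have "(\<integral>\<^sup>+t. ennreal (t\<^sup>2 / R\<^sup>2) \<partial>gauss 0 (sqrt v)) = (\<integral>\<^sup>+t. ennreal (normal_density 0 (sqrt v) t * (t - 0) ^ (2 * 1) / R\<^sup>2) \<partial>lborel)"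
      by (subst nn_integral_density) (auto simp: ennreal_mult[symmetric])
    also have "\<dots> = ennreal (\<integral>t. normal_density 0 (sqrt v) t * (t - 0) ^ (2 * 1) / R\<^sup>2 \<partial>lborel)"
      using integrable_normal_moment[of "sqrt v" 0 "2 * 1"] v by (intro nn_integral_eq_integral) auto
    also have "(\<integral>t. normal_density 0 (sqrt v) t * (t - 0) ^ (2 * 1) / R\<^sup>2 \<partial>lborel) = v / R\<^sup>2"
      using integral_normal_moment_even[of "sqrt v" 0 1] v by (simp add: fact_numeral)
    finally show "(\<integral>\<^sup>+x. ennreal ((x i)\<^sup>2 / R\<^sup>2) \<partial>centred_gaussian d v) = ennreal (v / R\<^sup>2)" .
  qed
  also have "\<dots> = ennreal (real d * v / R\<^sup>2)"
    using v by (simp add: ennreal_of_nat_eq_real_of_nat ennreal_mult[symmetric])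
  finally have "measure (centred_gaussian d v) (space (centred_gaussian d v) - ?B) \<le> real d * v / R\<^sup>2"
    using v by (simp add: emeasure_eq_measure)
  then show ?thesis using prob_compl[OF B] by linarith
qed

section \<open>Empirical approximation and the two-point method\<close>

lemma (in prob_space) exists_le_nn_integral:
  assumes h [measurable]: "h \<in> borel_measurable M" and c: "(\<integral>\<^sup>+x. h x \<partial>M) \<le> ennreal c"
    and A: "AE x in M. x \<in> A"
  shows "\<exists>x\<in>space M. x \<in> A \<and> h x \<le> ennreal c"
proof (rule ccontr)
  assume no: "\<not> ?thesis"
  have gt: "AE x in M. ennreal c < h x"
    using A AE_space by eventually_elim (use no in force)
  have "(\<integral>\<^sup>+x. h x - ennreal c \<partial>M) = (\<integral>\<^sup>+x. h x \<partial>M) - (\<integral>\<^sup>+x. ennreal c \<partial>M)"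
  proof (rule nn_integral_diff)
    show "AE x in M. ennreal c \<le> h x" using gt by eventually_elim simp
  qed (auto simp: emeasure_space_1)
  also have "\<dots> = 0" using c le_less_trans[OF c, of top]
    by (simp add: emeasure_space_1 diff_eq_0_iff_ennreal)
  finally have "AE x in M. h x - ennreal c = 0"
    by (subst (asm) nn_integral_0_iff_AE) auto
  with gt have "AE x in M. False"
    by eventually_elim (auto simp: diff_eq_0_iff_ennreal ennreal_minus_eq_0)
  then show False by simp
qed

text \<open>The cross term vanishes on average, because \<open>k - expectation k\<close> is centred.\<close>

lemma (in prob_space) second_moment_step:
  assumes i: "integrable M k" and i2: "integrable M (\<lambda>x. (k x)\<^sup>2)"
  shows "(\<integral>\<^sup>+x. ennreal ((s + k x - expectation k)\<^sup>2) \<partial>M) \<le> ennreal (s\<^sup>2) + (\<integral>\<^sup>+x. ennreal ((k x)\<^sup>2) \<partial>M)"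
proof -
  let ?m = "expectation k"
  have e: "(s + k x - ?m)\<^sup>2 = (k x)\<^sup>2 + (2 * (s - ?m) * k x + (s - ?m)\<^sup>2)" for x
    by (simp add: power2_eq_square algebra_simps)
  have int: "integrable M (\<lambda>x. 2 * (s - ?m) * k x + (s - ?m)\<^sup>2)" using i by auto
  have "(\<integral>\<^sup>+x. ennreal ((s + k x - ?m)\<^sup>2) \<partial>M) = ennreal (\<integral>x. (s + k x - ?m)\<^sup>2 \<partial>M)"
  proof (rule nn_integral_eq_integral)
    show "integrable M (\<lambda>x. (s + k x - ?m)\<^sup>2)"
      unfolding e by (rule Bochner_Integration.integrable_add[OF i2 int])
  qed simp
  also have "(\<integral>x. (s + k x - ?m)\<^sup>2 \<partial>M) = (\<integral>x. (k x)\<^sup>2 \<partial>M) + (2 * (s - ?m) * ?m + (s - ?m)\<^sup>2)"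
    unfolding e Bochner_Integration.integral_add[OF i2 int] using i by (simp add: prob_space)
  also have "\<dots> = (\<integral>x. (k x)\<^sup>2 \<partial>M) + s\<^sup>2 - ?m\<^sup>2" by (simp add: power2_eq_square algebra_simps)
  also have "ennreal \<dots> \<le> ennreal ((\<integral>x. (k x)\<^sup>2 \<partial>M) + s\<^sup>2)" by (intro ennreal_leI) simp
  also have "\<dots> = ennreal (s\<^sup>2) + (\<integral>\<^sup>+x. ennreal ((k x)\<^sup>2) \<partial>M)"
    using nn_integral_eq_integral[OF i2] by (simp add: add.commute)
  finally show ?thesis .
qed

text \<open>Averages of independent draws approximate the mean in square norm at the rate \<open>1 / n\<close>.  The
  points are chosen one after the other: the expected squared norm of the error
  sum grows by at most \<open>B\<close> when the next point is drawn from \<open>Q\<close>, so that some next point does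
  no worse.\<close>

lemma empirical_approximation:
  fixes K :: "'a \<Rightarrow> 'b \<Rightarrow> real"
  assumes Q: "prob_space Q" and N: "sigma_finite_measure N"
    and K [measurable]: "(\<lambda>(x, y). K x y) \<in> borel_measurable (Q \<Otimes>\<^sub>M N)"
    and i: "\<And>y. y \<in> space N \<Longrightarrow> integrable Q (\<lambda>x. K x y)"
    and i2: "\<And>y. y \<in> space N \<Longrightarrow> integrable Q (\<lambda>x. (K x y)\<^sup>2)"
    and B: "(\<integral>\<^sup>+x. \<integral>\<^sup>+y. ennreal ((K x y)\<^sup>2) \<partial>N \<partial>Q) \<le> ennreal B" "0 \<le> B"
    and A: "AE x in Q. x \<in> A"
  shows "\<exists>xs. (\<forall>j<n::nat. xs j \<in> A \<inter> space Q) \<and>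
    (\<integral>\<^sup>+y. ennreal (((\<Sum>j<n. K (xs j) y) - real n * (\<integral>x. K x y \<partial>Q))\<^sup>2) \<partial>N) \<le> ennreal (real n * B)"
proof -
  interpret Q: prob_space Q by (rule Q)
  interpret N: sigma_finite_measure N by (rule N)
  interpret QN: pair_sigma_finite Q N ..
  let ?m = "\<lambda>y. \<integral>x. K x y \<partial>Q"
  have [measurable]: "?m \<in> borel_measurable N" by measurable
  show ?thesis
  proof (induction n)
    case 0
    then show ?case by simp
  next
    case (Suc n)
    then obtain xs where xs: "\<And>j. j < n \<Longrightarrow> xs j \<in> A \<inter> space Q"
      and le: "(\<integral>\<^sup>+y. ennreal (((\<Sum>j<n. K (xs j) y) - real n * ?m y)\<^sup>2) \<partial>N) \<le> ennreal (real n * B)"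
      by blast
    let ?S = "\<lambda>y. (\<Sum>j<n. K (xs j) y) - real n * ?m y"
    have [measurable]: "K (xs j) \<in> borel_measurable N" if "j < n" for j
      using measurable_compose[OF measurable_Pair1'[of "xs j" Q N] K] xs[OF that] by simp
    have [measurable]: "?S \<in> borel_measurable N"
      by (intro borel_measurable_diff borel_measurable_sum) auto
    let ?h = "\<lambda>x. \<integral>\<^sup>+y. ennreal ((?S y + K x y - ?m y)\<^sup>2) \<partial>N"
    have "(\<integral>\<^sup>+x. ?h x \<partial>Q) = (\<integral>\<^sup>+y. \<integral>\<^sup>+x. ennreal ((?S y + K x y - ?m y)\<^sup>2) \<partial>Q \<partial>N)"
      by (rule QN.Fubini'[symmetric]) measurable
    also have "\<dots> \<le> (\<integral>\<^sup>+y. ennreal ((?S y)\<^sup>2) + (\<integral>\<^sup>+x. ennreal ((K x y)\<^sup>2) \<partial>Q) \<partial>N)"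
      by (intro nn_integral_mono Q.second_moment_step i i2)
    also have "\<dots> = (\<integral>\<^sup>+y. ennreal ((?S y)\<^sup>2) \<partial>N) + (\<integral>\<^sup>+y. \<integral>\<^sup>+x. ennreal ((K x y)\<^sup>2) \<partial>Q \<partial>N)"
      by (rule nn_integral_add) measurable
    also have "(\<integral>\<^sup>+y. \<integral>\<^sup>+x. ennreal ((K x y)\<^sup>2) \<partial>Q \<partial>N) = (\<integral>\<^sup>+x. \<integral>\<^sup>+y. ennreal ((K x y)\<^sup>2) \<partial>N \<partial>Q)"
      by (rule QN.Fubini') measurable
    also have "(\<integral>\<^sup>+y. ennreal ((?S y)\<^sup>2) \<partial>N) + (\<integral>\<^sup>+x. \<integral>\<^sup>+y. ennreal ((K x y)\<^sup>2) \<partial>N \<partial>Q)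
        \<le> ennreal (real n * B) + ennreal B"
      by (intro add_mono le B)
    also have "\<dots> = ennreal (real (Suc n) * B)"
      using B(2) by (simp add: ennreal_plus[symmetric] algebra_simps del: ennreal_plus)
    finally have "(\<integral>\<^sup>+x. ?h x \<partial>Q) \<le> ennreal (real (Suc n) * B)" .
    moreover have "?h \<in> borel_measurable Q" by measurable
    ultimately obtain x where x: "x \<in> space Q" "x \<in> A" "?h x \<le> ennreal (real (Suc n) * B)"
      using Q.exists_le_nn_integral A by blast
    define xs' where "xs' = (\<lambda>j. if j < n then xs j else x)"
    have "(\<Sum>j<Suc n. K (xs' j) y) - real (Suc n) * ?m y = ?S y + K x y - ?m y" for y
      by (simp add: xs'_def algebra_simps)
    then have "(\<integral>\<^sup>+y. ennreal (((\<Sum>j<Suc n. K (xs' j) y) - real (Suc n) * ?m y)\<^sup>2) \<partial>N) \<le> ennreal (real (Suc n) * B)"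
      using x(3) by (simp only:)
    moreover have "\<forall>j<Suc n. xs' j \<in> A \<inter> space Q" using xs x by (auto simp: xs'_def)
    ultimately show ?case by blast
  qed
qed

text \<open>Where \<open>h\<close> exceeds \<open>q\<close>, the deficit is at most \<open>m - q\<close>, and \<open>t \<le> a + t\<^sup>2 / (4 * a)\<close> bounds it by its
  square.  This replaces the Cauchy-Schwarz bound of the total variation by the chi-square
  divergence.  The function \<open>h\<close> may be smaller than \<open>m\<close> to allow for truncated mixtures.\<close>

lemma overlap_lower_bound:
  fixes q h m :: "'a \<Rightarrow> real"
  assumes [measurable]: "q \<in> borel_measurable N" "h \<in> borel_measurable N" "m \<in> borel_measurable N"
    and h: "\<And>y. y \<in> space N \<Longrightarrow> 0 \<le> h y" "\<And>y. y \<in> space N \<Longrightarrow> h y \<le> 1" "\<And>y. y \<in> space N \<Longrightarrow> h y \<le> m y"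
    and q: "\<And>y. y \<in> space N \<Longrightarrow> 0 \<le> q y"
    and N: "prob_space N" and a: "0 < a"
    and D: "(\<integral>\<^sup>+y. ennreal ((m y - q y)\<^sup>2) \<partial>N) \<le> ennreal D" "0 \<le> D"
  shows "(\<integral>\<^sup>+y. ennreal (h y) \<partial>N) \<le> (\<integral>\<^sup>+y. ennreal (min 1 (q y)) \<partial>N) + ennreal (a + D / (4 * a))"
proof -
  interpret prob_space N by (rule N)
  have pt: "h y \<le> min 1 (q y) + (a + (m y - q y)\<^sup>2 / (4 * a))" if y: "y \<in> space N" for y
  proof (cases "h y \<le> q y")
    case True
    then show ?thesis using h(2)[OF y] a by (intro add_increasing2) auto
  next
    case False
    have "(m y - q y) \<le> a + (m y - q y)\<^sup>2 / (4 * a)"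
    proof -
      have "0 \<le> (2 * a - (m y - q y))\<^sup>2 / (4 * a)" using a by simp
      also have "\<dots> = a + (m y - q y)\<^sup>2 / (4 * a) - (m y - q y)"
        using a by (simp add: power2_eq_square field_simps)
      finally show ?thesis by simp
    qed
    moreover have "min 1 (q y) = q y" using False h(2)[OF y] by simp
    ultimately show ?thesis using h(3)[OF y] by linarith
  qed
  have "(\<integral>\<^sup>+y. ennreal (h y) \<partial>N) \<le> (\<integral>\<^sup>+y. ennreal (min 1 (q y)) + (ennreal a + ennreal (1 / (4 * a)) * ennreal ((m y - q y)\<^sup>2)) \<partial>N)"
  proof (rule nn_integral_mono)
    fix y assume y: "y \<in> space N"
    have "ennreal (h y) \<le> ennreal (min 1 (q y) + (a + 1 / (4 * a) * (m y - q y)\<^sup>2))"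
      using pt[OF y] by (intro ennreal_leI) simp
    also have "\<dots> = ennreal (min 1 (q y)) + (ennreal a + ennreal (1 / (4 * a)) * ennreal ((m y - q y)\<^sup>2))"
      using q[OF y] a
      by (simp add: ennreal_plus[symmetric] ennreal_mult'[symmetric] del: ennreal_plus)
    finally show "ennreal (h y) \<le> ennreal (min 1 (q y)) + (ennreal a + ennreal (1 / (4 * a)) * ennreal ((m y - q y)\<^sup>2))" .
  qed
  also have "\<dots> = (\<integral>\<^sup>+y. ennreal (min 1 (q y)) \<partial>N) + (ennreal a + ennreal (1 / (4 * a)) * (\<integral>\<^sup>+y. ennreal ((m y - q y)\<^sup>2) \<partial>N))"
    by (simp add: nn_integral_add nn_integral_cmult emeasure_space_1)
  also have "\<dots> \<le> (\<integral>\<^sup>+y. ennreal (min 1 (q y)) \<partial>N) + (ennreal a + ennreal (1 / (4 * a)) * ennreal D)"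
    by (intro add_mono mult_left_mono D order_refl) simp
  also have "ennreal a + ennreal (1 / (4 * a)) * ennreal D = ennreal (a + D / (4 * a))"
    using a D(2) by (simp add: ennreal_mult[symmetric] ennreal_plus[symmetric] del: ennreal_plus)
  finally show ?thesis .
qed

lemma ennreal_half_le:
  assumes "ennreal (2 * c) \<le> X + X" shows "ennreal c \<le> X"
proof (cases X)
  case (real r)
  have "ennreal (2 * c) \<le> ennreal (r + r)"
    unfolding ennreal_plus[OF real(1) real(1)] using assms unfolding real(2) .
  moreover have nn: "0 \<le> r + r" using real by simp
  ultimately have "2 * c \<le> r + r" by (intro iffD1[OF ennreal_le_iff[OF nn]])
  then show ?thesis unfolding real(2) by (intro ennreal_leI) simp
qed simp

text \<open>Le Cam's two-point method.  Both observation laws dominate \<open>\<theta>\<close> times the measure with density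
  \<open>min 1 q\<close>, and at every point the two squared errors add up to at least \<open>(l2 - l1)\<^sup>2 / 2\<close>.\<close>

lemma two_point_risk_bound:
  assumes l: "l1 \<in> \<Lambda>" "l2 \<in> \<Lambda>" and f: "f \<in> estimators d \<Lambda>"
    and N: "sets N = sets (Rd d)"
    and q [measurable]: "q \<in> borel_measurable N" and q0: "\<And>y. y \<in> space N \<Longrightarrow> 0 \<le> q y" and \<theta>: "0 \<le> \<theta>"
    and P1: "\<And>g. g \<in> borel_measurable (Rd d) \<Longrightarrow>
      ennreal \<theta> * (\<integral>\<^sup>+y. g y \<partial>N) \<le> (\<integral>\<^sup>+y. g y \<partial>obs_law d P l1)"
    and P2: "\<And>g. g \<in> borel_measurable (Rd d) \<Longrightarrow>
      ennreal \<theta> * (\<integral>\<^sup>+y. ennreal (q y) * g y \<partial>N) \<le> (\<integral>\<^sup>+y. g y \<partial>obs_law d P l2)"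
    and ov: "ennreal \<eta> \<le> (\<integral>\<^sup>+y. ennreal (min 1 (q y)) \<partial>N)" "0 \<le> \<eta>"
  shows "ennreal (\<theta> * \<eta> * (l2 - l1)\<^sup>2 / 4) \<le> max_risk d P \<Lambda> f"
proof -
  note N [measurable_cong]
  have f' [measurable]: "f \<in> borel_measurable (Rd d)"
    using f by (auto simp: estimators_def measurable_restrict_space2_iff)
  let ?g = "\<lambda>l y. ennreal ((f y - l)\<^sup>2)"
  have "ennreal ((l2 - l1)\<^sup>2 / 2) * (\<integral>\<^sup>+y. ennreal (min 1 (q y)) \<partial>N)
      = (\<integral>\<^sup>+y. ennreal ((l2 - l1)\<^sup>2 / 2) * ennreal (min 1 (q y)) \<partial>N)"
    by (rule nn_integral_cmult[symmetric]) measurable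
  also have "\<dots> \<le> (\<integral>\<^sup>+y. ?g l1 y + ennreal (q y) * ?g l2 y \<partial>N)"
  proof (rule nn_integral_mono)
    fix y assume y: "y \<in> space N"
    have "(l2 - l1)\<^sup>2 / 2 * min 1 (q y) \<le> ((f y - l1)\<^sup>2 + (f y - l2)\<^sup>2) * min 1 (q y)"
    proof (rule mult_right_mono)
      have "((f y - l1)\<^sup>2 + (f y - l2)\<^sup>2) - (l2 - l1)\<^sup>2 / 2 = (2 * f y - l1 - l2)\<^sup>2 / 2"
        by (simp add: power2_eq_square field_simps)
      also have "\<dots> \<ge> 0" by simp
      finally show "(l2 - l1)\<^sup>2 / 2 \<le> (f y - l1)\<^sup>2 + (f y - l2)\<^sup>2" by simp
    qed (use q0[OF y] in auto)
    also have "\<dots> = min 1 (q y) * (f y - l1)\<^sup>2 + min 1 (q y) * (f y - l2)\<^sup>2"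
      by (simp add: algebra_simps)
    also have "\<dots> \<le> 1 * (f y - l1)\<^sup>2 + q y * (f y - l2)\<^sup>2"
      by (intro add_mono mult_right_mono) auto
    finally have "ennreal ((l2 - l1)\<^sup>2 / 2 * min 1 (q y)) \<le> ennreal ((f y - l1)\<^sup>2 + q y * (f y - l2)\<^sup>2)"
      by (intro ennreal_leI) simp
    then show "ennreal ((l2 - l1)\<^sup>2 / 2) * ennreal (min 1 (q y)) \<le> ?g l1 y + ennreal (q y) * ?g l2 y"
      using q0[OF y] by (simp add: ennreal_mult[symmetric] ennreal_plus[symmetric] del: ennreal_plus)
  qed
  also have "\<dots> = (\<integral>\<^sup>+y. ?g l1 y \<partial>N) + (\<integral>\<^sup>+y. ennreal (q y) * ?g l2 y \<partial>N)"
    by (rule nn_integral_add) measurable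
  finally have inner: "ennreal ((l2 - l1)\<^sup>2 / 2) * (\<integral>\<^sup>+y. ennreal (min 1 (q y)) \<partial>N)
    \<le> (\<integral>\<^sup>+y. ?g l1 y \<partial>N) + (\<integral>\<^sup>+y. ennreal (q y) * ?g l2 y \<partial>N)" .
  have "ennreal (\<theta> * ((l2 - l1)\<^sup>2 / 2) * \<eta>) = ennreal \<theta> * (ennreal ((l2 - l1)\<^sup>2 / 2) * ennreal \<eta>)"
    using \<theta> ov(2) by (simp add: ennreal_mult[symmetric])
  also have "\<dots> \<le> ennreal \<theta> * (ennreal ((l2 - l1)\<^sup>2 / 2) * (\<integral>\<^sup>+y. ennreal (min 1 (q y)) \<partial>N))"
    by (intro mult_left_mono ov) auto
  also have "\<dots> \<le> ennreal \<theta> * ((\<integral>\<^sup>+y. ?g l1 y \<partial>N) + (\<integral>\<^sup>+y. ennreal (q y) * ?g l2 y \<partial>N))"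
    by (rule mult_left_mono[OF inner]) simp
  also have "\<dots> = ennreal \<theta> * (\<integral>\<^sup>+y. ?g l1 y \<partial>N) + ennreal \<theta> * (\<integral>\<^sup>+y. ennreal (q y) * ?g l2 y \<partial>N)"
    by (rule distrib_left)
  also have "\<dots> \<le> (\<integral>\<^sup>+y. ?g l1 y \<partial>obs_law d P l1) + (\<integral>\<^sup>+y. ?g l2 y \<partial>obs_law d P l2)"
    by (intro add_mono P1 P2) measurable
  also have "\<dots> \<le> max_risk d P \<Lambda> f + max_risk d P \<Lambda> f"
    unfolding max_risk_def by (intro add_mono SUP_upper l)
  finally have "ennreal (2 * (\<theta> * \<eta> * (l2 - l1)\<^sup>2 / 4)) \<le> max_risk d P \<Lambda> f + max_risk d P \<Lambda> f"
    by (simp add: mult_ac)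
  then show ?thesis by (rule ennreal_half_le)
qed

section \<open>Signal laws with finitely many atoms\<close>

definition uniform_on_points :: "nat \<Rightarrow> nat \<Rightarrow> (nat \<Rightarrow> nat \<Rightarrow> real) \<Rightarrow> (nat \<Rightarrow> real) measure" where
  "uniform_on_points d n pts = distr (measure_pmf (pmf_of_set {..<n})) (Rd d) pts"

context
  fixes d n :: nat and pts :: "nat \<Rightarrow> nat \<Rightarrow> real"
  assumes n: "0 < n" and pts: "\<And>j. pts j \<in> space (Rd d)"
begin

lemma measurable_pts: "pts \<in> measure_pmf (pmf_of_set {..<n}) \<rightarrow>\<^sub>M Rd d"
  using pts by (auto simp: measurable_def)

lemma uniform_on_points_prob_measures: "uniform_on_points d n pts \<in> prob_measures d"
  unfolding prob_measures_def uniform_on_points_def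
  using measure_pmf.prob_space_distr[OF measurable_pts] by simp

lemma nn_integral_uniform_on_points:
  assumes g: "g \<in> borel_measurable (Rd d)"
  shows "(\<integral>\<^sup>+x. g x \<partial>uniform_on_points d n pts) = ennreal (1 / real n) * (\<Sum>j<n. g (pts j))"
proof -
  have "(\<integral>\<^sup>+x. g x \<partial>uniform_on_points d n pts) = (\<Sum>j<n. g (pts j)) / of_nat n"
    unfolding uniform_on_points_def
    using n nn_integral_pmf_of_set[of "{..<n}"] by (subst nn_integral_distr[OF measurable_pts]) (auto simp: g lessThan_empty_iff)
  also have "\<dots> = ennreal (1 / real n) * (\<Sum>j<n. g (pts j))"
    using n by (simp add: divide_ennreal_def ennreal_of_nat_eq_real_of_nat inverse_ennreal inverse_eq_divide mult.commute)
  finally show ?thesis .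
qed

lemma supp_uniform_on_points: "supp d (uniform_on_points d n pts) \<subseteq> pts ` {..<n}"
proof
  fix x assume x: "x \<in> supp d (uniform_on_points d n pts)"
  then have xs: "x \<in> space (Rd d)" by (auto simp: supp_def)
  show "x \<in> pts ` {..<n}"
  proof (rule ccontr)
    assume nx: "x \<notin> pts ` {..<n}"
    define r where "r = Min ((\<lambda>j. edist d x (pts j)) ` {..<n}) / 2"
    have pos: "0 < edist d x (pts j)" if "j < n" for j
    proof -
      have "x \<noteq> pts j" using nx that by auto
      then show ?thesis using edist_eq_0_iff[OF xs pts, of j] by (simp add: less_le)
    qed
    have "0 < Min ((\<lambda>j. edist d x (pts j)) ` {..<n})"
      using n pos by (subst Min_gr_iff) auto
    then have r: "0 < r" "\<And>j. j < n \<Longrightarrow> 2 * r \<le> edist d x (pts j)"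
      by (auto simp: r_def)
    have out: "pts j \<notin> eball d x r" if "j < n" for j
      using r(1) r(2)[OF that] by (auto simp: eball_def)
    have B: "eball d x r \<in> sets (Rd d)" by (rule sets_eball[OF xs])
    have "emeasure (uniform_on_points d n pts) (eball d x r) = (\<integral>\<^sup>+y. indicator (eball d x r) y \<partial>uniform_on_points d n pts)"
      using B uniform_on_points_prob_measures by (subst nn_integral_indicator) (auto simp: prob_measures_def)
    also have "\<dots> = ennreal (1 / real n) * (\<Sum>j<n. indicator (eball d x r) (pts j))"
      by (rule nn_integral_uniform_on_points) (use B in auto)
    also have "\<dots> = 0" using out by (simp add: sum_nonneg_eq_0_iff)
    finally show False using x r(1) by (auto simp: supp_def)
  qed
qed

lemma uniform_on_points_LD_class:
  assumes R: "\<And>j. j < n \<Longrightarrow> pts j \<in> eball d (origin d) R" and k: "1 + ln (real n) \<le> k"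
    and lm: "0 < lmin" "0 < lmax"
  shows "uniform_on_points d n pts \<in> LD_class d k R lmin lmax"
proof -
  let ?S = "supp d (uniform_on_points d n pts)" and ?N = "covering_number d (supp d (uniform_on_points d n pts)) (r0 d lmin lmax)"
  have r: "0 \<le> r0 d lmin lmax" using lm by (simp add: r0_def)
  have "?S \<subseteq> (\<Union>x\<in>pts ` {..<n}. eball d x (r0 d lmin lmax))"
  proof
    fix x assume "x \<in> ?S"
    then obtain j where "j < n" "x = pts j" using supp_uniform_on_points by blast
    then show "x \<in> (\<Union>x\<in>pts ` {..<n}. eball d x (r0 d lmin lmax))"
      using r pts by (auto simp: eball_def intro!: bexI[of _ j])
  qed
  then have "?N \<le> card (pts ` {..<n})"
    using pts by (intro covering_number_le) auto
  also have "\<dots> \<le> n" using card_image_le[of "{..<n}" pts] by simp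
  finally have "?N \<le> n" .
  then have "ln (real ?N) \<le> ln (real n)"
    using n by (cases "?N = 0") auto
  then have "1 + ln (real ?N) \<le> k" using k by linarith
  moreover have "?S \<subseteq> eball d (origin d) R"
    using R by (intro order_trans[OF supp_uniform_on_points]) auto
  ultimately show ?thesis
    unfolding LD_class_def using uniform_on_points_prob_measures by blast
qed

lemma nn_integral_obs_law_uniform_on_points:
  assumes l: "0 < l1" "0 < l2" and g: "g \<in> borel_measurable (Rd d)"
  shows "(\<integral>\<^sup>+y. g y \<partial>obs_law d (uniform_on_points d n pts) l2)
    = ennreal (1 / real n) * (\<Sum>j<n. \<integral>\<^sup>+y. ennreal (lik_ratio d l1 l2 (pts j) y) * g y \<partial>centred_gaussian d (1 / l1))"
proof -
  interpret S: prob_space "std_gaussian d" by (rule prob_space_std_gaussian)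
  have m: "(\<lambda>x. \<integral>\<^sup>+z. g (noisy d l2 x z) \<partial>std_gaussian d) \<in> borel_measurable (Rd d)"
  proof -
    have "(\<lambda>w. noisy d l2 (fst w) (snd w)) \<in> Rd d \<Otimes>\<^sub>M std_gaussian d \<rightarrow>\<^sub>M Rd d"
      unfolding Rd_def
    proof (rule measurable_restrict, fold Rd_def)
      fix i assume i: "i \<in> {..<d}"
      have "(\<lambda>w. fst w i) \<in> borel_measurable (Rd d \<Otimes>\<^sub>M std_gaussian d)"
        "(\<lambda>w. snd w i) \<in> borel_measurable (Rd d \<Otimes>\<^sub>M std_gaussian d)"
        using i by (auto intro!: measurable_compose[OF _ measurable_coordinate[of i d]])
      then show "(\<lambda>w. fst w i + snd w i / sqrt l2) \<in> borel_measurable (Rd d \<Otimes>\<^sub>M std_gaussian d)"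
        by measurable
    qed
    from measurable_compose[OF this g]
    show ?thesis by (intro S.borel_measurable_nn_integral) (simp add: case_prod_beta)
  qed
  show ?thesis
    unfolding nn_integral_obs_law[OF uniform_on_points_prob_measures g] nn_integral_uniform_on_points[OF m]
    by (simp only: nn_integral_noise_eq[OF l pts g])
qed

end

section \<open>Lower bounds for the minimax risk\<close>

lemma ennreal_le_cancel_add:
  assumes "ennreal u \<le> X + ennreal e" "0 \<le> e"
  shows "ennreal (u - e) \<le> X"
proof (cases X)
  case (real r)
  have "ennreal u \<le> ennreal (r + e)"
    using assms(1) unfolding real(2) ennreal_plus[OF real(1) assms(2)] .
  then have "u \<le> r + e" using real(1) assms(2) by (auto simp: ennreal_le_iff2 simp del: ennreal_plus)
  then show ?thesis unfolding real(2) by (intro ennreal_leI) simp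
qed simp

lemma lik_ratio_origin_self:
  assumes "0 < l"
  shows "lik_ratio d l l (origin d) y = 1"
  using assms by (simp add: lik_ratio_def coord_ratio_def origin_def)

lemma nn_integral_ratio:
  assumes l: "0 < l1" "0 < l2" and x: "x \<in> space (Rd d)"
  shows "(\<integral>\<^sup>+y. ennreal (lik_ratio d l1 l2 x y) \<partial>centred_gaussian d (1 / l1)) = 1"
proof -
  interpret S: prob_space "std_gaussian d" by (rule prob_space_std_gaussian)
  show ?thesis
    using nn_integral_noise_eq[OF l x, of "\<lambda>_. 1"] by (simp add: S.emeasure_space_1)
qed

lemma LD_risk_lower_bound:
  assumes P: "P \<in> LD_class d k R lmin lmax"
    and b: "\<And>f. f \<in> estimators d {lmin..lmax} \<Longrightarrow> c \<le> max_risk d P {lmin..lmax} f"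
  shows "c \<le> LD_risk d k R lmin lmax"
  unfolding LD_risk_def minimax_risk_def
  by (rule SUP_upper2[OF P]) (rule INF_greatest[OF b])

text \<open>Without a signal, the laws at precisions \<open>lmin\<close> and \<open>lmin * (1 + t)\<close> have a chi-square divergence of
  about \<open>d * t\<^sup>2 / 2\<close>, which is a small constant for \<open>t \<le> 1 / (2 * sqrt d)\<close>.\<close>

lemma LD_risk_ge_parametric:
  assumes lm: "0 < lmin" "lmin < lmax" and d: "1 \<le> d" and k: "1 \<le> k" and R: "0 < R"
  shows "ennreal (min ((lmax - lmin)\<^sup>2) (lmin\<^sup>2 / real d) / 32) \<le> LD_risk d k R lmin lmax"
proof -
  define \<delta> where "\<delta> = min (lmax - lmin) (lmin / (2 * sqrt (real d)))"
  have \<delta>: "0 < \<delta>" using lm d by (simp add: \<delta>_def)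
  define l2 where "l2 = lmin + \<delta>"
  have l2: "lmin < l2" "l2 \<le> lmax" "0 < l2" using \<delta> lm by (auto simp: l2_def \<delta>_def min_def)
  define P where "P = uniform_on_points d 1 (\<lambda>_. origin d)"
  have PLD: "P \<in> LD_class d k R lmin lmax"
    unfolding P_def by (rule uniform_on_points_LD_class) (use R k lm in \<open>auto simp: eball_def\<close>)
  let ?N = "centred_gaussian d (1 / lmin)"
  interpret N: prob_space ?N by (rule prob_space_centred) (use lm in simp)
  let ?q = "lik_ratio d lmin l2 (origin d)"
  have q [measurable]: "?q \<in> borel_measurable ?N"
  proof -
    have "(\<lambda>y. ?q y) \<in> borel_measurable (Rd d)"
      by (rule measurable_ratio[where f = "\<lambda>_. origin d" and g = "\<lambda>y. y"]) auto
    then show ?thesis by (simp cong: measurable_cong_sets)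
  qed
  have q0: "0 \<le> ?q y" for y using lm l2 by simp
  define C where "C = l2 / sqrt (lmin * (2 * l2 - lmin))"
  have C0: "0 \<le> C" using l2 lm by (simp add: C_def)
  have q2: "(\<integral>\<^sup>+y. ennreal ((?q y)\<^sup>2) \<partial>?N) = ennreal (C ^ d)"
    using lm l2 C0 by (subst lik_ratio_second_moment) (auto simp: origin_def C_def[symmetric] ennreal_power)
  have Cd: "C ^ d \<le> 23 / 20"
  proof -
    have pos: "0 < lmin * (2 * l2 - lmin)" using l2 lm by simp
    have "\<delta>\<^sup>2 / (lmin * (2 * l2 - lmin)) \<le> (lmin / (2 * sqrt (real d)))\<^sup>2 / (lmin * lmin)"
      using \<delta> lm l2 by (intro frac_le power_mono mult_left_mono) (auto simp: \<delta>_def)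
    also have "(lmin / (2 * sqrt (real d)))\<^sup>2 / (lmin * lmin) = 1 / (4 * real d)"
      using lm by (simp add: power_divide power_mult_distrib power2_eq_square)
    finally have step: "\<delta>\<^sup>2 / (lmin * (2 * l2 - lmin)) \<le> 1 / (4 * real d)" .
    have "C\<^sup>2 = l2\<^sup>2 / (lmin * (2 * l2 - lmin))" using pos by (simp add: C_def power_divide)
    also have "l2\<^sup>2 = lmin * (2 * l2 - lmin) + \<delta>\<^sup>2" by (simp add: l2_def power2_eq_square algebra_simps)
    also have "(lmin * (2 * l2 - lmin) + \<delta>\<^sup>2) / (lmin * (2 * l2 - lmin)) = 1 + \<delta>\<^sup>2 / (lmin * (2 * l2 - lmin))"
    proof -
      have "(a + b) / a = 1 + b / a" if "0 < a" for a b :: real using that by (simp add: add_divide_distrib)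
      then show ?thesis using pos .
    qed
    also have "\<dots> \<le> 1 + 1 / (4 * real d)" using step by simp
    also have "1 + 1 / (4 * real d) \<le> exp (1 / (4 * real d))" by (rule exp_ge_add_one_self)
    also have "\<dots> = (exp (1 / (8 * real d)))\<^sup>2" by (simp add: power2_eq_square exp_add[symmetric] field_simps)
    finally have "C \<le> exp (1 / (8 * real d))" by (rule power2_le_imp_le) (rule exp_ge_zero)
    then have "C ^ d \<le> exp (1 / (8 * real d)) ^ d" using C0 by (intro power_mono)
    also have "\<dots> = exp (1 / 8)" using d by (simp add: exp_of_nat_mult[symmetric])
    also have "\<dots> \<le> 1 + 1 / 8 + (1 / 8)\<^sup>2" by (rule exp_bound) auto
    also have "\<dots> \<le> 23 / 20" by (simp add: power2_eq_square)
    finally show ?thesis .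
  qed
  \<comment> \<open>The mean of \<open>(1 - q)\<^sup>2\<close> is that of \<open>q\<^sup>2\<close> minus 1; adding 2 to both sides avoids subtraction
    of extended reals.\<close>
  have D: "(\<integral>\<^sup>+y. ennreal ((1 - ?q y)\<^sup>2) \<partial>?N) \<le> ennreal (3 / 20)"
  proof -
    have "(\<integral>\<^sup>+y. ennreal ((1 - ?q y)\<^sup>2) \<partial>?N) + 2 = (\<integral>\<^sup>+y. ennreal ((1 - ?q y)\<^sup>2) \<partial>?N) + 2 * (\<integral>\<^sup>+y. ennreal (?q y) \<partial>?N)"
      using nn_integral_ratio[OF lm(1) l2(3) origin_in_space] by simp
    also have "\<dots> = (\<integral>\<^sup>+y. ennreal ((1 - ?q y)\<^sup>2) + 2 * ennreal (?q y) \<partial>?N)"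
      by (subst nn_integral_add) (auto simp: nn_integral_cmult)
    also have "\<dots> = (\<integral>\<^sup>+y. 1 + ennreal ((?q y)\<^sup>2) \<partial>?N)"
    proof (rule nn_integral_cong)
      fix y
      have "ennreal ((1 - ?q y)\<^sup>2) + 2 * ennreal (?q y) = ennreal ((1 - ?q y)\<^sup>2 + 2 * ?q y)"
        using q0[of y] by (simp add: ennreal_mult)
      also have "(1 - ?q y)\<^sup>2 + 2 * ?q y = 1 + (?q y)\<^sup>2" by (simp add: power2_eq_square algebra_simps)
      finally show "ennreal ((1 - ?q y)\<^sup>2) + 2 * ennreal (?q y) = 1 + ennreal ((?q y)\<^sup>2)" by simp
    qed
    also have "\<dots> = 1 + ennreal (C ^ d)"
      by (subst nn_integral_add) (auto simp: q2 N.emeasure_space_1)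
    also have "\<dots> \<le> ennreal 1 + ennreal (23 / 20)" by (intro add_mono ennreal_leI Cd) auto
    also have "\<dots> = ennreal (1 + 23 / 20)" by (rule ennreal_plus[symmetric]) auto
    also have "1 + 23 / 20 = 43 / (20::real)" by simp
    finally have "ennreal 2 + (\<integral>\<^sup>+y. ennreal ((1 - ?q y)\<^sup>2) \<partial>?N) \<le> ennreal (43 / 20)" by (simp add: add.commute)
    then show ?thesis
    proof (cases "\<integral>\<^sup>+y. ennreal ((1 - ?q y)\<^sup>2) \<partial>?N")
      case (real r)
      have "ennreal (2 + r) \<le> ennreal (43 / 20)"
        using \<open>ennreal 2 + _ \<le> _\<close> real by (subst ennreal_plus) auto
      then have "2 + r \<le> 43 / 20" by (subst (asm) ennreal_le_iff) auto
      then show ?thesis unfolding real(2) by (intro ennreal_leI) simp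
    qed (auto simp: top_unique)
  qed
  have "(\<integral>\<^sup>+y. ennreal 1 \<partial>?N) \<le> (\<integral>\<^sup>+y. ennreal (min 1 (?q y)) \<partial>?N) + ennreal (1 / 5 + (3 / 20) / (4 * (1 / 5)))"
    by (rule overlap_lower_bound[where m = "\<lambda>_. 1"]) (use q0 D in \<open>auto intro: N.prob_space_axioms\<close>)
  then have "ennreal 1 \<le> (\<integral>\<^sup>+y. ennreal (min 1 (?q y)) \<partial>?N) + ennreal (1 / 5 + (3 / 20) / (4 * (1 / 5)))"
    by (simp add: N.emeasure_space_1)
  then have "ennreal (1 - (1 / 5 + (3 / 20) / (4 * (1 / 5)))) \<le> (\<integral>\<^sup>+y. ennreal (min 1 (?q y)) \<partial>?N)"
    by (rule ennreal_le_cancel_add) simp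
  then have ov: "ennreal (1 / 2) \<le> (\<integral>\<^sup>+y. ennreal (min 1 (?q y)) \<partial>?N)"
    by (rule order_trans[rotated]) (rule ennreal_leI, simp)
  show ?thesis
  proof (rule LD_risk_lower_bound[OF PLD])
    fix f assume f: "f \<in> estimators d {lmin..lmax}"
    have "ennreal (1 * (1 / 2) * (l2 - lmin)\<^sup>2 / 4) \<le> max_risk d P {lmin..lmax} f"
    proof (rule two_point_risk_bound[where N = ?N and q = ?q])
      show "ennreal 1 * (\<integral>\<^sup>+y. g y \<partial>?N) \<le> (\<integral>\<^sup>+y. g y \<partial>obs_law d P lmin)"
        if "g \<in> borel_measurable (Rd d)" for g
        using nn_integral_obs_law_uniform_on_points[of 1 "\<lambda>_. origin d" d lmin lmin g] lm that
        by (simp add: P_def lik_ratio_origin_self)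
      show "ennreal 1 * (\<integral>\<^sup>+y. ennreal (?q y) * g y \<partial>?N) \<le> (\<integral>\<^sup>+y. g y \<partial>obs_law d P l2)"
        if "g \<in> borel_measurable (Rd d)" for g
        using nn_integral_obs_law_uniform_on_points[of 1 "\<lambda>_. origin d" d lmin l2 g] lm l2 that
        by (simp add: P_def)
    qed (use lm l2 f q q0 ov in auto)
    moreover have "min ((lmax - lmin)\<^sup>2) (lmin\<^sup>2 / real d) / 32 \<le> 1 * (1 / 2) * (l2 - lmin)\<^sup>2 / 4"
    proof -
      have "min ((lmax - lmin)\<^sup>2) (lmin\<^sup>2 / real d) / 4 \<le> \<delta>\<^sup>2"
      proof (cases "lmax - lmin \<le> lmin / (2 * sqrt (real d))")
        case True
        then have eq: "\<delta> = lmax - lmin" by (simp add: \<delta>_def)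
        have "m / 4 \<le> b" if "m \<le> b" "0 \<le> b" for m b :: real using that by simp
        from this[OF min.cobounded1 zero_le_power2] show ?thesis unfolding eq .
      next
        case False
        then have "\<delta>\<^sup>2 = lmin\<^sup>2 / real d / 4" by (simp add: \<delta>_def power_divide power_mult_distrib)
        then show ?thesis by simp
      qed
      then show ?thesis by (simp add: l2_def)
    qed
    ultimately show "ennreal (min ((lmax - lmin)\<^sup>2) (lmin\<^sup>2 / real d) / 32) \<le> max_risk d P {lmin..lmax} f"
      using order_trans ennreal_leI by blast
  qed
qed

text \<open>Codewords are drawn from the Gaussian law of variance \<open>1 / l1 - 1 / l2\<close> conditioned on the ball, which
  has probability \<open>p \<ge> 9 / 10\<close>.  The mixture \<open>m\<close> over the conditioned law satisfies \<open>p * m \<le> 1\<close>, because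
  the mixture over the full law is 1; so \<open>p * m\<close> is the part of the target that the codebook has to
  imitate.\<close>

lemma gaussian_codebook:
  assumes l: "0 < l1" "l1 < l2" and R: "0 < R" and mass: "real d * (1 / l1 - 1 / l2) \<le> R\<^sup>2 / 10"
    and M: "0 < M" and rate: "(10 / 9) * (l2 / l1) ^ d \<le> real M * D" and D: "D \<le> 7 / 25"
  obtains xs where "\<And>j. j < M \<Longrightarrow> xs j \<in> eball d (origin d) R"
    "ennreal (1 / 4) \<le> (\<integral>\<^sup>+y. ennreal (min 1 ((\<Sum>j<M. lik_ratio d l1 l2 (xs j) y) / real M)) \<partial>centred_gaussian d (1 / l1))"
proof -
  let ?v = "1 / l1 - 1 / l2"
  have v: "0 < ?v" using l by (simp add: frac_less2)
  let ?Q = "centred_gaussian d ?v" and ?N = "centred_gaussian d (1 / l1)" and ?B = "eball d (origin d) R"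
  let ?K = "lik_ratio d l1 l2"
  have l2: "0 < l2" using l by simp
  have K0: "0 \<le> ?K x y" for x y using l by simp
  interpret Q: prob_space ?Q by (rule prob_space_centred[OF v])
  interpret N: prob_space ?N by (rule prob_space_centred) (use l in simp)
  define p where "p = measure ?Q ?B"
  have "real d * ?v / R\<^sup>2 \<le> 1 / 10" using mass R by (simp add: divide_le_eq)
  moreover have "9 / 10 \<le> 1 - x" if "x \<le> 1 / 10" for x :: real using that by simp
  ultimately have "9 / 10 \<le> 1 - real d * ?v / R\<^sup>2" by blast
  also have "\<dots> \<le> p" unfolding p_def by (rule centred_ball_mass[OF v R])
  finally have p: "9 / 10 \<le> p" "p \<le> 1" by (auto simp: p_def)
  have B [measurable]: "?B \<in> sets ?Q" by (simp add: sets_eball)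
  have eB: "emeasure ?Q ?B = ennreal p" by (simp add: p_def Q.emeasure_eq_measure)
  define Q' where "Q' = uniform_measure ?Q ?B"
  have setsQ' [measurable_cong]: "sets Q' = sets (Rd d)" by (simp add: Q'_def)
  have spQ': "space Q' = space (Rd d)" using sets_eq_imp_space_eq[OF setsQ'] .
  have spN: "space ?N = space (Rd d)" by (rule space_centred)
  interpret Q': prob_space Q'
    unfolding Q'_def by (rule prob_space_uniform_measure) (use p in \<open>auto simp: eB\<close>)
  interpret QN: pair_sigma_finite Q' ?N ..
  have Q'_int: "(\<integral>\<^sup>+x. g x \<partial>Q') = (\<integral>\<^sup>+x. g x * indicator ?B x \<partial>?Q) / ennreal p"
    if "g \<in> borel_measurable (Rd d)" for g
    unfolding Q'_def eB[symmetric] by (rule nn_integral_uniform_measure) (use that in \<open>auto cong: measurable_cong_sets\<close>)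
  have Q'_le: "ennreal p * (\<integral>\<^sup>+x. g x \<partial>Q') \<le> (\<integral>\<^sup>+x. g x \<partial>?Q)" if "g \<in> borel_measurable (Rd d)" for g
  proof -
    have "ennreal p * (\<integral>\<^sup>+x. g x \<partial>Q') = (\<integral>\<^sup>+x. g x * indicator ?B x \<partial>?Q)"
      unfolding Q'_int[OF that] using p by (simp add: ennreal_times_divide mult_divide_eq_ennreal mult.commute[of "ennreal p"])
    also have "\<dots> \<le> (\<integral>\<^sup>+x. g x \<partial>?Q)" by (intro nn_integral_mono) (auto simp: indicator_def)
    finally show ?thesis .
  qed
  have mK: "(\<lambda>(x, y). ?K x y) \<in> borel_measurable (Q' \<Otimes>\<^sub>M ?N)"
    unfolding case_prod_beta by (rule measurable_ratio) (auto cong: measurable_cong_sets)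
  have mK1: "(\<lambda>x. ?K x y) \<in> borel_measurable (Rd d)" if "y \<in> space (Rd d)" for y
    by (rule measurable_ratio[where f = "\<lambda>x. x" and g = "\<lambda>_. y"]) (use that in auto)
  have mK2: "(\<lambda>y. ?K x y) \<in> borel_measurable (Rd d)" if "x \<in> space (Rd d)" for x
    by (rule measurable_ratio[where f = "\<lambda>_. x" and g = "\<lambda>y. y"]) (use that in auto)
  have Kb: "?K x y \<le> (\<Prod>i<d. sqrt (l2 / l1) * exp (l1 / 2 * (y i)\<^sup>2))" for x y
    unfolding lik_ratio_def coord_ratio_def using l by (intro prod_mono) (auto intro!: mult_left_mono)
  have i1: "integrable Q' (\<lambda>x. ?K x y)" if "y \<in> space ?N" for y
    using mK1[of y] that K0 Kb unfolding spN
    by (intro Q'.integrable_const_bound[of _ "\<Prod>i<d. sqrt (l2 / l1) * exp (l1 / 2 * (y i)\<^sup>2)"])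
       (auto cong: measurable_cong_sets)
  have i2: "integrable Q' (\<lambda>x. (?K x y)\<^sup>2)" if "y \<in> space ?N" for y
    using mK1[of y] that K0 Kb unfolding spN
    by (intro Q'.integrable_const_bound[of _ "(\<Prod>i<d. sqrt (l2 / l1) * exp (l1 / 2 * (y i)\<^sup>2))\<^sup>2"])
       (auto cong: measurable_cong_sets intro!: power_mono)
  have m_inner: "(\<lambda>x. \<integral>\<^sup>+y. ennreal ((?K x y)\<^sup>2) \<partial>?N) \<in> borel_measurable (Rd d)"
  proof -
    have "(\<lambda>x. \<integral>\<^sup>+y. ennreal ((?K x y)\<^sup>2) \<partial>?N) \<in> borel_measurable Q'" using mK by measurable
    then show ?thesis by (simp add: measurable_cong_sets[OF setsQ' refl])
  qed
  have B2: "(\<integral>\<^sup>+x. \<integral>\<^sup>+y. ennreal ((?K x y)\<^sup>2) \<partial>?N \<partial>Q') \<le> ennreal (10 / 9 * (l2 / l1) ^ d)"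
  proof -
    have "(\<integral>\<^sup>+x. \<integral>\<^sup>+y. ennreal ((?K x y)\<^sup>2) \<partial>?N \<partial>Q') = ennreal (10 / 9) * (ennreal (9 / 10) * (\<integral>\<^sup>+x. \<integral>\<^sup>+y. ennreal ((?K x y)\<^sup>2) \<partial>?N \<partial>Q'))"
      unfolding mult.assoc[symmetric] by (simp add: ennreal_mult[symmetric])
    also have "\<dots> \<le> ennreal (10 / 9) * (ennreal p * (\<integral>\<^sup>+x. \<integral>\<^sup>+y. ennreal ((?K x y)\<^sup>2) \<partial>?N \<partial>Q'))"
      using p by (intro mult_left_mono mult_right_mono ennreal_leI) auto
    also have "\<dots> \<le> ennreal (10 / 9) * (\<integral>\<^sup>+x. \<integral>\<^sup>+y. ennreal ((?K x y)\<^sup>2) \<partial>?N \<partial>?Q)"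
      by (intro mult_left_mono Q'_le m_inner) auto
    also have "\<dots> = ennreal (10 / 9 * (l2 / l1) ^ d)"
      unfolding lik_ratio_mean_second_moment[OF l] using l by (simp add: ennreal_mult[symmetric])
    finally show ?thesis .
  qed
  define m where "m y = (\<integral>x. ?K x y \<partial>Q')" for y
  have "AE x in Q'. x \<in> ?B"
    unfolding Q'_def by (rule AE_uniform_measureI) auto
  from empirical_approximation[OF Q'.prob_space_axioms N.sigma_finite_measure_axioms mK i1 i2 B2 _ this, of M]
  obtain xs where xs: "\<And>j. j < M \<Longrightarrow> xs j \<in> ?B"
    and app: "(\<integral>\<^sup>+y. ennreal (((\<Sum>j<M. ?K (xs j) y) - real M * m y)\<^sup>2) \<partial>?N) \<le> ennreal (real M * (10 / 9 * (l2 / l1) ^ d))"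
    using l unfolding m_def by auto
  let ?q = "\<lambda>y. (\<Sum>j<M. ?K (xs j) y) / real M"
  have q [measurable]: "?q \<in> borel_measurable ?N"
  proof -
    have "(\<lambda>y. ?K (xs j) y) \<in> borel_measurable ?N" if "j < M" for j
      using mK2[of "xs j"] xs[OF that] by (auto simp: eball_def cong: measurable_cong_sets)
    then show ?thesis by (intro borel_measurable_divide borel_measurable_sum) auto
  qed
  have m_meas [measurable]: "m \<in> borel_measurable ?N" unfolding m_def using mK by measurable
  have m0: "0 \<le> m y" for y unfolding m_def using K0 by (intro integral_nonneg_AE) auto
  have m_nn: "ennreal (m y) = (\<integral>\<^sup>+x. ennreal (?K x y) \<partial>Q')" if "y \<in> space ?N" for y
    unfolding m_def using i1[OF that] K0 by (intro nn_integral_eq_integral[symmetric]) auto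
  have pm: "p * m y \<le> 1" if y: "y \<in> space ?N" for y
  proof -
    have "ennreal (p * m y) = ennreal p * (\<integral>\<^sup>+x. ennreal (?K x y) \<partial>Q')"
      using p m0 by (simp add: ennreal_mult m_nn[OF y])
    also have "\<dots> \<le> (\<integral>\<^sup>+x. ennreal (?K x y) \<partial>?Q)"
      using mK1[of y] y by (intro Q'_le) (auto simp: spN)
    also have "\<dots> = ennreal 1" using lik_ratio_mixture[OF l] by simp
    finally show ?thesis by (subst (asm) ennreal_le_iff) auto
  qed
  have D0: "0 \<le> D"
  proof (rule ccontr)
    assume "\<not> 0 \<le> D"
    then have "real M * D < 0" using M by (simp add: mult_less_0_iff)
    moreover have "0 \<le> 10 / 9 * (l2 / l1) ^ d" using l by simp
    ultimately show False using rate by linarith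
  qed
  have dev: "(\<integral>\<^sup>+y. ennreal ((m y - ?q y)\<^sup>2) \<partial>?N) \<le> ennreal D"
  proof -
    have "(m y - ?q y)\<^sup>2 = 1 / (real M)\<^sup>2 * ((\<Sum>j<M. ?K (xs j) y) - real M * m y)\<^sup>2" for y
    proof -
      have "m y - ?q y = - (1 / real M * ((\<Sum>j<M. ?K (xs j) y) - real M * m y))"
        using M by (simp add: field_simps)
      then show ?thesis by (simp only: power2_minus power_mult_distrib power_divide power_one)
    qed
    then have "(\<integral>\<^sup>+y. ennreal ((m y - ?q y)\<^sup>2) \<partial>?N)
       = (\<integral>\<^sup>+y. ennreal (1 / (real M)\<^sup>2) * ennreal (((\<Sum>j<M. ?K (xs j) y) - real M * m y)\<^sup>2) \<partial>?N)"
      by (simp only: ennreal_mult''[OF zero_le_power2])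
    also have "\<dots> = ennreal (1 / (real M)\<^sup>2) * (\<integral>\<^sup>+y. ennreal (((\<Sum>j<M. ?K (xs j) y) - real M * m y)\<^sup>2) \<partial>?N)"
    proof (rule nn_integral_cmult)
      have "(\<lambda>y. \<Sum>j<M. ?K (xs j) y) \<in> borel_measurable ?N"
      proof (rule borel_measurable_sum)
        fix j assume "j \<in> {..<M}"
        then show "(\<lambda>y. ?K (xs j) y) \<in> borel_measurable ?N"
          using mK2[of "xs j"] xs[of j] by (auto simp: eball_def cong: measurable_cong_sets)
      qed
      then show "(\<lambda>y. ennreal (((\<Sum>j<M. ?K (xs j) y) - real M * m y)\<^sup>2)) \<in> borel_measurable ?N" by measurable
    qed
    also have "\<dots> \<le> ennreal (1 / (real M)\<^sup>2) * ennreal (real M * (10 / 9 * (l2 / l1) ^ d))"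
      by (intro mult_left_mono app) simp
    also have "\<dots> = ennreal (1 / (real M)\<^sup>2 * (real M * (10 / 9 * (l2 / l1) ^ d)))"
      using l by (simp add: ennreal_mult[symmetric])
    also have "\<dots> \<le> ennreal D"
    proof (rule ennreal_leI)
      have "1 / (real M)\<^sup>2 * (real M * (10 / 9 * (l2 / l1) ^ d)) = (10 / 9 * (l2 / l1) ^ d) / real M"
        using M by (simp add: power2_eq_square)
      also have "\<dots> \<le> D" using rate M by (simp add: pos_divide_le_eq mult.commute)
      finally show "1 / (real M)\<^sup>2 * (real M * (10 / 9 * (l2 / l1) ^ d)) \<le> D" .
    qed
    finally show ?thesis .
  qed
  have "(\<integral>\<^sup>+y. ennreal (p * m y) \<partial>?N) \<le> (\<integral>\<^sup>+y. ennreal (min 1 (?q y)) \<partial>?N) + ennreal (1 / 5 + D / (4 * (1 / 5)))"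
  proof (rule overlap_lower_bound[where m = m])
    show "p * m y \<le> m y" for y using p m0[of y] by (simp add: mult_left_le_one_le)
    show "0 \<le> p * m y" for y using p m0[of y] by simp
    show "p * m y \<le> 1" if "y \<in> space ?N" for y by (rule pm[OF that])
    show "0 \<le> ?q y" for y using K0 by (intro divide_nonneg_nonneg sum_nonneg) auto
  qed (use dev D0 in \<open>auto intro: N.prob_space_axioms\<close>)
  also have "(\<integral>\<^sup>+y. ennreal (p * m y) \<partial>?N) = ennreal p"
  proof -
    have "(\<integral>\<^sup>+y. ennreal (p * m y) \<partial>?N) = (\<integral>\<^sup>+y. ennreal p * (\<integral>\<^sup>+x. ennreal (?K x y) \<partial>Q') \<partial>?N)"
      using p m0 by (intro nn_integral_cong) (simp add: ennreal_mult m_nn)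
    also have "\<dots> = ennreal p * (\<integral>\<^sup>+y. \<integral>\<^sup>+x. ennreal (?K x y) \<partial>Q' \<partial>?N)"
      using mK by (intro nn_integral_cmult) measurable
    also have "(\<integral>\<^sup>+y. \<integral>\<^sup>+x. ennreal (?K x y) \<partial>Q' \<partial>?N) = (\<integral>\<^sup>+x. \<integral>\<^sup>+y. ennreal (?K x y) \<partial>?N \<partial>Q')"
      using mK by (intro QN.Fubini') measurable
    also have "\<dots> = (\<integral>\<^sup>+x. 1 \<partial>Q')"
      using nn_integral_ratio[OF l(1) l2] by (intro nn_integral_cong) (simp add: spQ')
    finally show ?thesis by (simp add: Q'.emeasure_space_1)
  qed
  finally have "ennreal p \<le> (\<integral>\<^sup>+y. ennreal (min 1 (?q y)) \<partial>?N) + ennreal (1 / 5 + D / (4 * (1 / 5)))" .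
  then have "ennreal (p - (1 / 5 + D / (4 * (1 / 5)))) \<le> (\<integral>\<^sup>+y. ennreal (min 1 (?q y)) \<partial>?N)"
    by (rule ennreal_le_cancel_add) (use D0 in simp)
  then have "ennreal (1 / 4) \<le> (\<integral>\<^sup>+y. ennreal (min 1 (?q y)) \<partial>?N)"
    by (rule order_trans[rotated]) (rule ennreal_leI, use p D in simp)
  with xs show thesis by (rule that)
qed

text \<open>The signal law puts half its mass on the origin and half on a codebook.  At precision \<open>lmin\<close> the
  origin produces the centred Gaussian law of variance \<open>1 / lmin\<close>; at precision \<open>l2\<close> the codebook
  imitates it.  The other two halves are discarded, which costs only a constant factor.\<close>

lemma LD_risk_ge_codebook:
  assumes lm: "0 < lmin" "lmin < lmax" and d: "1 \<le> d" and k: "10 \<le> k" and R: "0 < R" and Rk: "5 / lmin * k \<le> R\<^sup>2"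
  shows "ennreal (min ((lmax - lmin)\<^sup>2) (lmin\<^sup>2 * (k\<^sup>2 / (real d)\<^sup>2)) / 128) \<le> LD_risk d k R lmin lmax"
proof -
  define \<delta> where "\<delta> = min (lmax - lmin) (lmin * k / (2 * real d))"
  have \<delta>: "0 < \<delta>" "\<delta> \<le> lmax - lmin" "\<delta> \<le> lmin * k / (2 * real d)" using lm d k by (auto simp: \<delta>_def)
  define l2 where "l2 = lmin + \<delta>"
  have l2: "lmin < l2" "l2 \<le> lmax" "0 < l2" using \<delta> lm by (auto simp: l2_def)
  let ?N = "centred_gaussian d (1 / lmin)"
  interpret N: prob_space ?N by (rule prob_space_centred) (use lm in simp)
  \<comment> \<open>The codebook has of order \<open>exp k\<close> points, against a likelihood ratio of second moment \<open>exp (k / 2)\<close>.\<close>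
  define M where "M = nat \<lfloor>exp (k - 1) / 2\<rfloor>"
  have ek: "10 \<le> exp (k - 1)" using exp_ge_add_one_self[of "k - 1"] k by linarith
  have M_real: "real M = real_of_int \<lfloor>exp (k - 1) / 2\<rfloor>" using ek by (simp add: M_def)
  have M_le: "2 * real M \<le> exp (k - 1)" unfolding M_real using of_int_floor_le[of "exp (k - 1) / 2"] by linarith
  have M_ge: "exp (k - 1) / 4 \<le> real M"
    unfolding M_real using floor_correct[of "exp (k - 1) / 2"] ek by linarith
  have M: "0 < M" using M_ge ek by (cases "M = 0") auto
  have mass: "real d * (1 / lmin - 1 / l2) \<le> R\<^sup>2 / 10"
  proof -
    have "1 / lmin - 1 / l2 = \<delta> / (lmin * l2)" using lm l2 by (simp add: l2_def field_simps)
    also have "\<dots> \<le> (lmin * k / (2 * real d)) / (lmin * lmin)"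
      using \<delta> lm l2 k by (intro frac_le mult_left_mono) auto
    also have "\<dots> = k / lmin / (2 * real d)" using lm by simp
    finally have "real d * (1 / lmin - 1 / l2) \<le> real d * (k / lmin / (2 * real d))" by (rule mult_left_mono) simp
    also have "\<dots> = 5 / lmin * k / 10" using d by simp
    also have "\<dots> \<le> R\<^sup>2 / 10" using Rk by (rule divide_right_mono) simp
    finally show ?thesis .
  qed
  have growth: "(l2 / lmin) ^ d \<le> exp (k / 2)"
  proof -
    have "l2 / lmin = 1 + \<delta> / lmin" using lm by (simp add: l2_def add_divide_distrib)
    also have "\<dots> \<le> 1 + k / (2 * real d)"
      using divide_right_mono[OF \<delta>(3), of lmin] lm by simp
    also have "\<dots> \<le> exp (k / (2 * real d))" by (rule exp_ge_add_one_self)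
    finally have "(l2 / lmin) ^ d \<le> exp (k / (2 * real d)) ^ d" using l2 lm by (intro power_mono) auto
    also have "\<dots> = exp (k / 2)" using d by (simp add: exp_of_nat_mult[symmetric])
    finally show ?thesis .
  qed
  have rate: "10 / 9 * (l2 / lmin) ^ d \<le> real M * (7 / 25)"
  proof -
    have "(2::real) ^ 4 \<le> exp 1 ^ 4" using exp_ge_add_one_self[of 1] by (intro power_mono) auto
    also have "\<dots> = exp 4" by (simp add: exp_of_nat_mult[symmetric])
    also have "\<dots> \<le> exp (k / 2 - 1)" using k by simp
    finally have "16 * exp (k / 2) \<le> exp (k / 2 - 1) * exp (k / 2)" by (intro mult_right_mono) auto
    also have "\<dots> = exp (k - 1)" by (simp add: exp_add[symmetric])
    finally show ?thesis using growth M_ge by linarith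
  qed
  obtain xs where xs: "\<And>j. j < M \<Longrightarrow> xs j \<in> eball d (origin d) R"
    and ov: "ennreal (1 / 4) \<le> (\<integral>\<^sup>+y. ennreal (min 1 ((\<Sum>j<M. lik_ratio d lmin l2 (xs j) y) / real M)) \<partial>?N)"
    using gaussian_codebook[OF lm(1) l2(1) R mass M rate] by auto
  let ?q = "\<lambda>y. (\<Sum>j<M. lik_ratio d lmin l2 (xs j) y) / real M"
  \<comment> \<open>The origin is repeated \<open>M\<close> times to carry half the mass of a uniform law.\<close>
  define pts where "pts j = (if j < M then origin d else if j < 2 * M then xs (j - M) else origin d)" for j
  have pts_space: "pts j \<in> space (Rd d)" for j
    using xs[of "j - M"] by (auto simp: pts_def eball_def)
  have pts_ball: "pts j \<in> eball d (origin d) R" for j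
    using xs[of "j - M"] R by (auto simp: pts_def eball_def)
  have n: "0 < 2 * M" using M by simp
  define P where "P = uniform_on_points d (2 * M) pts"
  have "ln (real (2 * M)) \<le> ln (exp (k - 1))" using M M_le by (intro ln_mono) auto
  then have PLD: "P \<in> LD_class d k R lmin lmax"
    unfolding P_def using lm n pts_space pts_ball by (intro uniform_on_points_LD_class) auto
  have xs_meas: "(\<lambda>y. lik_ratio d lmin l2 (xs j) y) \<in> borel_measurable (Rd d)" if "j < M" for j
    by (rule measurable_ratio[where f = "\<lambda>_. xs j" and g = "\<lambda>y. y"]) (use xs[OF that] in \<open>auto simp: eball_def\<close>)
  have q_meas: "?q \<in> borel_measurable ?N"
    unfolding measurable_cong_sets[OF sets_centred refl]
    using xs_meas by (intro borel_measurable_divide borel_measurable_sum) auto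
  have K0: "0 \<le> lik_ratio d lmin l2 x y" for x y using lm l2 by simp
  have q0: "0 \<le> ?q y" for y using K0 by (intro divide_nonneg_nonneg sum_nonneg) auto
  have law1: "ennreal (1 / 2) * (\<integral>\<^sup>+y. g y \<partial>?N) \<le> (\<integral>\<^sup>+y. g y \<partial>obs_law d P lmin)"
    if g: "g \<in> borel_measurable (Rd d)" for g
  proof -
    have "ennreal (1 / 2) * (\<integral>\<^sup>+y. g y \<partial>?N) = ennreal (1 / real (2 * M)) * (\<Sum>j<M. \<integral>\<^sup>+y. g y \<partial>?N)"
      using M by (simp add: ennreal_of_nat_eq_real_of_nat mult.assoc[symmetric] ennreal_mult[symmetric])
    also have "(\<Sum>j<M. \<integral>\<^sup>+y. g y \<partial>?N) = (\<Sum>j<M. \<integral>\<^sup>+y. ennreal (lik_ratio d lmin lmin (pts j) y) * g y \<partial>?N)"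
      using lm by (intro sum.cong) (auto simp: pts_def lik_ratio_origin_self)
    also have "\<dots> \<le> (\<Sum>j<2 * M. \<integral>\<^sup>+y. ennreal (lik_ratio d lmin lmin (pts j) y) * g y \<partial>?N)"
      by (intro sum_mono2) auto
    finally have "ennreal (1 / 2) * (\<integral>\<^sup>+y. g y \<partial>?N)
        \<le> ennreal (1 / real (2 * M)) * (\<Sum>j<2 * M. \<integral>\<^sup>+y. ennreal (lik_ratio d lmin lmin (pts j) y) * g y \<partial>?N)"
      by (simp add: mult_left_mono)
    then show ?thesis
      unfolding P_def nn_integral_obs_law_uniform_on_points[of "2 * M" pts d lmin lmin g, OF n pts_space lm(1) lm(1) g] .
  qed
  have law2: "ennreal (1 / 2) * (\<integral>\<^sup>+y. ennreal (?q y) * g y \<partial>?N) \<le> (\<integral>\<^sup>+y. g y \<partial>obs_law d P l2)"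
    if g: "g \<in> borel_measurable (Rd d)" for g
  proof -
    let ?I = "\<lambda>x. \<integral>\<^sup>+y. ennreal (lik_ratio d lmin l2 x y) * g y \<partial>?N"
    have gN [measurable]: "g \<in> borel_measurable ?N" using g by (simp cong: measurable_cong_sets)
    have xN [measurable]: "(\<lambda>y. lik_ratio d lmin l2 (xs j) y) \<in> borel_measurable ?N" if "j < M" for j
      using xs_meas[OF that] by (simp cong: measurable_cong_sets)
    have "(\<integral>\<^sup>+y. ennreal (?q y) * g y \<partial>?N)
        = (\<integral>\<^sup>+y. ennreal (1 / real M) * (\<Sum>j<M. ennreal (lik_ratio d lmin l2 (xs j) y) * g y) \<partial>?N)"
    proof (rule nn_integral_cong)
      fix y
      have "?q y = 1 / real M * (\<Sum>j<M. lik_ratio d lmin l2 (xs j) y)" by simp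
      then have "ennreal (?q y) = ennreal (1 / real M) * (\<Sum>j<M. ennreal (lik_ratio d lmin l2 (xs j) y))"
        using K0 by (simp only: ennreal_mult sum_nonneg sum_ennreal zero_le_divide_1_iff of_nat_0_le_iff)
      then show "ennreal (?q y) * g y = ennreal (1 / real M) * (\<Sum>j<M. ennreal (lik_ratio d lmin l2 (xs j) y) * g y)"
        by (simp only: sum_distrib_right mult.assoc)
    qed
    also have "\<dots> = ennreal (1 / real M) * (\<integral>\<^sup>+y. (\<Sum>j<M. ennreal (lik_ratio d lmin l2 (xs j) y) * g y) \<partial>?N)"
    proof (rule nn_integral_cmult, rule borel_measurable_sum)
      fix j assume "j \<in> {..<M}"
      then have [measurable]: "(\<lambda>y. lik_ratio d lmin l2 (xs j) y) \<in> borel_measurable ?N" using xN by simp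
      show "(\<lambda>y. ennreal (lik_ratio d lmin l2 (xs j) y) * g y) \<in> borel_measurable ?N" by measurable
    qed
    also have "(\<integral>\<^sup>+y. (\<Sum>j<M. ennreal (lik_ratio d lmin l2 (xs j) y) * g y) \<partial>?N) = (\<Sum>j<M. ?I (xs j))"
    proof (rule nn_integral_sum)
      fix j assume "j \<in> {..<M}"
      then have [measurable]: "(\<lambda>y. lik_ratio d lmin l2 (xs j) y) \<in> borel_measurable ?N" using xN by simp
      show "(\<lambda>y. ennreal (lik_ratio d lmin l2 (xs j) y) * g y) \<in> borel_measurable ?N" by measurable
    qed
    also have "(\<Sum>j<M. ?I (xs j)) = (\<Sum>j\<in>{M..<2 * M}. ?I (pts j))"
      by (rule sum.reindex_bij_witness[of _ "\<lambda>j. j - M" "\<lambda>j. j + M"]) (auto simp: pts_def)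
    finally have q_eq: "(\<integral>\<^sup>+y. ennreal (?q y) * g y \<partial>?N) = ennreal (1 / real M) * (\<Sum>j\<in>{M..<2 * M}. ?I (pts j))" .
    have "ennreal (1 / 2) * ennreal (1 / real M) = ennreal (1 / real (2 * M))"
      by (subst ennreal_mult[symmetric]) auto
    then have "ennreal (1 / 2) * (\<integral>\<^sup>+y. ennreal (?q y) * g y \<partial>?N)
        = ennreal (1 / real (2 * M)) * (\<Sum>j\<in>{M..<2 * M}. ?I (pts j))"
      by (simp only: q_eq mult.assoc[symmetric])
    also have "\<dots> \<le> ennreal (1 / real (2 * M)) * (\<Sum>j<2 * M. ?I (pts j))"
      by (intro mult_left_mono sum_mono2) auto
    finally show ?thesis
      unfolding P_def nn_integral_obs_law_uniform_on_points[of "2 * M" pts d lmin l2 g, OF n pts_space lm(1) l2(3) g] .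
  qed
  show ?thesis
  proof (rule LD_risk_lower_bound[OF PLD])
    fix f assume f: "f \<in> estimators d {lmin..lmax}"
    have "ennreal (1 / 2 * (1 / 4) * (l2 - lmin)\<^sup>2 / 4) \<le> max_risk d P {lmin..lmax} f"
      by (rule two_point_risk_bound[where N = ?N and q = ?q, OF _ _ f sets_centred q_meas q0 _ law1 law2 ov])
         (use lm l2 in auto)
    moreover have "min ((lmax - lmin)\<^sup>2) (lmin\<^sup>2 * (k\<^sup>2 / (real d)\<^sup>2)) / 128 \<le> 1 / 2 * (1 / 4) * (l2 - lmin)\<^sup>2 / 4"
    proof -
      have "min ((lmax - lmin)\<^sup>2) (lmin\<^sup>2 * (k\<^sup>2 / (real d)\<^sup>2)) / 4 \<le> \<delta>\<^sup>2"
      proof (cases "lmax - lmin \<le> lmin * k / (2 * real d)")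
        case True
        then have eq: "\<delta> = lmax - lmin" by (simp add: \<delta>_def)
        have "m / 4 \<le> b" if "m \<le> b" "0 \<le> b" for m b :: real using that by simp
        from this[OF min.cobounded1 zero_le_power2] show ?thesis unfolding eq .
      next
        case False
        then have "\<delta>\<^sup>2 = lmin\<^sup>2 * (k\<^sup>2 / (real d)\<^sup>2) / 4" by (simp add: \<delta>_def power_divide power_mult_distrib)
        then show ?thesis by simp
      qed
      then show ?thesis by (simp add: l2_def)
    qed
    ultimately show "ennreal (min ((lmax - lmin)\<^sup>2) (lmin\<^sup>2 * (k\<^sup>2 / (real d)\<^sup>2)) / 128) \<le> max_risk d P {lmin..lmax} f"
      using order_trans ennreal_leI by blast
  qed
qed

text \<open>For bounded \<open>k\<close> the term \<open>1 / d\<close> dominates, and the codebook takes over for large \<open>k\<close>.\<close>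

lemma LD_risk_lower:
  assumes lm: "0 < lmin" "lmin < lmax" and d: "1 \<le> d" and k: "1 \<le> k" and R: "0 < R" and Rk: "5 / lmin * k \<le> R\<^sup>2"
  shows "ennreal (1 / 4000 * min ((lmax - lmin)\<^sup>2) (lmin\<^sup>2 * (1 / real d + k\<^sup>2 / (real d)\<^sup>2))) \<le> LD_risk d k R lmin lmax"
proof -
  let ?A = "(lmax - lmin)\<^sup>2" and ?u = "lmin\<^sup>2 / real d" and ?w = "lmin\<^sup>2 * (k\<^sup>2 / (real d)\<^sup>2)"
  have nn: "0 \<le> ?A" "0 \<le> ?u" "0 \<le> ?w" by simp_all
  have split: "lmin\<^sup>2 * (1 / real d + k\<^sup>2 / (real d)\<^sup>2) = ?u + ?w" by (simp add: algebra_simps)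
  have scale: "min a (101 * b) \<le> 101 * min a b" if "0 \<le> a" for a b :: real using that by (auto simp: min_def)
  have add: "min a (b + c) \<le> 2 * max (min a b) (min a c)" if "0 \<le> a" "0 \<le> b" "0 \<le> c" for a b c :: real
    using that by (auto simp: min_def max_def)
  have "ennreal (1 / 4000 * min ?A (?u + ?w)) \<le> LD_risk d k R lmin lmax"
  proof (cases "k \<le> 10")
    case True
    have "k\<^sup>2 \<le> 10\<^sup>2" using k True by (intro power_mono) auto
    then have "?w \<le> lmin\<^sup>2 * (100 / (real d)\<^sup>2)" by (intro mult_left_mono divide_right_mono) auto
    also have "\<dots> \<le> lmin\<^sup>2 * (100 / real d)"
      using d by (intro mult_left_mono divide_left_mono) (auto simp: power2_eq_square)
    finally have "?u + ?w \<le> 101 * ?u" by simp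
    then have "min ?A (?u + ?w) \<le> min ?A (101 * ?u)" by (intro min.mono) auto
    also have "\<dots> \<le> 101 * min ?A ?u" by (rule scale) simp
    finally have le: "min ?A (?u + ?w) \<le> 101 * min ?A ?u" .
    have "1 / 4000 * a \<le> b / 32" if "a \<le> 101 * b" "0 \<le> b" for a b :: real using that by simp
    from this[OF le] have "1 / 4000 * min ?A (?u + ?w) \<le> min ?A ?u / 32" using nn by simp
    then show ?thesis
      using order_trans[OF ennreal_leI LD_risk_ge_parametric[OF lm d k R]] by blast
  next
    case False
    then have k10: "10 \<le> k" by simp
    have pick: "1 / 4000 * a \<le> b / 32 \<or> 1 / 4000 * a \<le> c / 128"
      if "a \<le> 2 * max b c" "0 \<le> b" "0 \<le> c" for a b c :: real
      using that by (auto simp: max_def split: if_splits)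
    have "0 \<le> min ?A ?u" "0 \<le> min ?A ?w" using nn by auto
    from pick[OF add[OF nn] this]
    have "1 / 4000 * min ?A (?u + ?w) \<le> min ?A ?u / 32 \<or> 1 / 4000 * min ?A (?u + ?w) \<le> min ?A ?w / 128" .
    then show ?thesis
      using order_trans[OF ennreal_leI LD_risk_ge_parametric[OF lm d k R]]
        order_trans[OF ennreal_leI LD_risk_ge_codebook[OF lm d k10 R Rk]] by blast
  qed
  then show ?thesis unfolding split .
qed

section \<open>Convexity of the log-partition function and the constrained MLE\<close>

text \<open>Normalise both exponentials to mean 1 and integrate the convexity inequality of \<open>exp\<close>; this is
  Hoelder's inequality by way of Young's.\<close>

lemma (in prob_space) convex_on_log_laplace:
  assumes D [measurable]: "D \<in> borel_measurable M" and D0: "\<And>x. 0 \<le> D x"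
  shows "convex_on {0..} (\<lambda>s. ln (\<integral>x. exp (- s * D x) \<partial>M))"
proof -
  let ?I = "\<lambda>s. \<integral>x. exp (- s * D x) \<partial>M"
  have int: "integrable M (\<lambda>x. exp (- s * D x))" if "0 \<le> s" for s
    by (rule integrable_const_bound[of _ 1]) (use that D0 in auto)
  have pos: "0 < ?I s" if "0 \<le> s" for s
  proof -
    have "?I s \<noteq> 0"
      using integral_nonneg_eq_0_iff_AE[OF int[OF that]] AE_False by simp
    moreover have "0 \<le> ?I s" by (rule integral_nonneg_AE) simp
    ultimately show ?thesis by linarith
  qed
  show ?thesis
  proof (rule convex_onI)
    fix t a b :: real
    assume t: "0 < t" "t < 1" and ab: "a \<in> {0..}" "b \<in> {0..}"
    let ?c = "(1 - t) * ln (?I a) + t * ln (?I b)"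
    have c0: "0 \<le> (1 - t) *\<^sub>R a + t *\<^sub>R b" using t ab by auto
    have "?I ((1 - t) *\<^sub>R a + t *\<^sub>R b)
        \<le> (\<integral>x. exp ?c * ((1 - t) * (exp (- a * D x) / ?I a) + t * (exp (- b * D x) / ?I b)) \<partial>M)"
    proof (rule integral_mono)
      show "integrable M (\<lambda>x. exp (- ((1 - t) *\<^sub>R a + t *\<^sub>R b) * D x))"
        by (rule int[OF c0])
      show "integrable M (\<lambda>x. exp ?c * ((1 - t) * (exp (- a * D x) / ?I a) + t * (exp (- b * D x) / ?I b)))"
        using int ab by (intro integrable_mult_right integrable_add integrable_divide) auto
      fix x
      let ?u = "- a * D x - ln (?I a)" and ?v = "- b * D x - ln (?I b)"
      have "exp ((1 - t) *\<^sub>R ?u + t *\<^sub>R ?v) \<le> (1 - t) * exp ?u + t * exp ?v"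
        using t by (intro convex_onD[OF exp_convex]) auto
      also have "\<dots> = (1 - t) * (exp (- a * D x) / ?I a) + t * (exp (- b * D x) / ?I b)"
        using pos ab by (simp add: exp_diff)
      finally have "exp ?c * exp ((1 - t) *\<^sub>R ?u + t *\<^sub>R ?v)
          \<le> exp ?c * ((1 - t) * (exp (- a * D x) / ?I a) + t * (exp (- b * D x) / ?I b))"
        by (rule mult_left_mono) simp
      also have "exp ?c * exp ((1 - t) *\<^sub>R ?u + t *\<^sub>R ?v)
          = exp (- ((1 - t) *\<^sub>R a + t *\<^sub>R b) * D x)"
        unfolding exp_add[symmetric] by (simp add: algebra_simps)
      finally show "exp (- ((1 - t) *\<^sub>R a + t *\<^sub>R b) * D x)
          \<le> exp ?c * ((1 - t) * (exp (- a * D x) / ?I a) + t * (exp (- b * D x) / ?I b))" .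
    qed
    also have "\<dots> = exp ?c * ((1 - t) * (?I a / ?I a) + t * (?I b / ?I b))"
    proof -
      have i: "integrable M (\<lambda>x. (1 - t) * (exp (- a * D x) / ?I a))" "integrable M (\<lambda>x. t * (exp (- b * D x) / ?I b))"
        using int ab by (intro integrable_mult_right integrable_divide; simp)+
      show ?thesis
        by (simp only: integral_mult_right_zero Bochner_Integration.integral_add[OF i] integral_divide_zero)
    qed
    also have "\<dots> = exp ?c"
      using pos[of a] pos[of b] ab by auto
    finally have "ln (?I ((1 - t) *\<^sub>R a + t *\<^sub>R b)) \<le> ln (exp ?c)"
      by (intro ln_mono pos[OF c0])
    then show "ln (?I ((1 - t) *\<^sub>R a + t *\<^sub>R b)) \<le> ?c" by (simp only: ln_exp)
  qed (rule convex_real_interval)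
qed

lemma le_of_scaled_le:
  fixes a g :: real
  assumes u0: "u0 > 0" and h: "\<And>u. 0 < u \<Longrightarrow> u < u0 \<Longrightarrow> g * (1 - u) \<le> a"
  shows "g \<le> a"
proof -
  have "((\<lambda>u. g * (1 - u)) \<longlongrightarrow> g * (1 - 0)) (at_right 0)"
    by (intro tendsto_intros)
  moreover have "eventually (\<lambda>u. g * (1 - u) \<le> a) (at_right 0)"
    using eventually_at_right_real[OF u0] by eventually_elim (use h in auto)
  ultimately show ?thesis
    using tendsto_upperbound[of "\<lambda>u. g * (1 - u)" g "at_right 0" a] by auto
qed

text \<open>These are one-sided first-order conditions.  A minimiser of \<open>- a * ln q - \<Psi> q\<close> below the
  upper end of the interval cannot gain by moving up.  By convexity the chord of \<open>\<Psi>\<close> to the right of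
  \<open>p\<close> is at least as steep as the one from 0 to \<open>p\<close>, so a long chord replaces the short one, and the
  logarithm contributes \<open>a / p\<close> in the limit.  The other condition uses the chord from \<open>p\<close> to \<open>2 * p\<close>;
  this is why \<open>\<Psi>\<close> is needed outside the interval.\<close>

lemma constrained_minimiser_stationary:
  fixes \<Psi> :: "real \<Rightarrow> real"
  assumes cv: "convex_on {0..} \<Psi>" and \<Psi>0: "\<Psi> 0 = 0"
    and lm: "0 < lmin" and p: "lmin \<le> p" "p \<le> lmax" and a: "0 \<le> a"
    and opt: "\<And>q. lmin \<le> q \<Longrightarrow> q \<le> lmax \<Longrightarrow> a * ln q + \<Psi> q \<le> a * ln p + \<Psi> p"
  shows "p < lmax \<Longrightarrow> a \<le> - \<Psi> p" and "lmin < p \<Longrightarrow> \<Psi> p - \<Psi> (2 * p) \<le> a"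
proof -
  have p0: "p > 0" using lm p by simp
  show "a \<le> - \<Psi> p" if pl: "p < lmax"
  proof (rule le_of_scaled_le[of "min 1 ((lmax - p) / p)"])
    show "0 < min 1 ((lmax - p) / p)" using pl p0 by auto
    fix u :: real assume u: "0 < u" "u < min 1 ((lmax - p) / p)"
    define q where "q = p * (1 + u)"
    have q: "p < q" "q \<le> lmax" using u p0 by (auto simp: q_def field_simps)
    have "(\<Psi> 0 - \<Psi> p) / (0 - p) \<le> (\<Psi> p - \<Psi> q) / (p - q)"
      using convex_on_slope_le[OF cv, of 0 q p] p0 q by auto
    then have "\<Psi> p / p \<le> (\<Psi> q - \<Psi> p) / (p * u)"
      using p0 u by (simp add: q_def \<Psi>0 field_simps)
    then have sl: "u * \<Psi> p \<le> \<Psi> q - \<Psi> p"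
      using p0 u by (simp add: field_simps)
    have "ln q = ln p + ln (1 + u)" using p0 u by (simp add: q_def ln_mult)
    with opt[of q] q p have "\<Psi> q - \<Psi> p \<le> - a * ln (1 + u)" by (simp add: algebra_simps)
    moreover have "ln (1 / (1 + u)) \<le> 1 / (1 + u) - 1"
      using u by (intro ln_le_minus_one) auto
    then have "u / (1 + u) \<le> ln (1 + u)" using u by (simp add: ln_div field_simps)
    then have "a * (u / (1 + u)) \<le> a * ln (1 + u)" using a by (rule mult_left_mono)
    moreover have "u * (a / (1 + u)) = a * (u / (1 + u))" by simp
    ultimately have "u * (a / (1 + u)) \<le> u * (- \<Psi> p)" using sl by (simp only: mult_minus_left mult_minus_right)
    then have "a / (1 + u) \<le> - \<Psi> p" using u by (subst (asm) mult_le_cancel_left_pos) auto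
    moreover have "1 - u \<le> 1 / (1 + u)" using u by (simp add: field_simps)
    then have "a * (1 - u) \<le> a * (1 / (1 + u))" using a by (rule mult_left_mono)
    ultimately show "a * (1 - u) \<le> - \<Psi> p" by simp
  qed
  show "\<Psi> p - \<Psi> (2 * p) \<le> a" if pl: "lmin < p"
  proof (rule le_of_scaled_le[of "(p - lmin) / p"])
    show "0 < (p - lmin) / p" using pl p0 by auto
    fix u :: real assume u: "0 < u" "u < (p - lmin) / p"
    have "(p - lmin) / p < 1" using lm p0 by simp
    then have u1: "u < 1" using u(2) by simp
    define q where "q = p * (1 - u)"
    have q: "lmin \<le> q" "q < p" using u p0 by (auto simp: q_def field_simps)
    have "(\<Psi> q - \<Psi> p) / (q - p) \<le> (\<Psi> p - \<Psi> (2 * p)) / (p - 2 * p)"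
      using convex_on_slope_le[OF cv, of q "2 * p" p] p0 q lm by auto
    then have "(\<Psi> p - \<Psi> q) / (p * u) \<le> (\<Psi> (2 * p) - \<Psi> p) / p"
      using p0 u by (simp add: q_def field_simps)
    then have "\<Psi> p - \<Psi> q \<le> (\<Psi> (2 * p) - \<Psi> p) / p * (p * u)"
      using p0 u pos_divide_le_eq[of "p * u"] by simp
    then have sl: "\<Psi> p - \<Psi> q \<le> u * (\<Psi> (2 * p) - \<Psi> p)"
      using p0 by (simp add: mult.commute)
    have "ln q = ln p + ln (1 - u)" using p0 u1 by (simp add: q_def ln_mult)
    with opt[of q] q p have o: "\<Psi> q - \<Psi> p \<le> a * (- ln (1 - u))" by (simp add: algebra_simps)
    have "ln (1 / (1 - u)) \<le> 1 / (1 - u) - 1"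
      using u1 by (intro ln_le_minus_one) auto
    then have "- ln (1 - u) \<le> u / (1 - u)" using u1 by (simp add: ln_div field_simps)
    then have "a * (- ln (1 - u)) \<le> a * (u / (1 - u))" using a by (rule mult_left_mono)
    then have "u * (\<Psi> p - \<Psi> (2 * p)) \<le> u * (a / (1 - u))" using sl o by (simp add: algebra_simps)
    then have "\<Psi> p - \<Psi> (2 * p) \<le> a / (1 - u)" using u by (subst (asm) mult_le_cancel_left_pos) auto
    then show "(\<Psi> p - \<Psi> (2 * p)) * (1 - u) \<le> a" using u1 by (simp add: field_simps)
  qed
qed

text \<open>The two bounds \<open>up\<close> and \<open>lo\<close> pin \<open>- \<Psi> q\<close> to \<open>q / 2 * V / l\<close> up to a multiple of \<open>L\<close> and terms of order one, and the
  stationarity conditions compare the slope \<open>V / l\<close> with \<open>d / p\<close>.  The radius \<open>r\<close> is such that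
  \<open>p * r * s\<close> is at most of the order of \<open>sqrt (V / d)\<close>, which is about 1.\<close>

lemma minimiser_error_bound:
  fixes \<Psi> :: "real \<Rightarrow> real"
  assumes cv: "convex_on {0..} \<Psi>" and \<Psi>0: "\<Psi> 0 = 0"
    and lm: "0 < lmin" and p: "lmin \<le> p" "p \<le> lmax" and l: "lmin \<le> l" "l \<le> lmax"
    and opt: "\<And>q. lmin \<le> q \<Longrightarrow> q \<le> lmax \<Longrightarrow> d / 2 * ln q + \<Psi> q \<le> d / 2 * ln p + \<Psi> p"
    and d: "1 \<le> d" and V: "0 \<le> V" and L: "0 \<le> L"
    and s_def: "s = sqrt (V / l)" and r_def: "r = sqrt lmin / (lmax * sqrt d)"
    and up: "\<And>q. 0 < q \<Longrightarrow> - \<Psi> q \<le> L + q / 2 * (s + 2 * r)\<^sup>2"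
    and lo: "\<And>q. 0 < q \<Longrightarrow> q / 2 * (s\<^sup>2 - 2 / l * L - 2 * r * s - r\<^sup>2) \<le> - \<Psi> q"
  shows "\<bar>p - l\<bar> \<le> lmax * (5 * \<bar>V - d\<bar> + 6 * L + 14) / d"
proof -
  have p0: "p > 0" and l0: "l > 0" and M0: "lmax > 0" using lm p l by auto
  have s2: "s\<^sup>2 = V / l" using V l0 by (simp add: s_def)
  have r0: "0 \<le> r" using lm M0 d by (simp add: r_def)
  have r2: "r\<^sup>2 = lmin / (lmax\<^sup>2 * d)"
    using lm d by (simp add: r_def power_divide power_mult_distrib)
  have "p * r\<^sup>2 \<le> lmax * r\<^sup>2" using p by (intro mult_right_mono) auto
  also have "\<dots> = lmin / lmax / d" using M0 unfolding r2 by (simp add: power2_eq_square)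
  also have "\<dots> \<le> 1 / 1" using lm p d M0 by (intro frac_le) (auto simp: divide_le_eq)
  finally have pr2: "p * r\<^sup>2 \<le> 1" by simp
  have "(p * r * s)\<^sup>2 = p\<^sup>2 * (lmin / (lmax\<^sup>2 * d)) * (V / l)"
    by (simp add: power_mult_distrib r2 s2)
  also have "\<dots> = (p / lmax)\<^sup>2 * (lmin / l) * (V / d)"
    by (simp add: power_divide field_simps)
  also have "\<dots> \<le> 1 * 1 * (V / d)"
    using lm p l M0 V d by (intro mult_right_mono mult_mono power_le_one) (auto simp: divide_le_eq)
  also have "\<dots> \<le> ((1 + V / d) / 2)\<^sup>2"
  proof -
    have "((1 + w) / 2)\<^sup>2 - w = ((1 - w) / 2)\<^sup>2" for w :: real
      by (simp add: power2_eq_square field_simps)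
    from this[of "V / d"] zero_le_power2[of "(1 - V / d) / 2"] show ?thesis by linarith
  qed
  finally have prs: "p * r * s \<le> (1 + V / d) / 2"
    by (rule power2_le_imp_le) (use V d in auto)
  have Vd: "V / d \<le> 1 + \<bar>V - d\<bar>"
  proof -
    have "V / d = 1 + (V - d) / d" using d by (simp add: field_simps)
    also have "(V - d) / d \<le> \<bar>V - d\<bar> / 1" using d by (intro frac_le) auto
    finally show ?thesis by simp
  qed
  have "\<bar>p - l\<bar> \<le> max p l * (5 * \<bar>V - d\<bar> + 6 * L + 14) / d"
  proof (cases "p < l")
    case True
    have "d / 2 \<le> - \<Psi> p"
      by (rule constrained_minimiser_stationary(1)[OF cv \<Psi>0 lm p _ opt]) (use d True l in auto)
    also have "\<dots> \<le> L + p / 2 * (s + 2 * r)\<^sup>2" by (rule up[OF p0])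
    finally have "d \<le> 2 * L + p * s\<^sup>2 + 4 * (p * r * s) + 4 * (p * r\<^sup>2)"
      by (simp add: power2_sum algebra_simps)
    also have "p * s\<^sup>2 = p / l * d + p / l * (V - d)"
      using l0 d by (simp add: s2 field_simps)
    also have "p / l * (V - d) \<le> 1 * \<bar>V - d\<bar>"
      using True l0 p0 by (intro order_trans[OF mult_left_mono[of "V - d" "\<bar>V - d\<bar>"]] mult_right_mono) auto
    finally have "(1 - p / l) * d \<le> 3 * \<bar>V - d\<bar> + 2 * L + 8 + 0"
      using prs pr2 Vd by (simp add: algebra_simps)
    also have "\<dots> \<le> 5 * \<bar>V - d\<bar> + 6 * L + 14" using L by simp
    finally have "(1 - p / l) * d \<le> 5 * \<bar>V - d\<bar> + 6 * L + 14" .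
    then have "l * ((1 - p / l) * d) \<le> l * (5 * \<bar>V - d\<bar> + 6 * L + 14)"
      using l0 by (intro mult_left_mono) auto
    moreover have "l * ((1 - p / l) * d) = (l - p) * d" using l0 by (simp add: field_simps)
    ultimately show ?thesis using True d by (simp add: field_simps)
  next
    case False
    show ?thesis
    proof (cases "p = l")
      case True then show ?thesis using d L l0 by simp
    next
      case pl: False
      with False have lp: "l < p" by simp
      have "- \<Psi> (2 * p) - - \<Psi> p \<le> d / 2"
        using constrained_minimiser_stationary(2)[OF cv \<Psi>0 lm p _ opt] d lp l by simp
      moreover have "p * (s\<^sup>2 - 2 / l * L - 2 * r * s - r\<^sup>2) - (L + p / 2 * (s + 2 * r)\<^sup>2) \<le> - \<Psi> (2 * p) - - \<Psi> p"
        using up[OF p0] lo[of "2 * p"] p0 by (intro diff_mono) simp_all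
      ultimately have "p * (s\<^sup>2 - 2 / l * L - 2 * r * s - r\<^sup>2) - (L + p / 2 * (s + 2 * r)\<^sup>2) \<le> d / 2"
        by (rule order_trans[rotated])
      then have "p * s\<^sup>2 \<le> d + (4 * (p / l) + 2) * L + 8 * (p * r * s) + 6 * (p * r\<^sup>2)"
        by (simp add: power2_sum algebra_simps)
      also have "\<dots> \<le> d + (6 * (p / l)) * L + 4 * (1 + V / d) + 6"
      proof (intro add_mono mult_right_mono L order_refl)
        have "1 \<le> p / l" using lp l0 by simp
        then show "4 * (p / l) + 2 \<le> 6 * (p / l)" by linarith
        have "8 * a \<le> 4 * b" if "a \<le> b / 2" for a b :: real using that by simp
        then show "8 * (p * r * s) \<le> 4 * (1 + V / d)" using prs .
        show "6 * (p * r\<^sup>2) \<le> 6" using pr2 by linarith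
      qed
      also have "\<dots> \<le> d + (6 * (p / l)) * L + (14 + 4 * \<bar>V - d\<bar>)" using Vd by simp
      finally have "l / p * (p * s\<^sup>2) \<le> l / p * (d + (6 * (p / l)) * L + (14 + 4 * \<bar>V - d\<bar>))"
        using l0 p0 by (intro mult_left_mono) auto
      also have "\<dots> = l / p * d + 6 * L + l / p * (14 + 4 * \<bar>V - d\<bar>)"
        using l0 p0 by (simp add: field_simps)
      also have "l / p * (14 + 4 * \<bar>V - d\<bar>) \<le> 1 * (14 + 4 * \<bar>V - d\<bar>)"
        using lp l0 by (intro mult_right_mono) auto
      also have "l / p * (p * s\<^sup>2) = V" using l0 p0 by (simp add: s2)
      finally have "(1 - l / p) * d \<le> 5 * \<bar>V - d\<bar> + 6 * L + 14"
        by (simp add: algebra_simps abs_if split: if_splits)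
      then have "p * ((1 - l / p) * d) \<le> p * (5 * \<bar>V - d\<bar> + 6 * L + 14)"
        using p0 by (intro mult_left_mono) auto
      moreover have "p * ((1 - l / p) * d) = (p - l) * d" using p0 by (simp add: field_simps)
      ultimately show ?thesis using lp d by (simp add: field_simps)
    qed
  qed
  also have "\<dots> \<le> lmax * (5 * \<bar>V - d\<bar> + 6 * L + 14) / d"
    using p l d L by (intro divide_right_mono mult_right_mono) auto
  finally show ?thesis .
qed

text \<open>Up to the normalising factor of the Gaussian density, the log likelihood of the precision \<open>l\<close>.\<close>

definition log_partition :: "nat \<Rightarrow> (nat \<Rightarrow> real) measure \<Rightarrow> (nat \<Rightarrow> real) \<Rightarrow> real \<Rightarrow> real" where
  "log_partition d P y l = ln (\<integral>x. exp (- (l / 2) * (edist d x y)\<^sup>2) \<partial>P)"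

context
  fixes d :: nat and P :: "(nat \<Rightarrow> real) measure"
  assumes P: "P \<in> prob_measures d"
begin

lemma prob_space_P: "prob_space P" and sets_P [measurable_cong]: "sets P = sets (Rd d)"
  using P by (auto simp: prob_measures_def)

lemma space_P: "space P = space (Rd d)"
  using sets_eq_imp_space_eq[OF sets_P] .

lemma measurable_edist_to: "y \<in> space (Rd d) \<Longrightarrow> (\<lambda>x. edist d x y) \<in> borel_measurable P"
  by measurable

lemma integrable_gibbs:
  assumes y: "y \<in> space (Rd d)" and l: "0 \<le> l"
  shows "integrable P (\<lambda>x. exp (- (l / 2) * (edist d x y)\<^sup>2))"
proof -
  interpret prob_space P by (rule prob_space_P)
  note measurable_edist_to[OF y, measurable]
  show ?thesis by (rule integrable_const_bound[of _ 1]) (use l in auto)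
qed

lemma gibbs_pos:
  assumes y: "y \<in> space (Rd d)" and l: "0 \<le> l"
  shows "0 < (\<integral>x. exp (- (l / 2) * (edist d x y)\<^sup>2) \<partial>P)"
proof -
  interpret prob_space P by (rule prob_space_P)
  have "(\<integral>x. exp (- (l / 2) * (edist d x y)\<^sup>2) \<partial>P) \<noteq> 0"
    using integral_nonneg_eq_0_iff_AE[OF integrable_gibbs[OF y l]] AE_False by simp
  moreover have "0 \<le> (\<integral>x. exp (- (l / 2) * (edist d x y)\<^sup>2) \<partial>P)"
    by (rule integral_nonneg_AE) simp
  ultimately show ?thesis by linarith
qed

lemma convex_on_log_partition:
  assumes y: "y \<in> space (Rd d)"
  shows "convex_on {0..} (log_partition d P y)"
proof -
  interpret prob_space P by (rule prob_space_P)
  note measurable_edist_to[OF y, measurable]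
  have "convex_on {0..} (\<lambda>s. ln (\<integral>x. exp (- s * ((edist d x y)\<^sup>2 / 2)) \<partial>P))"
    by (rule convex_on_log_laplace) auto
  then show ?thesis unfolding log_partition_def[abs_def] by simp
qed

lemma log_partition_0: "log_partition d P y 0 = 0"
proof -
  interpret prob_space P by (rule prob_space_P)
  show ?thesis by (simp add: log_partition_def prob_space)
qed

lemma neg_log_lik_eq:
  assumes y: "y \<in> space (Rd d)" and l: "0 < l"
  shows "neg_log_lik d P l y = real d / 2 * ln (2 * pi) - (real d / 2 * ln l + log_partition d P y l)"
proof -
  have "neg_log_lik d P l y = - (real d / 2 * ln (l / (2 * pi)) + log_partition d P y l)"
    using l gibbs_pos[OF y, of l]
    by (simp add: neg_log_lik_def obs_density_def log_partition_def ln_mult_pos ln_powr)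
  also have "ln (l / (2 * pi)) = ln l - ln (2 * pi)" using l by (intro ln_divide_pos) auto
  finally show ?thesis by (simp only: right_diff_distrib)
qed

text \<open>The points of the cell around \<open>c\<close> are at most \<open>2 * r\<close> farther from \<open>y\<close> than \<open>x\<close> is.\<close>

lemma log_partition_ge:
  assumes y: "y \<in> space (Rd d)" and l: "0 < l"
    and c: "c \<in> space (Rd d)" and x: "x \<in> eball d c r" and \<beta>: "0 < \<beta>" "\<beta> \<le> measure P (eball d c r)"
  shows "ln \<beta> - l / 2 * (edist d x y + 2 * r)\<^sup>2 \<le> log_partition d P y l"
proof -
  interpret prob_space P by (rule prob_space_P)
  let ?B = "eball d c r" and ?e = "exp (- (l / 2) * (edist d x y + 2 * r)\<^sup>2)"
  have [measurable]: "?B \<in> sets P" using sets_eball[OF c] sets_P by simp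
  have "\<beta> * ?e \<le> measure P ?B * ?e" using \<beta> by (intro mult_right_mono) auto
  also have "\<dots> = (\<integral>w. indicator ?B w * ?e \<partial>P)" by simp
  also have "\<dots> \<le> (\<integral>w. exp (- (l / 2) * (edist d w y)\<^sup>2) \<partial>P)"
  proof (rule integral_mono)
    show "integrable P (\<lambda>w. indicator ?B w * ?e)"
      by (intro integrable_mult_left integrable_real_indicator) (auto simp: emeasure_eq_measure)
    show "integrable P (\<lambda>w. exp (- (l / 2) * (edist d w y)\<^sup>2))"
      using integrable_gibbs[OF y] l by simp
    fix w
    show "indicator ?B w * ?e \<le> exp (- (l / 2) * (edist d w y)\<^sup>2)"
    proof (cases "w \<in> ?B")
      case True
      have "edist d w y \<le> edist d w c + edist d c x + edist d x y"
        using edist_triangle[of d w y c] edist_triangle[of d c y x] by simp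
      also have "\<dots> \<le> edist d x y + 2 * r"
        using True x by (simp add: eball_def edist_commute[of d w c])
      finally have "(edist d w y)\<^sup>2 \<le> (edist d x y + 2 * r)\<^sup>2"
        by (intro power_mono) auto
      then show ?thesis using True l by simp
    qed simp
  qed
  finally have "ln (\<beta> * ?e) \<le> log_partition d P y l"
    unfolding log_partition_def using \<beta> by (intro ln_mono) auto
  then show ?thesis using \<beta> by (simp add: ln_mult_pos)
qed

lemma log_partition_le:
  assumes y: "y \<in> space (Rd d)" and l: "0 < l"
    and m: "AE w in P. m \<le> (edist d w y)\<^sup>2"
  shows "log_partition d P y l \<le> - (l / 2 * m)"
proof -
  interpret prob_space P by (rule prob_space_P)
  have "(\<integral>w. exp (- (l / 2) * (edist d w y)\<^sup>2) \<partial>P) \<le> (\<integral>w. exp (- (l / 2 * m)) \<partial>P)"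
  proof (rule integral_mono_AE)
    show "integrable P (\<lambda>w. exp (- (l / 2) * (edist d w y)\<^sup>2))"
      using integrable_gibbs[OF y] l by simp
    show "AE w in P. exp (- (l / 2) * (edist d w y)\<^sup>2) \<le> exp (- (l / 2 * m))"
      using m by eventually_elim (use l in auto)
  qed simp
  then have "log_partition d P y l \<le> ln (exp (- (l / 2 * m)))"
    unfolding log_partition_def using gibbs_pos[OF y, of l] l by (intro ln_mono) (auto simp: prob_space)
  then show ?thesis by simp
qed

lemma measurable_neg_log_lik:
  assumes l: "0 < l"
  shows "(\<lambda>y. neg_log_lik d P l y) \<in> borel_measurable (Rd d)"
proof -
  interpret prob_space P by (rule prob_space_P)
  have "(\<lambda>(y, x). exp (- (l / 2) * (edist d x y)\<^sup>2)) \<in> borel_measurable (Rd d \<Otimes>\<^sub>M P)"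
    by measurable
  then show ?thesis
    unfolding neg_log_lik_def obs_density_def by measurable
qed

lemma continuous_on_neg_log_lik:
  assumes y: "y \<in> space (Rd d)"
  shows "continuous_on {0<..} (\<lambda>l. neg_log_lik d P l y)"
proof -
  have "convex_on {0<..} (log_partition d P y)"
    by (rule convex_on_subset[OF convex_on_log_partition[OF y]]) auto
  then have "continuous_on {0<..} (log_partition d P y)"
    by (intro convex_on_continuous) auto
  then have "continuous_on {0<..} (\<lambda>l. real d / 2 * ln (2 * pi) - (real d / 2 * ln l + log_partition d P y l))"
    by (intro continuous_intros) auto
  then show ?thesis
    by (rule continuous_on_eq) (simp add: neg_log_lik_eq[OF y])
qed

text \<open>The least minimiser is a measurable choice.\<close>

lemma constrained_MLE_exists:
  assumes lm: "0 < lmin" "lmin \<le> lmax"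
  shows "\<exists>f. constrained_MLE d P {lmin..lmax} f"
proof -
  let ?h = "\<lambda>l y. neg_log_lik d P l y"
  define A where "A y = {l \<in> {lmin..lmax}. \<forall>l'\<in>{lmin..lmax}. ?h l y \<le> ?h l' y}" for y
  define f where "f y = Inf (A y)" for y
  have cont: "continuous_on {lmin..a} (\<lambda>l. ?h l y)" if "y \<in> space (Rd d)" for y a
    by (rule continuous_on_subset[OF continuous_on_neg_log_lik[OF that]]) (use lm in auto)
  have fA: "f y \<in> A y" if y: "y \<in> space (Rd d)" for y
  proof -
    obtain l where "l \<in> {lmin..lmax}" "\<forall>l'\<in>{lmin..lmax}. ?h l y \<le> ?h l' y"
      using continuous_attains_inf[OF compact_Icc _ cont[OF y, of lmax]] lm by auto
    then have ne: "A y \<noteq> {}" unfolding A_def by blast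
    have bd: "bdd_below (A y)" by (auto simp: A_def intro!: bdd_belowI[of _ lmin])
    have eqA: "A y = {lmin..lmax} \<inter> (\<Inter>l'\<in>{lmin..lmax}. {l \<in> {lmin..lmax}. ?h l y \<le> ?h l' y})"
      unfolding A_def using lm by auto
    have cl: "closed {l \<in> {lmin..lmax}. ?h l y \<le> ?h l' y}" for l'
      using continuous_on_closed_Collect_le[OF cont[OF y, of lmax], of "\<lambda>_. ?h l' y"] by simp
    have "closed (A y)"
      unfolding eqA by (intro closed_Int closed_INT ballI cl closed_atLeastAtMost)
    then show ?thesis unfolding f_def by (intro closed_contains_Inf ne bd)
  qed
  have f_le: "f y \<le> l" if "l \<in> A y" for l y
    unfolding f_def using that by (intro cInf_lower) (auto simp: A_def intro!: bdd_belowI[of _ lmin])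
  \<comment> \<open>The sublevel sets of the least minimiser are described by countably many comparisons,
    because the likelihood is continuous in the precision.\<close>
  have "f \<in> borel_measurable (Rd d)"
  proof (rule borel_measurableI_le)
    fix a
    obtain D where D: "countable D" "D \<subseteq> {lmin..lmax}" "{lmin..lmax} \<subseteq> closure D" by (rule separable)
    obtain E where E: "countable E" "E \<subseteq> {lmin..min a lmax}" "{lmin..min a lmax} \<subseteq> closure E" by (rule separable)
    have cl: "closure D = {lmin..lmax}" "closure E = {lmin..min a lmax}"
      by (rule antisym[OF closure_minimal[OF D(2) closed_atLeastAtMost] D(3)],
          rule antisym[OF closure_minimal[OF E(2) closed_atLeastAtMost] E(3)])
    have eq: "f y \<le> a \<longleftrightarrow> (\<forall>q\<in>D. \<forall>n::nat. \<exists>p\<in>E. ?h p y < ?h q y + 1 / Suc n)" if y: "y \<in> space (Rd d)" for y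
    proof
      assume fa: "f y \<le> a"
      show "\<forall>q\<in>D. \<forall>n::nat. \<exists>p\<in>E. ?h p y < ?h q y + 1 / Suc n"
      proof (intro ballI allI, rule ccontr)
        fix q n assume q: "q \<in> D" and no: "\<not> (\<exists>p\<in>E. ?h p y < ?h q y + 1 / Suc n)"
        have "f y \<in> closure E" unfolding cl using fA[OF y] fa by (simp add: A_def)
        moreover have "continuous_on (closure E) (\<lambda>l. ?h l y)" unfolding cl by (rule cont[OF y])
        moreover have "?h q y + 1 / Suc n \<le> ?h p y" if "p \<in> E" for p
          using no that by (meson not_less)
        ultimately have "?h q y + 1 / Suc n \<le> ?h (f y) y"
          using continuous_ge_on_closure[of E "\<lambda>l. ?h l y"] by blast
        moreover have "?h (f y) y \<le> ?h q y" using fA[OF y] q D by (auto simp: A_def)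
        moreover have "0 < 1 / real (Suc n)" by simp
        ultimately show False by linarith
      qed
    next
      assume H: "\<forall>q\<in>D. \<forall>n::nat. \<exists>p\<in>E. ?h p y < ?h q y + 1 / Suc n"
      have "D \<noteq> {}" using D lm by auto
      then have "{lmin..min a lmax} \<noteq> {}" using H E by blast
      then obtain m where m: "m \<in> {lmin..min a lmax}" "\<forall>p\<in>{lmin..min a lmax}. ?h m y \<le> ?h p y"
        using continuous_attains_inf[OF compact_Icc _ cont[OF y, of "min a lmax"]] by blast
      have "?h m y \<le> ?h q y" if q: "q \<in> D" for q
      proof (rule field_le_epsilon)
        fix e :: real assume "0 < e"
        then obtain n :: nat where n: "1 / Suc n < e" using nat_approx_posE by blast
        obtain p where "p \<in> E" "?h p y < ?h q y + 1 / Suc n" using H q by blast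
        moreover have "?h m y \<le> ?h p y" using m(2) E(2) \<open>p \<in> E\<close> by blast
        ultimately show "?h m y \<le> ?h q y + e" using n by linarith
      qed
      then have "?h m y \<le> ?h q y" if "q \<in> {lmin..lmax}" for q
        using that cont[OF y, of lmax] continuous_ge_on_closure[of D "\<lambda>l. ?h l y"] unfolding cl by blast
      then have "m \<in> A y" using m by (auto simp: A_def)
      then show "f y \<le> a" using f_le[of m y] m by auto
    qed
    have "{y \<in> space (Rd d). \<forall>q\<in>D. \<forall>n::nat. \<exists>p\<in>E. ?h p y < ?h q y + 1 / Suc n} \<in> sets (Rd d)"
    proof (intro sets.sets_Collect_countable_All' sets.sets_Collect_countable_All sets.sets_Collect_countable_Ex' D(1) E(1))
      fix q n p assume "q \<in> D" "p \<in> E"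
      then have "0 < q" "0 < p" using D E lm by auto
      note measurable_neg_log_lik[OF this(1), measurable] measurable_neg_log_lik[OF this(2), measurable]
      show "{y \<in> space (Rd d). ?h p y < ?h q y + 1 / Suc n} \<in> sets (Rd d)" by measurable
    qed
    also have "{y \<in> space (Rd d). \<forall>q\<in>D. \<forall>n::nat. \<exists>p\<in>E. ?h p y < ?h q y + 1 / Suc n}
        = {y \<in> space (Rd d). f y \<le> a}" using eq by auto
    finally show "{y \<in> space (Rd d). f y \<le> a} \<in> sets (Rd d)" .
  qed
  then have "f \<in> estimators d {lmin..lmax}"
    unfolding estimators_def using fA by (intro measurable_restrict_space2) (auto simp: A_def)
  then have "constrained_MLE d P {lmin..lmax} f"
    unfolding constrained_MLE_def is_arg_min_linorder using fA by (auto simp: A_def)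
  then show ?thesis by blast
qed

end

section \<open>Risk of the MLE\<close>

lemma square_le_two_sided_exp: "t\<^sup>2 \<le> 2 * (exp t + exp (- t))" for t :: real
proof -
  have *: "s\<^sup>2 \<le> 2 * exp s" if "0 \<le> s" for s :: real
    using exp_lower_Taylor_quadratic[OF that] that by linarith
  show ?thesis
  proof (cases "0 \<le> t")
    case True then show ?thesis using *[OF True] by (simp add: distrib_left add_increasing2)
  next
    case False then show ?thesis using *[of "- t"] by (simp add: distrib_left add_increasing)
  qed
qed

lemma chi_square_exp_moment:
  assumes \<theta>: "\<bar>\<theta>\<bar> \<le> 1 / 4"
  shows "(\<integral>\<^sup>+z. ennreal (exp (\<theta> * ((\<Sum>i<d. (z i)\<^sup>2) - real d))) \<partial>std_gaussian d)
    \<le> ennreal (exp (4 * \<theta>\<^sup>2 * real d))"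
proof -
  have "(\<integral>\<^sup>+z. ennreal (exp (\<theta> * ((\<Sum>i<d. (z i)\<^sup>2) - real d))) \<partial>std_gaussian d)
      = (\<integral>\<^sup>+z. (\<Prod>i<d. ennreal (exp (\<theta> * (z i)\<^sup>2) * exp (- \<theta>))) \<partial>std_gaussian d)"
  proof (rule nn_integral_cong)
    fix z :: "nat \<Rightarrow> real"
    have "exp (\<theta> * ((\<Sum>i<d. (z i)\<^sup>2) - real d)) = exp (\<Sum>i<d. \<theta> * (z i)\<^sup>2 - \<theta>)"
      by (simp add: sum_subtractf sum_distrib_left right_diff_distrib mult.commute)
    also have "\<dots> = (\<Prod>i<d. exp (\<theta> * (z i)\<^sup>2) * exp (- \<theta>))"
      by (simp add: exp_sum exp_diff exp_minus divide_inverse)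
    finally show "ennreal (exp (\<theta> * ((\<Sum>i<d. (z i)\<^sup>2) - real d))) = (\<Prod>i<d. ennreal (exp (\<theta> * (z i)\<^sup>2) * exp (- \<theta>)))"
      by (simp add: prod_ennreal)
  qed
  also have "\<dots> = (\<Prod>i<d. \<integral>\<^sup>+t. ennreal (exp (\<theta> * t\<^sup>2) * exp (- \<theta>)) \<partial>gauss 0 1)"
    unfolding std_gaussian_eq by (rule nn_integral_prod_gauss) auto
  also have "(\<integral>\<^sup>+t. ennreal (exp (\<theta> * t\<^sup>2) * exp (- \<theta>)) \<partial>gauss 0 1) = ennreal (exp (- \<theta>) / sqrt (1 - 2 * \<theta>))"
  proof -
    have "(\<integral>\<^sup>+t. ennreal (exp (\<theta> * t\<^sup>2) * exp (- \<theta>)) \<partial>gauss 0 1)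
        = (\<integral>\<^sup>+t. ennreal (exp (\<theta> * t\<^sup>2 + 0 * t)) * ennreal (exp (- \<theta>)) \<partial>gauss 0 1)"
      by (simp add: ennreal_mult')
    also have "\<dots> = ennreal (1 / sqrt (1 - 2 * \<theta>)) * ennreal (exp (- \<theta>))"
      using gauss_exp_quadratic[of 1 \<theta> 0] \<theta> by (subst nn_integral_multc) auto
    finally show ?thesis using \<theta> by (simp add: ennreal_mult'[symmetric])
  qed
  also have "(\<Prod>i<d. ennreal (exp (- \<theta>) / sqrt (1 - 2 * \<theta>))) = ennreal ((exp (- \<theta>) / sqrt (1 - 2 * \<theta>)) ^ d)"
    using \<theta> by (simp add: ennreal_power)
  also have "\<dots> \<le> ennreal (exp (4 * \<theta>\<^sup>2) ^ d)"
  proof (intro ennreal_leI power_mono)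
    have p: "0 < 1 - 2 * \<theta>" using \<theta> by auto
    have "\<bar>ln (1 + - 2 * \<theta>) - (- 2 * \<theta>)\<bar> \<le> 2 * (- 2 * \<theta>)\<^sup>2"
      using \<theta> by (intro abs_ln_one_plus_x_minus_x_bound) auto
    then have "- \<theta> - ln (1 - 2 * \<theta>) / 2 \<le> 4 * \<theta>\<^sup>2" by (simp add: power2_eq_square)
    then have "exp (- \<theta> - ln (1 - 2 * \<theta>) / 2) \<le> exp (4 * \<theta>\<^sup>2)" by simp
    moreover have "exp (ln (1 - 2 * \<theta>) / 2) = sqrt (1 - 2 * \<theta>)"
      using p by (simp add: powr_half_sqrt[symmetric] powr_def)
    ultimately show "exp (- \<theta>) / sqrt (1 - 2 * \<theta>) \<le> exp (4 * \<theta>\<^sup>2)" by (simp add: exp_diff)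
    show "0 \<le> exp (- \<theta>) / sqrt (1 - 2 * \<theta>)" using p by simp
  qed
  also have "exp (4 * \<theta>\<^sup>2) ^ d = exp (4 * \<theta>\<^sup>2 * real d)"
    by (simp add: exp_of_nat_mult[symmetric] mult.commute)
  finally show ?thesis .
qed

text \<open>The square is dominated by exponentials, whose expectations factor over the coordinates; the scale
  \<open>\<theta> = 1 / (4 * sqrt d)\<close> keeps them bounded.\<close>

lemma chi_square_variance_bound:
  assumes d: "1 \<le> d"
  shows "(\<integral>\<^sup>+z. ennreal (((\<Sum>i<d. (z i)\<^sup>2) - real d)\<^sup>2) \<partial>std_gaussian d) \<le> ennreal (96 * real d)"
proof -
  define \<theta> where "\<theta> = 1 / (4 * sqrt (real d))"
  have \<theta>: "0 < \<theta>" "\<theta> \<le> 1 / 4" using d by (auto simp: \<theta>_def divide_le_eq)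
  have \<theta>2: "\<theta>\<^sup>2 = 1 / (16 * real d)" by (simp add: \<theta>_def power_divide power_mult_distrib)
  let ?E = "\<lambda>\<theta> z::nat\<Rightarrow>real. exp (\<theta> * ((\<Sum>i<d. (z i)\<^sup>2) - real d))"
  have [measurable]: "(\<lambda>z. ?E a z) \<in> borel_measurable (std_gaussian d)" for a
  proof -
    have "(\<lambda>z. \<Sum>i<d. (z i)\<^sup>2) \<in> borel_measurable (Rd d)"
      by (intro borel_measurable_sum borel_measurable_power measurable_coordinate) auto
    then show ?thesis by (simp cong: measurable_cong_sets)
  qed
  have e14: "exp (1 / 4 :: real) \<le> 3 / 2"
    using exp_bound[of "1 / 4 :: real"] by (simp add: power2_eq_square)
  have "(\<integral>\<^sup>+z. ennreal (((\<Sum>i<d. (z i)\<^sup>2) - real d)\<^sup>2) \<partial>std_gaussian d)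
      \<le> (\<integral>\<^sup>+z. ennreal (32 * real d) * (ennreal (?E \<theta> z) + ennreal (?E (- \<theta>) z)) \<partial>std_gaussian d)"
  proof (rule nn_integral_mono)
    fix z :: "nat \<Rightarrow> real"
    let ?t = "(\<Sum>i<d. (z i)\<^sup>2) - real d"
    have "(\<theta> * ?t)\<^sup>2 \<le> 2 * (exp (\<theta> * ?t) + exp (- (\<theta> * ?t)))" by (rule square_le_two_sided_exp)
    then have "16 * real d * (\<theta>\<^sup>2 * ?t\<^sup>2) \<le> 16 * real d * (2 * (?E \<theta> z + ?E (- \<theta>) z))"
      by (intro mult_left_mono) (simp_all add: power_mult_distrib)
    then have "?t\<^sup>2 \<le> 32 * real d * (?E \<theta> z + ?E (- \<theta>) z)"
      using d by (simp add: \<theta>2 distrib_left)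
    then show "ennreal (?t\<^sup>2) \<le> ennreal (32 * real d) * (ennreal (?E \<theta> z) + ennreal (?E (- \<theta>) z))"
      by (simp add: ennreal_mult[symmetric] ennreal_plus[symmetric] ennreal_leI del: ennreal_plus)
  qed
  also have "\<dots> = ennreal (32 * real d) * ((\<integral>\<^sup>+z. ennreal (?E \<theta> z) \<partial>std_gaussian d)
      + (\<integral>\<^sup>+z. ennreal (?E (- \<theta>) z) \<partial>std_gaussian d))"
    by (subst nn_integral_cmult, measurable, subst nn_integral_add, measurable)
  also have "\<dots> \<le> ennreal (32 * real d) * (ennreal (3 / 2) + ennreal (3 / 2))"
  proof (intro mult_left_mono add_mono)
    show "(\<integral>\<^sup>+z. ennreal (?E \<theta> z) \<partial>std_gaussian d) \<le> ennreal (3 / 2)"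
      using chi_square_exp_moment[of \<theta> d] \<theta> d e14
      by (intro order_trans[OF chi_square_exp_moment] ennreal_leI) (auto simp: \<theta>2)
    show "(\<integral>\<^sup>+z. ennreal (?E (- \<theta>) z) \<partial>std_gaussian d) \<le> ennreal (3 / 2)"
      using chi_square_exp_moment[of "- \<theta>" d] \<theta> d e14
      by (intro order_trans[OF chi_square_exp_moment] ennreal_leI) (auto simp: \<theta>2)
  qed simp
  also have "\<dots> = ennreal (32 * real d * (3 / 2 + 3 / 2))"
    by (simp only: ennreal_mult' ennreal_plus)
  also have "32 * real d * (3 / 2 + 3 / 2) = 96 * real d" by simp
  finally show ?thesis .
qed

lemma edist_noisy_sq:
  assumes "0 < l"
  shows "(edist d x (noisy d l x z))\<^sup>2 = (\<Sum>i<d. (z i)\<^sup>2) / l"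
  using assms by (simp add: edist_sq power_divide sum_divide_distrib)

text \<open>The exponential is the likelihood ratio of the signal \<open>c\<close> against the signal \<open>x\<close> at \<open>noisy d l x z\<close>.
  Summed over the centres of a cover and combined with Markov's inequality, this is the union bound
  for the centres being close to the observation.\<close>

lemma likelihood_ratio_mean_one:
  assumes l: "0 < l"
  shows "(\<integral>\<^sup>+z. ennreal (exp ((\<Sum>i<d. (z i)\<^sup>2) / 2 - l / 2 * (edist d c (noisy d l x z))\<^sup>2)) \<partial>std_gaussian d) = 1"
proof -
  define h where "h i = sqrt l * (c i - x i)" for i
  have "(\<integral>\<^sup>+z. ennreal (exp ((\<Sum>i<d. (z i)\<^sup>2) / 2 - l / 2 * (edist d c (noisy d l x z))\<^sup>2)) \<partial>std_gaussian d)
     = (\<integral>\<^sup>+z. (\<Prod>i<d. ennreal (exp (0 * (z i)\<^sup>2 + h i * z i) * exp (- ((h i)\<^sup>2 / 2)))) \<partial>std_gaussian d)"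
  proof (rule nn_integral_cong)
    fix z :: "nat \<Rightarrow> real"
    have "l * (c i - (x i + z i / sqrt l))\<^sup>2 = (h i - z i)\<^sup>2" for i
    proof -
      have "l * (c i - (x i + z i / sqrt l))\<^sup>2 = (sqrt l * (c i - (x i + z i / sqrt l)))\<^sup>2"
        using l by (simp add: power_mult_distrib)
      also have "sqrt l * (c i - (x i + z i / sqrt l)) = h i - z i"
        using l by (simp add: h_def algebra_simps)
      finally show ?thesis .
    qed
    then have "(\<Sum>i<d. (z i)\<^sup>2) / 2 - l / 2 * (edist d c (noisy d l x z))\<^sup>2 = (\<Sum>i<d. (z i)\<^sup>2 / 2 - (h i - z i)\<^sup>2 / 2)"
      by (simp add: edist_sq sum_subtractf sum_distrib_left sum_divide_distrib)
    also have "\<dots> = (\<Sum>i<d. h i * z i + - ((h i)\<^sup>2 / 2))"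
      by (intro sum.cong) (auto simp: power2_eq_square field_simps)
    finally show "ennreal (exp ((\<Sum>i<d. (z i)\<^sup>2) / 2 - l / 2 * (edist d c (noisy d l x z))\<^sup>2))
       = (\<Prod>i<d. ennreal (exp (0 * (z i)\<^sup>2 + h i * z i) * exp (- ((h i)\<^sup>2 / 2))))"
      by (simp only: exp_sum finite_lessThan exp_add mult_zero_left add_0 prod_ennreal mult_nonneg_nonneg exp_ge_zero)
  qed
  also have "\<dots> = (\<Prod>i<d. \<integral>\<^sup>+t. ennreal (exp (0 * t\<^sup>2 + h i * t) * exp (- ((h i)\<^sup>2 / 2))) \<partial>gauss 0 1)"
    unfolding std_gaussian_eq by (rule nn_integral_prod_gauss) auto
  also have "\<dots> = (\<Prod>i<d. 1)"
  proof (rule prod.cong[OF refl])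
    fix i
    have "(\<integral>\<^sup>+t. ennreal (exp (0 * t\<^sup>2 + h i * t) * exp (- ((h i)\<^sup>2 / 2))) \<partial>gauss 0 1)
       = (\<integral>\<^sup>+t. ennreal (exp (0 * t\<^sup>2 + h i * t)) * ennreal (exp (- ((h i)\<^sup>2 / 2))) \<partial>gauss 0 1)"
      by (simp add: ennreal_mult')
    also have "\<dots> = ennreal (exp ((h i)\<^sup>2 / 2)) * ennreal (exp (- ((h i)\<^sup>2 / 2)))"
      using gauss_exp_quadratic[of 1 0 "h i"] by (subst nn_integral_multc) auto
    also have "\<dots> = 1" by (simp add: ennreal_mult'[symmetric] exp_add[symmetric])
    finally show "(\<integral>\<^sup>+t. ennreal (exp (0 * t\<^sup>2 + h i * t) * exp (- ((h i)\<^sup>2 / 2))) \<partial>gauss 0 1) = 1" .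
  qed
  finally show ?thesis by simp
qed

lemma noisy_in_space [simp]: "noisy d l x z \<in> space (Rd d)"
  by (auto simp: space_Rd)

text \<open>The hypothesis on the likelihood ratios says that no centre is closer to \<open>y\<close> than \<open>x\<close> by more than
  \<open>2 / l * ln (1 / \<beta>)\<close> in squared distance, and the triangle inequality carries this over to the whole
  support.\<close>

lemma MLE_error_bound_given_signal:
  assumes lm: "0 < lmin" "lmin \<le> lmax" and d: "1 \<le> d" and l: "l \<in> {lmin..lmax}"
    and P: "P \<in> prob_measures d" and mle: "constrained_MLE d P {lmin..lmax} f"
    and T: "T \<subseteq> space (Rd d)" "finite T" "supp d P \<subseteq> (\<Union>x\<in>T. eball d x (r0 d lmin lmax))"
    and \<beta>: "0 < \<beta>" "\<beta> \<le> 1"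
    and x: "x \<in> space (Rd d)"
    and c: "c \<in> T" "x \<in> eball d c (r0 d lmin lmax)" "\<beta> \<le> measure P (eball d c (r0 d lmin lmax))"
    and cb: "\<And>c. c \<in> T \<Longrightarrow>
      exp ((\<Sum>i<d. (z i)\<^sup>2) / 2 - l / 2 * (edist d c (noisy d l x z))\<^sup>2) \<le> 1 / \<beta>"
  shows "\<bar>f (noisy d l x z) - l\<bar>
    \<le> lmax * (5 * \<bar>(\<Sum>i<d. (z i)\<^sup>2) - real d\<bar> + 6 * ln (1 / \<beta>) + 14) / real d"
proof -
  define y where "y = noisy d l x z"
  define V where "V = (\<Sum>i<d. (z i)\<^sup>2)"
  define r where "r = r0 d lmin lmax"
  define s where "s = sqrt (V / l)"
  define L where "L = ln (1 / \<beta>)"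
  have l0: "0 < l" using l lm by auto
  have y: "y \<in> space (Rd d)" by (simp add: y_def)
  have V0: "0 \<le> V" by (simp add: V_def sum_nonneg)
  have L0: "0 \<le> L" using \<beta> by (simp add: L_def)
  have r: "r = sqrt lmin / (lmax * sqrt (real d))" by (simp add: r_def r0_def)
  have r_nn: "0 \<le> r" using lm by (simp add: r)
  have s_nn: "0 \<le> s" using V0 l0 by (simp add: s_def)
  have s2: "s\<^sup>2 = V / l" using V0 l0 by (simp add: s_def)
  have ex: "edist d x y = s"
    using edist_noisy_sq[OF l0, of d x z] edist_nonneg[of d x y]
    by (simp add: s_def V_def y_def real_sqrt_unique)
  have fy: "lmin \<le> f y" "f y \<le> lmax" and opt: "\<And>q. q \<in> {lmin..lmax} \<Longrightarrow> neg_log_lik d P (f y) y \<le> neg_log_lik d P q y"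
    using mle y by (auto simp: constrained_MLE_def is_arg_min_linorder)
  have opt': "real d / 2 * ln q + log_partition d P y q \<le> real d / 2 * ln (f y) + log_partition d P y (f y)"
    if "lmin \<le> q" "q \<le> lmax" for q
    using opt[of q] that fy lm neg_log_lik_eq[OF P y, of q] neg_log_lik_eq[OF P y, of "f y"] by simp
  have up: "- log_partition d P y q \<le> L + q / 2 * (s + 2 * r)\<^sup>2" if "0 < q" for q
    using log_partition_ge[OF P y that _ c(2) \<beta>(1) c(3)] c(1) T(1) \<beta>
    by (auto simp: L_def r_def ex ln_div)
  have far: "s\<^sup>2 - 2 / l * L - 2 * r * s - r\<^sup>2 \<le> (edist d w y)\<^sup>2" if w: "w \<in> supp d P" for w
  proof (cases "s \<le> edist d w y")
    case True
    then have "s\<^sup>2 \<le> (edist d w y)\<^sup>2" using s_nn by (intro power_mono) auto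
    moreover have "0 \<le> 2 / l * L" "0 \<le> 2 * r * s" using l0 L0 r_nn s_nn by auto
    ultimately show ?thesis using zero_le_power2[of r] by linarith
  next
    case False
    obtain c' where c': "c' \<in> T" "w \<in> eball d c' r" using T(3) w by (auto simp: r_def)
    have "ln (exp (V / 2 - l / 2 * (edist d c' y)\<^sup>2)) \<le> ln (1 / \<beta>)"
      using cb[OF c'(1)] by (intro ln_mono) (auto simp: V_def y_def)
    then have "V / 2 - l / 2 * (edist d c' y)\<^sup>2 \<le> L" by (simp only: ln_exp L_def)
    then have "V / l - 2 / l * L \<le> (edist d c' y)\<^sup>2" using l0 by (simp add: field_simps)
    also have "\<dots> \<le> (edist d w y + r)\<^sup>2"
      using edist_triangle[of d c' y w] c' by (intro power_mono) (auto simp: eball_def)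
    also have "\<dots> = (edist d w y)\<^sup>2 + 2 * r * edist d w y + r\<^sup>2" by (simp add: power2_sum)
    also have "2 * r * edist d w y \<le> 2 * r * s" using False r_nn by (intro mult_left_mono) auto
    finally show ?thesis by (simp add: s2)
  qed
  have lo: "q / 2 * (s\<^sup>2 - 2 / l * L - 2 * r * s - r\<^sup>2) \<le> - log_partition d P y q" if "0 < q" for q
  proof -
    have "AE w in P. s\<^sup>2 - 2 / l * L - 2 * r * s - r\<^sup>2 \<le> (edist d w y)\<^sup>2"
      using AE_in_supp[OF P] by eventually_elim (rule far)
    from log_partition_le[OF P y that this] show ?thesis by linarith
  qed
  have "\<bar>f y - l\<bar> \<le> lmax * (5 * \<bar>V - real d\<bar> + 6 * L + 14) / real d"
    by (rule minimiser_error_bound[OF convex_on_log_partition[OF P y] log_partition_0[OF P] lm(1) fy _ _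
          opt' _ V0 L0 s_def r up lo]) (use l d in auto)
  then show ?thesis by (simp add: y_def V_def L_def)
qed

lemma square_ennreal_le:
  assumes "\<bar>a - b\<bar> \<le> c"
  shows "ennreal ((a - b)\<^sup>2) \<le> ennreal (c\<^sup>2)"
  using power_mono[OF assms, of 2] by (intro ennreal_leI) simp

text \<open>There are two exceptional cases, with error at most \<open>lmax - lmin\<close>: \<open>x\<close> may lie in a cell of mass below
  \<open>\<beta>\<close>, or some likelihood ratio may exceed \<open>1 / \<beta>\<close>.  Both are charged to nonnegative functions of mean
  at most \<open>1 / (2 d)\<close>, so that the risk is bounded by integrating one pointwise inequality.\<close>

lemma MLE_risk_bound:
  assumes lm: "0 < lmin" "lmin \<le> lmax" and d: "1 \<le> d" and l: "l \<in> {lmin..lmax}"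
    and P: "P \<in> LD_class d k R lmin lmax" and mle: "constrained_MLE d P {lmin..lmax} f"
  shows "(\<integral>\<^sup>+y. ennreal ((f y - l)\<^sup>2) \<partial>obs_law d P l)
    \<le> ennreal ((lmax - lmin)\<^sup>2 / real d
        + lmax\<^sup>2 * (4800 / real d + 392 * (k + ln (2 * real d))\<^sup>2 / (real d)\<^sup>2))"
proof -
  define r where "r = r0 d lmin lmax"
  have P': "P \<in> prob_measures d" and supp: "supp d P \<subseteq> eball d (origin d) R"
    and cov: "1 + ln (real (covering_number d (supp d P) r)) \<le> k"
    using P by (auto simp: LD_class_def r_def)
  have r_pos: "0 < r" using lm d by (simp add: r_def r0_def)
  obtain T where T: "T \<subseteq> space (Rd d)" "finite T" "card T = covering_number d (supp d P) r"
    "supp d P \<subseteq> (\<Union>x\<in>T. eball d x r)"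
    using covering_number_attained[OF supp r_pos] .
  interpret P: prob_space P by (rule prob_space_P[OF P'])
  interpret S: prob_space "std_gaussian d" by (rule prob_space_std_gaussian)
  note sets_P[OF P', measurable_cong]
  have spP: "space P = space (Rd d)" by (rule space_P[OF P'])
  have "supp d P \<noteq> {}"
  proof
    assume "supp d P = {}"
    then have "AE x in P. False" using AE_in_supp[OF P'] by simp
    then show False by simp
  qed
  then have "T \<noteq> {}" using T by auto
  then have N1: "1 \<le> real (card T)" using T(2) card_gt_0_iff[of T] by simp
  \<comment> \<open>Cells lighter than \<beta> carry total mass at most 1/(2d).\<close>
  define \<beta> where "\<beta> = 1 / (2 * real d * real (card T))"
  have "1 * 1 \<le> 2 * real d * real (card T)" using N1 d by (intro mult_mono) auto
  then have \<beta>: "0 < \<beta>" "\<beta> \<le> 1" by (auto simp: \<beta>_def)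
  define L where "L = ln (1 / \<beta>)"
  have L_eq: "L = ln (2 * real d) + ln (real (card T))"
    using N1 d by (simp add: L_def \<beta>_def ln_mult_pos)
  have L_le: "L \<le> k - 1 + ln (2 * real d)" using cov T(3) L_eq by simp
  have L_nn: "0 \<le> L" using \<beta> by (simp add: L_def)
  define D where "D = (lmax - lmin)\<^sup>2"
  have D_nn: "0 \<le> D" by (simp add: D_def)
  define T' where "T' = {c \<in> T. measure P (eball d c r) < \<beta>}"
  have T'T: "T' \<subseteq> T" by (auto simp: T'_def)
  then have fT': "finite T'" using T(2) finite_subset by blast
  let ?lr = "\<lambda>c x z. exp ((\<Sum>i<d. (z i)\<^sup>2) / 2 - l / 2 * (edist d c (noisy d l x z))\<^sup>2)"
  let ?e = "\<lambda>z::nat\<Rightarrow>real. (\<Sum>i<d. (z i)\<^sup>2) - real d"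
  define a where "a x = ennreal D * (\<Sum>c\<in>T'. indicator (eball d c r) x)" for x
  define b where "b = ennreal (2 * lmax\<^sup>2 * (6 * L + 14)\<^sup>2 / (real d)\<^sup>2)"
  have mf [measurable]: "f \<in> borel_measurable (Rd d)"
    using mle by (auto simp: constrained_MLE_def estimators_def measurable_restrict_space2_iff)
  have f_range: "f y \<in> {lmin..lmax}" if "y \<in> space (Rd d)" for y
    using mle that by (auto simp: constrained_MLE_def is_arg_min_linorder)
  have trivial: "ennreal ((f (noisy d l x z) - l)\<^sup>2) \<le> ennreal D" for x z
    unfolding D_def using f_range[OF noisy_in_space[where l = l and x = x and z = z]] l by (intro square_ennreal_le) auto
  have pt: "ennreal ((f (noisy d l x z) - l)\<^sup>2)
      \<le> a x + ennreal (D * \<beta>) * (\<Sum>c\<in>T. ennreal (?lr c x z))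
        + ennreal (50 * lmax\<^sup>2 / (real d)\<^sup>2) * ennreal ((?e z)\<^sup>2) + b"
    if x: "x \<in> supp d P" for x z
  proof -
    have xs: "x \<in> space (Rd d)" using x by (auto simp: supp_def)
    consider (light) c where "c \<in> T'" "x \<in> eball d c r"
      | (noise) c where "c \<in> T" "1 / \<beta> < ?lr c x z"
      | (good) c where "c \<in> T" "x \<in> eball d c r" "\<beta> \<le> measure P (eball d c r)"
          "\<And>c. c \<in> T \<Longrightarrow> ?lr c x z \<le> 1 / \<beta>"
    proof -
      obtain c where c: "c \<in> T" "x \<in> eball d c r" using T(4) x by auto
      show thesis
      proof (cases "c \<in> T'")
        case True then show ?thesis using c that(1) by blast
      next
        case False
        then have "\<beta> \<le> measure P (eball d c r)" using c by (auto simp: T'_def)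
        then show ?thesis using that(2) that(3)[OF c] by (meson not_le)
      qed
    qed
    then show ?thesis
    proof cases
      case light
      have "ennreal D * 1 \<le> a x"
        unfolding a_def
      proof (rule mult_left_mono)
        have "indicator (eball d c r) x \<le> (\<Sum>c\<in>T'. indicator (eball d c r) x :: ennreal)"
          by (rule member_le_sum[OF light(1)]) (use fT' in auto)
        then show "1 \<le> (\<Sum>c\<in>T'. indicator (eball d c r) x :: ennreal)" using light(2) by simp
      qed simp
      then show ?thesis using trivial[of x z] by (auto intro!: add_increasing2 intro: order_trans)
    next
      case noise
      have "ennreal D = ennreal (D * \<beta>) * ennreal (1 / \<beta>)"
        using \<beta> D_nn by (simp add: ennreal_mult[symmetric])
      also have "\<dots> \<le> ennreal (D * \<beta>) * (\<Sum>c\<in>T. ennreal (?lr c x z))"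
      proof (rule mult_left_mono)
        have "ennreal (1 / \<beta>) \<le> ennreal (?lr c x z)" using noise by (intro ennreal_leI) simp
        also have "\<dots> \<le> (\<Sum>c\<in>T. ennreal (?lr c x z))"
          by (rule member_le_sum[OF noise(1)]) (use T in auto)
        finally show "ennreal (1 / \<beta>) \<le> (\<Sum>c\<in>T. ennreal (?lr c x z))" .
      qed simp
      finally have "ennreal D \<le> ennreal (D * \<beta>) * (\<Sum>c\<in>T. ennreal (?lr c x z))" .
      then show ?thesis using trivial[of x z]
        by (auto intro!: add_increasing2 add_increasing[of "a x"] intro: order_trans)
    next
      case good
      let ?p = "5 * lmax * \<bar>?e z\<bar> / real d" and ?q = "lmax * (6 * L + 14) / real d"
      have "\<bar>f (noisy d l x z) - l\<bar> \<le> lmax * (5 * \<bar>?e z\<bar> + 6 * L + 14) / real d"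
        unfolding L_def
        by (rule MLE_error_bound_given_signal[OF lm d l P' mle T(1,2,4)[unfolded r_def] \<beta> xs
              good(1) good(2)[unfolded r_def] good(3)[unfolded r_def] good(4)])
      also have "\<dots> = ?p + ?q" by (simp add: add_divide_distrib algebra_simps)
      finally have err: "ennreal ((f (noisy d l x z) - l)\<^sup>2) \<le> ennreal ((?p + ?q)\<^sup>2)"
        by (rule square_ennreal_le)
      have "(?p + ?q)\<^sup>2 \<le> 2 * ?p\<^sup>2 + 2 * ?q\<^sup>2"
        using sum_squares_bound[of ?p ?q] by (simp add: power2_sum)
      also have "2 * ?p\<^sup>2 + 2 * ?q\<^sup>2 = 50 * lmax\<^sup>2 / (real d)\<^sup>2 * (?e z)\<^sup>2 + 2 * lmax\<^sup>2 * (6 * L + 14)\<^sup>2 / (real d)\<^sup>2"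
        by (simp add: power_mult_distrib power_divide)
      finally have "ennreal ((?p + ?q)\<^sup>2) \<le> ennreal \<dots>" by (rule ennreal_leI)
      also have "\<dots> = ennreal (50 * lmax\<^sup>2 / (real d)\<^sup>2) * ennreal ((?e z)\<^sup>2) + b"
        unfolding b_def by (simp add: ennreal_mult[symmetric] ennreal_plus[symmetric] del: ennreal_plus)
      finally show ?thesis by (intro order_trans[OF err]) (simp add: add_increasing add.assoc)
    qed
  qed
  have m_lr [measurable]: "(\<lambda>z. ?lr c x z) \<in> borel_measurable (std_gaussian d)"
    if "c \<in> T" "x \<in> space (Rd d)" for c x
  proof -
    have c: "c \<in> space (Rd d)" using that T by auto
    have 1: "(\<lambda>z. \<Sum>i<d. (z i)\<^sup>2) \<in> borel_measurable (std_gaussian d)"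
      unfolding measurable_cong_sets[OF sets_std_gaussian refl]
      by (intro borel_measurable_sum borel_measurable_power measurable_coordinate) auto
    have 2: "(\<lambda>z. noisy d l x z) \<in> std_gaussian d \<rightarrow>\<^sub>M Rd d"
      unfolding measurable_cong_sets[OF sets_std_gaussian refl] by (rule measurable_noisy)
    have 3: "(\<lambda>z. edist d c (noisy d l x z)) \<in> borel_measurable (std_gaussian d)"
      by (rule measurable_edist[OF measurable_const[OF c] 2])
    show ?thesis using 1 3 by measurable
  qed
  have m_e [measurable]: "(\<lambda>z. ?e z) \<in> borel_measurable (std_gaussian d)"
    unfolding measurable_cong_sets[OF sets_std_gaussian refl]
    by (intro borel_measurable_diff borel_measurable_sum borel_measurable_power measurable_coordinate) auto
  have inner: "(\<integral>\<^sup>+z. ennreal ((f (noisy d l x z) - l)\<^sup>2) \<partial>std_gaussian d)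
      \<le> a x + (ennreal (D * \<beta>) * of_nat (card T) + ennreal (50 * lmax\<^sup>2 / (real d)\<^sup>2) * ennreal (96 * real d) + b)"
    if x: "x \<in> supp d P" for x
  proof -
    have xs: "x \<in> space (Rd d)" using x by (auto simp: supp_def)
    have "(\<integral>\<^sup>+z. ennreal ((f (noisy d l x z) - l)\<^sup>2) \<partial>std_gaussian d)
      \<le> (\<integral>\<^sup>+z. a x + ennreal (D * \<beta>) * (\<Sum>c\<in>T. ennreal (?lr c x z))
        + ennreal (50 * lmax\<^sup>2 / (real d)\<^sup>2) * ennreal ((?e z)\<^sup>2) + b \<partial>std_gaussian d)"
      by (intro nn_integral_mono pt x)
    also have "\<dots> = a x + ennreal (D * \<beta>) * (\<Sum>c\<in>T. \<integral>\<^sup>+z. ennreal (?lr c x z) \<partial>std_gaussian d)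
        + ennreal (50 * lmax\<^sup>2 / (real d)\<^sup>2) * (\<integral>\<^sup>+z. ennreal ((?e z)\<^sup>2) \<partial>std_gaussian d) + b"
      using m_lr[OF _ xs]
      by (subst nn_integral_add nn_integral_cmult nn_integral_sum
          | (rule borel_measurable_add borel_measurable_const borel_measurable_times_ennreal borel_measurable_sum)
          | simp add: S.emeasure_space_1)+
    also have "(\<Sum>c\<in>T. \<integral>\<^sup>+z. ennreal (?lr c x z) \<partial>std_gaussian d) = of_nat (card T)"
      using likelihood_ratio_mean_one[of l d _ x] l lm by simp
    also have "a x + ennreal (D * \<beta>) * of_nat (card T)
        + ennreal (50 * lmax\<^sup>2 / (real d)\<^sup>2) * (\<integral>\<^sup>+z. ennreal ((?e z)\<^sup>2) \<partial>std_gaussian d) + b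
      \<le> a x + ennreal (D * \<beta>) * of_nat (card T)
        + ennreal (50 * lmax\<^sup>2 / (real d)\<^sup>2) * ennreal (96 * real d) + b"
      by (intro add_mono mult_left_mono chi_square_variance_bound d order_refl) simp
    finally show ?thesis by (simp only: add.assoc)
  qed
  have cell [measurable]: "eball d c r \<in> sets P" if "c \<in> T'" for c
    using that T(1) T'T sets_eball sets_P[OF P'] by blast
  have "(\<integral>\<^sup>+x. a x \<partial>P) = ennreal D * (\<Sum>c\<in>T'. emeasure P (eball d c r))"
    unfolding a_def by (subst nn_integral_cmult) (auto simp: nn_integral_sum cell)
  also have "\<dots> \<le> ennreal D * (\<Sum>c\<in>T'. ennreal \<beta>)"
    by (intro mult_left_mono sum_mono) (auto simp: P.emeasure_eq_measure T'_def intro!: ennreal_leI)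
  also have "(\<Sum>c\<in>T'. ennreal \<beta>) = ennreal (real (card T') * \<beta>)"
    using \<beta> by (simp add: ennreal_mult ennreal_of_nat_eq_real_of_nat)
  also have "real (card T') * \<beta> \<le> real (card T) * \<beta>"
    using \<beta> card_mono[OF T(2) T'T] by (intro mult_right_mono) auto
  also have "real (card T) * \<beta> = 1 / (2 * real d)" using N1 by (simp add: \<beta>_def)
  finally have int_a: "(\<integral>\<^sup>+x. a x \<partial>P) \<le> ennreal (D / (2 * real d))"
    using D_nn by (simp add: ennreal_mult[symmetric] ennreal_leI mult_left_mono)
  have m_a: "a \<in> borel_measurable P" unfolding a_def using cell by measurable
  have "(\<integral>\<^sup>+y. ennreal ((f y - l)\<^sup>2) \<partial>obs_law d P l)
     = (\<integral>\<^sup>+x. \<integral>\<^sup>+z. ennreal ((f (noisy d l x z) - l)\<^sup>2) \<partial>std_gaussian d \<partial>P)"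
    by (rule nn_integral_obs_law[OF P']) measurable
  also have "\<dots> \<le> (\<integral>\<^sup>+x. a x + (ennreal (D * \<beta>) * of_nat (card T) + ennreal (50 * lmax\<^sup>2 / (real d)\<^sup>2) * ennreal (96 * real d) + b) \<partial>P)"
    by (rule nn_integral_mono_AE, rule eventually_mono[OF AE_in_supp[OF P'] inner])
  also have "\<dots> = (\<integral>\<^sup>+x. a x \<partial>P) + (ennreal (D * \<beta>) * of_nat (card T) + ennreal (50 * lmax\<^sup>2 / (real d)\<^sup>2) * ennreal (96 * real d) + b)"
    using m_a by (subst nn_integral_add) (auto simp: P.emeasure_space_1)
  also have "\<dots> \<le> ennreal (D / (2 * real d)) + (ennreal (D * \<beta>) * of_nat (card T) + ennreal (50 * lmax\<^sup>2 / (real d)\<^sup>2) * ennreal (96 * real d) + b)"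
    by (intro add_mono int_a order_refl)
  also have "ennreal (D * \<beta>) * of_nat (card T) = ennreal (D / (2 * real d))"
    using N1 D_nn \<beta> unfolding ennreal_of_nat_eq_real_of_nat
    by (subst ennreal_mult[symmetric]) (auto simp: \<beta>_def)
  also have "ennreal (D / (2 * real d)) + (ennreal (D / (2 * real d)) + ennreal (50 * lmax\<^sup>2 / (real d)\<^sup>2) * ennreal (96 * real d) + b)
     = ennreal (D / (2 * real d) + (D / (2 * real d) + 50 * lmax\<^sup>2 / (real d)\<^sup>2 * (96 * real d) + 2 * lmax\<^sup>2 * (6 * L + 14)\<^sup>2 / (real d)\<^sup>2))"
    unfolding b_def using D_nn
    by (simp add: ennreal_mult[symmetric] ennreal_plus[symmetric] del: ennreal_plus)
  also have "\<dots> \<le> ennreal (D / real d + lmax\<^sup>2 * (4800 / real d + 392 * (k + ln (2 * real d))\<^sup>2 / (real d)\<^sup>2))"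
  proof (rule ennreal_leI)
    have 1: "D / (2 * real d) + D / (2 * real d) = D / real d" using d by simp
    have 2: "50 * lmax\<^sup>2 / (real d)\<^sup>2 * (96 * real d) = lmax\<^sup>2 * (4800 / real d)"
      using d by (simp add: power2_eq_square)
    have ln2: "0 \<le> ln (2 * real d)" using d by simp
    have "6 * L + 14 \<le> 14 * (k + ln (2 * real d))"
    proof -
      have "0 \<le> ln (real (card T))" using N1 by simp
      then have "1 \<le> k" using cov T(3) by simp
      then show ?thesis using L_le ln2 by argo
    qed
    then have "(6 * L + 14)\<^sup>2 \<le> (14 * (k + ln (2 * real d)))\<^sup>2"
      using L_nn by (intro power_mono) auto
    then have "2 * lmax\<^sup>2 / (real d)\<^sup>2 * (6 * L + 14)\<^sup>2 \<le> 2 * lmax\<^sup>2 / (real d)\<^sup>2 * (14 * (k + ln (2 * real d)))\<^sup>2"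
      by (intro mult_left_mono) auto
    then have 3: "2 * lmax\<^sup>2 * (6 * L + 14)\<^sup>2 / (real d)\<^sup>2 \<le> lmax\<^sup>2 * (392 * (k + ln (2 * real d))\<^sup>2 / (real d)\<^sup>2)"
      unfolding power_mult_distrib[of 14] by (simp add: mult_ac)
    show "D / (2 * real d) + (D / (2 * real d) + 50 * lmax\<^sup>2 / (real d)\<^sup>2 * (96 * real d) + 2 * lmax\<^sup>2 * (6 * L + 14)\<^sup>2 / (real d)\<^sup>2)
      \<le> D / real d + lmax\<^sup>2 * (4800 / real d + 392 * (k + ln (2 * real d))\<^sup>2 / (real d)\<^sup>2)"
      unfolding 2 distrib_left using 1 3 by (simp only: add.assoc[symmetric])
  qed
  finally show ?thesis by (simp add: D_def)
qed

section \<open>The minimax rate\<close>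

lemma max_risk_trivial:
  assumes P: "P \<in> prob_measures d" and f: "f \<in> estimators d {lmin..lmax}"
  shows "max_risk d P {lmin..lmax} f \<le> ennreal ((lmax - lmin)\<^sup>2)"
  unfolding max_risk_def
proof (rule SUP_least)
  fix l assume l: "l \<in> {lmin..lmax}"
  interpret P: prob_space P by (rule prob_space_P[OF P])
  interpret S: prob_space "std_gaussian d" by (rule prob_space_std_gaussian)
  have "(\<integral>\<^sup>+y. ennreal ((f y - l)\<^sup>2) \<partial>obs_law d P l) \<le> (\<integral>\<^sup>+y. ennreal ((lmax - lmin)\<^sup>2) \<partial>obs_law d P l)"
  proof (rule nn_integral_mono)
    fix y assume "y \<in> space (obs_law d P l)"
    then have "y \<in> space (Rd d)" by (simp add: obs_law_def)
    then have "f y \<in> {lmin..lmax}"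
      using f measurable_space[of f "Rd d" "restrict_space borel {lmin..lmax}"] by (auto simp: estimators_def)
    then show "ennreal ((f y - l)\<^sup>2) \<le> ennreal ((lmax - lmin)\<^sup>2)"
      using l by (intro square_ennreal_le) auto
  qed
  also have "\<dots> = ennreal ((lmax - lmin)\<^sup>2)"
    by (subst nn_integral_obs_law[OF P]) (auto simp: S.emeasure_space_1 P.emeasure_space_1)
  finally show "(\<integral>\<^sup>+y. ennreal ((f y - l)\<^sup>2) \<partial>obs_law d P l) \<le> ennreal ((lmax - lmin)\<^sup>2)" .
qed

lemma half_le_ln_2d:
  assumes "1 \<le> d" shows "1 / 2 \<le> ln (2 * real d)"
proof -
  have "1 / 2 \<le> ln (2::real)" using ln2_ge_two_thirds by simp
  also have "\<dots> \<le> ln (2 * real d)" using assms by (intro ln_mono) auto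
  finally show ?thesis .
qed

lemma MLE_max_risk:
  assumes lm: "0 < lmin" "lmin < lmax" and d: "1 \<le> d"
    and P: "P \<in> LD_class d k R lmin lmax" and mle: "constrained_MLE d P {lmin..lmax} f"
  shows "max_risk d P {lmin..lmax} f \<le> ennreal (10000 * min ((lmax - lmin)\<^sup>2)
    (lmax ^ 4 / lmin\<^sup>2 * (ln (2 * real d) / real d + (k + ln (2 * real d))\<^sup>2 / (real d)\<^sup>2)))"
proof -
  let ?L = "ln (2 * real d)" and ?D = "(lmax - lmin)\<^sup>2" and ?G = "lmax ^ 4 / lmin\<^sup>2"
  let ?T = "(k + ?L)\<^sup>2 / (real d)\<^sup>2"
  have L: "1 / 2 \<le> ?L" by (rule half_le_ln_2d[OF d])
  have P': "P \<in> prob_measures d" using P by (simp add: LD_class_def)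
  have G: "lmax\<^sup>2 \<le> ?G"
  proof -
    have "lmax\<^sup>2 * lmin\<^sup>2 \<le> lmax\<^sup>2 * lmax\<^sup>2" using lm by (intro mult_left_mono power_mono) auto
    also have "\<dots> = lmax ^ 4" by (simp add: power_add[symmetric])
    finally show ?thesis using lm by (simp add: pos_le_divide_eq)
  qed
  have bd: "?D / real d + lmax\<^sup>2 * (4800 / real d + 392 * ?T) \<le> 10000 * (?G * (?L / real d + ?T))"
  proof -
    have "?D \<le> lmax\<^sup>2" using lm by (intro power_mono) auto
    then have "?D / real d \<le> lmax\<^sup>2 * (1 / real d)" using divide_right_mono[of ?D "lmax\<^sup>2" "real d"] by simp
    then have "?D / real d + lmax\<^sup>2 * (4800 / real d + 392 * ?T) \<le> lmax\<^sup>2 * (1 / real d) + lmax\<^sup>2 * (4800 / real d + 392 * ?T)"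
      by simp
    also have "\<dots> = lmax\<^sup>2 * (4801 * (1 / real d) + 392 * ?T)" by (simp add: algebra_simps)
    also have "\<dots> \<le> ?G * (10000 * (?L / real d) + 10000 * ?T)"
    proof (rule mult_mono[OF G])
      have "1 / real d \<le> 2 * (?L / real d)" using L divide_right_mono[of 1 "2 * ?L" "real d"] by simp
      moreover have "0 \<le> ?L / real d" using L by simp
      moreover have "0 \<le> ?T" by simp
      ultimately show "4801 * (1 / real d) + 392 * ?T \<le> 10000 * (?L / real d) + 10000 * ?T" by linarith
    qed (use lm in auto)
    finally show ?thesis by (simp add: algebra_simps)
  qed
  have 1: "max_risk d P {lmin..lmax} f \<le> ennreal (10000 * (?G * (?L / real d + ?T)))"
    unfolding max_risk_def
  proof (rule SUP_least)
    fix l assume l: "l \<in> {lmin..lmax}"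
    show "(\<integral>\<^sup>+y. ennreal ((f y - l)\<^sup>2) \<partial>obs_law d P l) \<le> ennreal (10000 * (?G * (?L / real d + ?T)))"
      using MLE_risk_bound[OF lm(1) less_imp_le[OF lm(2)] d l P mle] bd
      by (intro order_trans[OF _ ennreal_leI[OF bd]]) simp
  qed
  have "max_risk d P {lmin..lmax} f \<le> ennreal ?D"
    using mle by (intro max_risk_trivial[OF P']) (simp add: constrained_MLE_def)
  also have "\<dots> \<le> ennreal (10000 * ?D)" by (rule ennreal_leI) simp
  finally have 2: "max_risk d P {lmin..lmax} f \<le> ennreal (10000 * ?D)" .
  show ?thesis using 1 2 by (simp only: min_def split: if_split) blast
qed

text \<open>The logarithms are bounded away from 0, so they can be pulled out at the price of a constant.\<close>

lemma MLE_rate_le: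
  assumes lm: "0 < lmin" and d: "1 \<le> d" and D: "0 \<le> D"
  shows "10000 * min D (lmax ^ 4 / lmin\<^sup>2 * (ln (2 * real d) / real d + (k + ln (2 * real d))\<^sup>2 / (real d)\<^sup>2))
    \<le> 10000 * (8 * (lmax ^ 4 / lmin\<^sup>2) + 4) * ln (2 * real d) powr 2 * min D (1 / real d + k\<^sup>2 / (real d)\<^sup>2)"
proof -
  let ?L = "ln (2 * real d)" and ?G = "lmax ^ 4 / lmin\<^sup>2" and ?x = "1 / real d + k\<^sup>2 / (real d)\<^sup>2"
  have L: "1 / 2 \<le> ?L" by (rule half_le_ln_2d[OF d])
  have L2: "1 \<le> 4 * ?L\<^sup>2" using power_mono[OF L, of 2] by (simp add: power2_eq_square)
  have G: "0 \<le> ?G" by simp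
  have x: "0 \<le> ?x" by simp
  have "?L / real d \<le> 2 * ?L\<^sup>2 / real d"
    using L by (intro divide_right_mono) (auto simp: power2_eq_square)
  moreover have "(k + ?L)\<^sup>2 / (real d)\<^sup>2 \<le> 8 * ?L\<^sup>2 * (k\<^sup>2 / (real d)\<^sup>2) + 2 * ?L\<^sup>2 / real d"
  proof -
    have "(k + ?L)\<^sup>2 \<le> 2 * k\<^sup>2 + 2 * ?L\<^sup>2" using sum_squares_bound[of k ?L] by (simp add: power2_sum)
    also have "2 * k\<^sup>2 \<le> 8 * ?L\<^sup>2 * k\<^sup>2" using mult_right_mono[OF L2, of "2 * k\<^sup>2"] by simp
    finally have "(k + ?L)\<^sup>2 / (real d)\<^sup>2 \<le> (8 * ?L\<^sup>2 * k\<^sup>2 + 2 * ?L\<^sup>2) / (real d)\<^sup>2"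
      by (intro divide_right_mono) auto
    also have "\<dots> = 8 * ?L\<^sup>2 * (k\<^sup>2 / (real d)\<^sup>2) + 2 * ?L\<^sup>2 / (real d)\<^sup>2" by (simp add: add_divide_distrib)
    also have "2 * ?L\<^sup>2 / (real d)\<^sup>2 \<le> 2 * ?L\<^sup>2 / real d"
      using d by (intro divide_left_mono) (auto simp: power2_eq_square)
    finally show ?thesis by simp
  qed
  ultimately have "?L / real d + (k + ?L)\<^sup>2 / (real d)\<^sup>2 \<le> 2 * ?L\<^sup>2 / real d + (8 * ?L\<^sup>2 * (k\<^sup>2 / (real d)\<^sup>2) + 2 * ?L\<^sup>2 / real d)"
    by (rule add_mono)
  also have "\<dots> \<le> 8 * ?L\<^sup>2 * ?x"
  proof -
    have "2 * ?L\<^sup>2 / real d + (8 * ?L\<^sup>2 * (k\<^sup>2 / (real d)\<^sup>2) + 2 * ?L\<^sup>2 / real d) = 8 * ?L\<^sup>2 * ?x - 4 * ?L\<^sup>2 / real d"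
      by (simp add: algebra_simps)
    moreover have "0 \<le> 4 * ?L\<^sup>2 / real d" by simp
    ultimately show ?thesis by linarith
  qed
  finally have le: "?G * (?L / real d + (k + ?L)\<^sup>2 / (real d)\<^sup>2) \<le> ?G * (8 * ?L\<^sup>2 * ?x)"
    by (rule mult_left_mono) (rule G)
  have D4: "D \<le> 4 * ?L\<^sup>2 * D" using mult_right_mono[OF L2 D] by simp
  have "min D (?G * (?L / real d + (k + ?L)\<^sup>2 / (real d)\<^sup>2)) \<le> (8 * ?G + 4) * ?L\<^sup>2 * min D ?x"
  proof (cases "D \<le> ?x")
    case True
    have "4 * ?L\<^sup>2 * D \<le> (8 * ?G + 4) * ?L\<^sup>2 * D" using G D by (intro mult_right_mono) auto
    then show ?thesis using True D4 by (simp add: min_def)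
  next
    case False
    have up: "?G * (8 * ?L\<^sup>2 * ?x) \<le> (8 * ?G + 4) * ?L\<^sup>2 * ?x"
    proof -
      have "(8 * ?G + 4) * ?L\<^sup>2 * ?x = ?G * (8 * ?L\<^sup>2 * ?x) + 4 * ?L\<^sup>2 * ?x" by (simp only: algebra_simps)
      moreover have "0 \<le> 4 * ?L\<^sup>2 * ?x" using x by simp
      ultimately show ?thesis by linarith
    qed
    have eq: "min D ?x = ?x" using False by simp
    show ?thesis unfolding eq by (rule min.coboundedI2[OF order_trans[OF le up]])
  qed
  moreover have "?L powr 2 = ?L\<^sup>2" using L by (intro powr_numeral) auto
  ultimately show ?thesis by (simp only: mult.assoc)
qed

lemma LD_risk_le:
  assumes "\<And>P. P \<in> LD_class d k R lmin lmax \<Longrightarrow>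
      \<exists>f\<in>estimators d {lmin..lmax}. max_risk d P {lmin..lmax} f \<le> c"
  shows "LD_risk d k R lmin lmax \<le> c"
  unfolding LD_risk_def minimax_risk_def
proof (rule SUP_least)
  fix P assume "P \<in> LD_class d k R lmin lmax"
  then obtain f where "f \<in> estimators d {lmin..lmax}" "max_risk d P {lmin..lmax} f \<le> c"
    using assms by blast
  then show "(INF f\<in>estimators d {lmin..lmax}. max_risk d P {lmin..lmax} f) \<le> c"
    by (meson INF_lower order_trans)
qed

lemma scaled_min_le:
  fixes a D x :: real
  assumes "0 \<le> a" "0 \<le> D" "0 \<le> x"
  shows "min 1 a * min D x \<le> min D (a * x)"
proof -
  have "min 1 a * min D x \<le> 1 * D" using assms by (intro mult_mono) auto
  moreover have "min 1 a * min D x \<le> a * x" using assms by (intro mult_mono) auto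
  ultimately show ?thesis by simp
qed

theorem theorem3p1:
  "\<exists>c>0. \<exists>C>0. \<exists>q\<ge>0. \<forall>lmin lmax :: real. 0 < lmin \<and> lmin < lmax \<longrightarrow>
    (\<exists>c\<^sub>\<Lambda>>0. \<exists>C\<^sub>\<Lambda>>0. \<forall>K>0. \<exists>A>0.
      \<forall>(d::nat) (k::real) (R::real).
        1 \<le> d \<and> 1 \<le> k \<and> k \<le> K * real d \<and> 0 < R \<and> A * k \<le> R\<^sup>2 \<longrightarrow>
        LD_risk d k R lmin lmax \<ge>
          ennreal (c * min ((lmax - lmin)\<^sup>2) (lmin\<^sup>2 * (1 / real d + k\<^sup>2 / (real d)\<^sup>2)))
        \<and>
        (\<forall>P \<in> LD_class d k R lmin lmax. \<forall>f. constrained_MLE d P {lmin..lmax} f \<longrightarrow>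
          max_risk d P {lmin..lmax} f \<le>
            ennreal (C * min ((lmax - lmin)\<^sup>2)
              (lmax ^ 4 / lmin\<^sup>2 *
                (ln (2 * real d) / real d + (k + ln (2 * real d))\<^sup>2 / (real d)\<^sup>2))))
        \<and>
        (let m = min ((lmax - lmin)\<^sup>2) (1 / real d + k\<^sup>2 / (real d)\<^sup>2) in
          ennreal (c\<^sub>\<Lambda> * m) \<le> LD_risk d k R lmin lmax \<and>
          LD_risk d k R lmin lmax \<le> ennreal (C\<^sub>\<Lambda> * ln (2 * real d) powr q * m)))"
proof (intro exI conjI allI impI)
  show "(0::real) < 1 / 4000" "(0::real) < 10000" "(0::real) \<le> 2" by simp_all
next
  fix lmin lmax :: real
  assume lm: "0 < lmin \<and> lmin < lmax"
  let ?c = "1 / 4000 * min 1 (lmin\<^sup>2)" and ?C = "10000 * (8 * (lmax ^ 4 / lmin\<^sup>2) + 4)"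
  show "0 < ?c" using lm by simp
  have pos: "0 < 10000 * (8 * g + 4)" if "0 \<le> g" for g :: real using that by simp
  show "0 < ?C" by (rule pos) simp
  show "0 < 5 / lmin" using lm by simp
  fix K :: real and d :: nat and k R :: real
  assume H: "1 \<le> d \<and> 1 \<le> k \<and> k \<le> K * real d \<and> 0 < R \<and> 5 / lmin * k \<le> R\<^sup>2"
  show lower: "ennreal (1 / 4000 * min ((lmax - lmin)\<^sup>2) (lmin\<^sup>2 * (1 / real d + k\<^sup>2 / (real d)\<^sup>2)))
      \<le> LD_risk d k R lmin lmax"
    using LD_risk_lower[of lmin lmax d k R] lm H by blast
  have upper: "max_risk d P {lmin..lmax} f \<le> ennreal (10000 * min ((lmax - lmin)\<^sup>2)
            (lmax ^ 4 / lmin\<^sup>2 * (ln (2 * real d) / real d + (k + ln (2 * real d))\<^sup>2 / (real d)\<^sup>2)))"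
    if "P \<in> LD_class d k R lmin lmax" "constrained_MLE d P {lmin..lmax} f" for P f
    using MLE_max_risk[of lmin lmax d P k R f] lm H that by blast
  then show "\<forall>P \<in> LD_class d k R lmin lmax. \<forall>f. constrained_MLE d P {lmin..lmax} f \<longrightarrow>
      max_risk d P {lmin..lmax} f \<le> ennreal (10000 * min ((lmax - lmin)\<^sup>2)
            (lmax ^ 4 / lmin\<^sup>2 * (ln (2 * real d) / real d + (k + ln (2 * real d))\<^sup>2 / (real d)\<^sup>2)))"
    by blast
  let ?m = "min ((lmax - lmin)\<^sup>2) (1 / real d + k\<^sup>2 / (real d)\<^sup>2)"
  have "?c * ?m \<le> 1 / 4000 * min ((lmax - lmin)\<^sup>2) (lmin\<^sup>2 * (1 / real d + k\<^sup>2 / (real d)\<^sup>2))"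
    unfolding mult.assoc by (intro mult_left_mono scaled_min_le) auto
  then have rate_lower: "ennreal (?c * ?m) \<le> LD_risk d k R lmin lmax"
    by (rule order_trans[OF ennreal_leI lower])
  have rate_upper: "LD_risk d k R lmin lmax \<le> ennreal (?C * ln (2 * real d) powr 2 * ?m)"
  proof (rule LD_risk_le)
    fix P assume P: "P \<in> LD_class d k R lmin lmax"
    then obtain f where f: "constrained_MLE d P {lmin..lmax} f"
      using constrained_MLE_exists[of P d lmin lmax] lm by (auto simp: LD_class_def)
    have "max_risk d P {lmin..lmax} f \<le> ennreal (?C * ln (2 * real d) powr 2 * ?m)"
      using lm H by (intro order_trans[OF upper[OF P f] ennreal_leI] MLE_rate_le) auto
    then show "\<exists>f\<in>estimators d {lmin..lmax}. max_risk d P {lmin..lmax} f \<le> ennreal (?C * ln (2 * real d) powr 2 * ?m)"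
      using f by (auto simp: constrained_MLE_def)
  qed
  show "let m = ?m in ennreal (?c * m) \<le> LD_risk d k R lmin lmax \<and>
      LD_risk d k R lmin lmax \<le> ennreal (?C * ln (2 * real d) powr 2 * m)"
    unfolding Let_def using rate_lower rate_upper by blast
qed

end
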